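(* Let the coding system be any one of $\mathsf{K}_1$, $\mathsf{K}_2$, $\mathsf{KV}$. Then $$\mathsf{Fin}<_{\sf m}\mathsf{BddSeq}_\omega<_{\sf m}\mathsf{HalfTruth}_{\Sigma^0_2}<_{\sf m}\mathsf{DisConn}<_{\sf m}\mathsf{Truth}_{\Sigma^0_2}.$$
   Context: Coding systems. $\mathsf{K}_1$: $\mathtt{Code}=\omega$, and the (partial) realizable functions are the partial computable functions on $\omega$. $\mathsf{K}_2$: $\mathtt{Code}=\omega^\omega$, and the realizable functions are the partial continuous functions $x\mapsto p\ast x$ ($p\in\omega^\omega$), where $\ast$ is application in Kleene's second algebra. $\mathsf{KV}$: $\mathtt{Code}=\omega^\omega$ with the same application, and the realizable functions are the partial computable ones (those $x\mapsto p\ast x$ with $p$ computable). Fix one of them; $\langle\cdot,\cdot\rangle$ is a standard computable tupling on $\mathtt{Code}$. A represented space $X$ is a set $|X|$ with a partial surjection $\delta_X$ from $\mathtt{Code}$ onto $|X|$; $p$ is an $X$-name of $x$ if $\delta_X(p)=x$. A morphism $f\colon X\to Y$ is a function $|X|\to|Y|$ for which some partial realizable function sends every $X$-name of $x$ to a $Y$-name of $f(x)$. In $\mathsf{K}_1$, $n\in\omega$ has name $n$, and $\omega^\omega$ consists of the total computable functions, a name being any index; in $\mathsf{K}_2,\mathsf{KV}$, $n\in\omega$ has name $n0^\infty$, and $\omega^\omega$ consists of all functions, each named by itself. The space $(\omega^\omega)^\omega$ is identified with $\omega^\omega$ via a standard pairing bijection $\omega\times\omega\cong\omega$ (so in $\mathsf{K}_1$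 its elements are the uniformly computable sequences). A subobject $A$ of $X$ is a represented space with $|A|\subseteq|X|$ such that some partial realizable function sends every $A$-name of $x\in|A|$ to an $X$-name of $x$. Many-one reducibility: for subobjects $A$ of $X$ and $B$ of $Y$, $A\leq_{\sf m}B$ if there are a morphism $\varphi\colon X\to Y$ and partial realizable functions $r_-,r_+$ with: (1) for all $x\in|X|$, $x\in|A|\iff\varphi(x)\in|B|$; (2) if $p$ is an $A$-name of $x\in|A|$ then $r_-(p)$ is a $B$-name of $\varphi(x)$; (3) if $p$ is an $X$-name of $x\in|A|$ and $q$ is a $B$-name of $\varphi(x)$ then $r_+(p,q)$ is an $A$-name of $x$. $A<_{\sf m}B$ means $A\leq_{\sf m}B$ and not $B\leq_{\sf m}A$. The following are subobjects of $\omega^\omega$; in each case $p$ ranges over $\omega^\omega$-names of $x$ and the other entries are natural numbers. - $\mathsf{Fin}$: $|\mathsf{Fin}|=\{x:\exists n\,\forall m\geq n\; x(m)=0\}$; names of $x$ are $\langle n,p\rangle$ with $x(m)=0$ for all $m\geq n$. - $\mathsf{BddSeq}_\omega$: $|\mathsf{BddSeq}_\omega|=\{x:\exists b\,\forall n\; x(n)\leq b\}$; names of $x$ are $\langle b,p\rangle$ with $x(n)\leq b$ for all $n$. - $\mathsf{HalfTruth}_{\Sigma^0_2}$: underlying set $\{(x_n)_{n\in\omega}\in(\omega^\omega)^\omega:\exists n\; x_n=0^\infty\}$; names of $x=(x_n)_n$ are $\langle n,m,p\rangle$ with $x_n=0^\infty$ or $x_m=0^\infty$. - $\mathsf{Truth}_{\Sigma^0_2}$: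 underlying set $\{(x_n)_{n\in\omega}\in(\omega^\omega)^\omega:\exists n\; x_n=0^\infty\}$; names of $x=(x_n)_n$ are $\langle n,p\rangle$ with $x_n=0^\infty$. - $\mathsf{DisConn}$: an undirected graph $G=(V,E)$ with $V\subseteq\omega$ and $E\subseteq[V]^2=\{(u,v)\in V^2:u<v\}$ is coded by the characteristic functions of $V$ and $E$, regarded as an element of $\omega^\omega$; $G_x=(V_x,E_x)$ is the graph coded by $x$. The underlying set is the set of $x$ coding a graph $G_x$ in which not every two vertices are connected by a finite path; names of $x$ are $\langle a,b,p\rangle$ with $a,b\in V_x$ not connected by any finite path in $G_x$. *)

theory Defs
  imports "HOL-Library.Nat_Bijection"
begin

section \<open>Partial computable functions on the natural numbers\<close>

text \<open>
  Unary presentation of Kleene's \<open>\<mu>\<close>-recursive functions: a tuple of arguments is passed as a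
  single number via the Cantor pairing \<^const>\<open>prod_encode\<close>.
\<close>

datatype prog =
    Zero | Succ | Left | Right
  | Pair prog prog
  | Comp prog prog
  | Prec prog prog
  | Mu prog

text \<open>
  \<open>Prec f g\<close> maps \<open>(a, 0)\<close> to \<open>f a\<close> and \<open>(a, n + 1)\<close> to \<open>g (a, (n, h))\<close>, where \<open>h\<close> is its value at
  \<open>(a, n)\<close>.  \<open>Mu f\<close> maps \<open>a\<close> to the least \<open>n\<close> with \<open>f (a, n) = 0\<close>, provided that \<open>f (a, m)\<close> is
  defined for all \<open>m < n\<close>.
\<close>

primrec run :: "prog \<Rightarrow> nat \<rightharpoonup> nat" where
  "run Zero = (\<lambda>x. Some 0)"
| "run Succ = (\<lambda>x. Some (Suc x))"
| "run Left = (\<lambda>x. Some (fst (prod_decode x)))"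
| "run Right = (\<lambda>x. Some (snd (prod_decode x)))"
| "run (Pair f g) = (\<lambda>x. Option.bind (run f x) (\<lambda>y.
     Option.bind (run g x) (\<lambda>z. Some (prod_encode (y, z)))))"
| "run (Comp f g) = (\<lambda>x. Option.bind (run g x) (run f))"
| "run (Prec f g) = (\<lambda>x. case prod_decode x of (a, n) \<Rightarrow>
     rec_nat (run f a)
       (\<lambda>m r. Option.bind r (\<lambda>h. run g (prod_encode (a, prod_encode (m, h))))) n)"
| "run (Mu f) = (\<lambda>a.
     let P = (\<lambda>n. run f (prod_encode (a, n)) = Some 0 \<and>
                  (\<forall>m<n. run f (prod_encode (a, m)) \<noteq> None))
     in if \<exists>n. P n then Some (LEAST n. P n) else None)"

definition computable :: "(nat \<Rightarrow> nat) \<Rightarrow> bool" where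
  "computable f \<longleftrightarrow> (\<exists>c. run c = Some \<circ> f)"

primrec goedel :: "prog \<Rightarrow> nat" where
  "goedel Zero = 0"
| "goedel Succ = 1"
| "goedel Left = 2"
| "goedel Right = 3"
| "goedel (Pair f g) = 4 * prod_encode (goedel f, goedel g) + 4"
| "goedel (Comp f g) = 4 * prod_encode (goedel f, goedel g) + 5"
| "goedel (Prec f g) = 4 * prod_encode (goedel f, goedel g) + 6"
| "goedel (Mu f) = 4 * goedel f + 7"

lemma bij_goedel: "bij goedel"
proof (rule bijI)
  have "goedel c = goedel d \<Longrightarrow> c = d" for c d
    by (induction c arbitrary: d; case_tac d; simp; presburger)
  then show "inj goedel" by (rule injI)
  have "\<exists>c. goedel c = n" for n
  proof (induction n rule: less_induct)
    case (less n)
    show ?case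
    proof (cases "n < 4")
      case True
      then have "n = 0 \<or> n = 1 \<or> n = 2 \<or> n = 3" by auto
      then show ?thesis using goedel.simps(1-4) by metis
    next
      case False
      define k where "k = (n - 4) div 4"
      have n: "n = 4 * k + 4 \<or> n = 4 * k + 5 \<or> n = 4 * k + 6 \<or> n = 4 * k + 7"
        using False unfolding k_def by presburger
      obtain a b where ab: "prod_decode k = (a, b)" by fastforce
      then have k: "k = prod_encode (a, b)" by (metis prod_decode_inverse)
      have "a \<le> k" "b \<le> k" using k le_prod_encode_1 le_prod_encode_2 by auto
      then have "a < n" "b < n" "k < n" using n by auto
      then obtain f g h where "goedel f = a" "goedel g = b" "goedel h = k"
        using less.IH by meson
      then show ?thesis using n k goedel.simps(5-8) by metis
    qed
  qed
  then show "surj goedel" by (metis surjI)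
qed

text \<open>The resulting standard numbering of the partial computable functions.\<close>

definition phi :: "nat \<Rightarrow> nat \<rightharpoonup> nat" where
  "phi e = run (inv goedel e)"


section \<open>Kleene's second algebra\<close>

text \<open>
  The value of \<open>p * x\<close> at \<open>n\<close> is \<open>p \<langle>n, x 0, \<dots>, x (k - 1)\<rangle> - 1\<close> for the least \<open>k\<close> for which
  \<open>p \<langle>n, x 0, \<dots>, x (k - 1)\<rangle> > 0\<close>; \<open>p * x\<close> is defined iff such \<open>k\<close> exists for every \<open>n\<close>.
\<close>

definition kquery :: "(nat \<Rightarrow> nat) \<Rightarrow> (nat \<Rightarrow> nat) \<Rightarrow> nat \<Rightarrow> nat \<Rightarrow> nat" where
  "kquery p x n k = p (list_encode (n # map x [0..<k]))"

definition kapp :: "(nat \<Rightarrow> nat) \<Rightarrow> (nat \<Rightarrow> nat) \<rightharpoonup> (nat \<Rightarrow> nat)" where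
  "kapp p x =
     (if \<forall>n. \<exists>k. kquery p x n k > 0
      then Some (\<lambda>n. kquery p x n (LEAST k. kquery p x n k > 0) - 1)
      else None)"


section \<open>Represented spaces and coding systems\<close>

text \<open>
  The representation of a space is given by its graph: \<open>names X p x\<close> means that \<open>p\<close> is an
  \<open>X\<close>-name of \<open>x\<close>.
\<close>

record ('c, 'a) rep_space =
  points :: "'a set"
  names :: "'c \<Rightarrow> 'a \<Rightarrow> bool"

definition represented_space :: "('c, 'a) rep_space \<Rightarrow> bool" where
  "represented_space X \<longleftrightarrow>
     (\<forall>p x. names X p x \<longrightarrow> x \<in> points X) \<and>
     (\<forall>p x y. names X p x \<longrightarrow> names X p y \<longrightarrow> x = y) \<and>
     (\<forall>x \<in> points X. \<exists>p. names X p x)"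

text \<open>Longer tuples of codes are nested to the right: \<open>\<langle>p, q, r\<rangle> = \<langle>p, \<langle>q, r\<rangle>\<rangle>\<close>.\<close>

record 'c coding_system =
  realizable :: "('c \<rightharpoonup> 'c) set"
  tuple :: "'c \<Rightarrow> 'c \<Rightarrow> 'c"
  nat_name :: "nat \<Rightarrow> 'c"
  baire :: "('c, nat \<Rightarrow> nat) rep_space"

definition K1 :: "nat coding_system" where
  "K1 = \<lparr>
     realizable = range run,
     tuple = (\<lambda>p q. prod_encode (p, q)),
     nat_name = (\<lambda>n. n),
     baire = \<lparr>points = {x. computable x}, names = (\<lambda>e x. phi e = Some \<circ> x)\<rparr>\<rparr>"

definition join :: "(nat \<Rightarrow> nat) \<Rightarrow> (nat \<Rightarrow> nat) \<Rightarrow> nat \<Rightarrow> nat" where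
  "join p q = (\<lambda>i. if even i then p (i div 2) else q (i div 2))"

definition K2 :: "(nat \<Rightarrow> nat) coding_system" where
  "K2 = \<lparr>
     realizable = range kapp,
     tuple = join,
     nat_name = (\<lambda>n i. if i = 0 then n else 0),
     baire = \<lparr>points = UNIV, names = (\<lambda>p x. p = x)\<rparr>\<rparr>"

definition KV :: "(nat \<Rightarrow> nat) coding_system" where
  "KV = K2 \<lparr>realizable := kapp ` {p. computable p}\<rparr>"

definition morphism ::
    "'c coding_system \<Rightarrow> ('c, 'a) rep_space \<Rightarrow> ('c, 'b) rep_space \<Rightarrow> ('a \<Rightarrow> 'b) \<Rightarrow> bool" where
  "morphism C X Y f \<longleftrightarrow>
     f ` points X \<subseteq> points Y \<and>
     (\<exists>r \<in> realizable C. \<forall>p x. names X p x \<longrightarrow> (\<exists>q. r p = Some q \<and> names Y q (f x)))"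

definition subobject :: "'c coding_system \<Rightarrow> ('c, 'a) rep_space \<Rightarrow> ('c, 'a) rep_space \<Rightarrow> bool" where
  "subobject C A X \<longleftrightarrow>
     represented_space A \<and> represented_space X \<and> points A \<subseteq> points X \<and>
     (\<exists>r \<in> realizable C. \<forall>p x. names A p x \<longrightarrow> (\<exists>q. r p = Some q \<and> names X q x))"


section \<open>Many-one reducibility\<close>

text \<open>
  Reducibility is a relation between subobjects, hence the first two conjuncts.
\<close>

definition m_reducible ::
    "'c coding_system \<Rightarrow> ('c, 'a) rep_space \<Rightarrow> ('c, 'a) rep_space \<Rightarrow>
     ('c, 'b) rep_space \<Rightarrow> ('c, 'b) rep_space \<Rightarrow> bool" where
  "m_reducible C X A Y B \<longleftrightarrow>
     subobject C A X \<and> subobject C B Y \<and>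
     (\<exists>\<phi>. morphism C X Y \<phi> \<and> (\<exists>rm \<in> realizable C. \<exists>rp \<in> realizable C.
        (\<forall>x \<in> points X. x \<in> points A \<longleftrightarrow> \<phi> x \<in> points B) \<and>
        (\<forall>p. \<forall>x \<in> points A. names A p x \<longrightarrow> (\<exists>q. rm p = Some q \<and> names B q (\<phi> x))) \<and>
        (\<forall>p q. \<forall>x \<in> points A. names X p x \<and> names B q (\<phi> x) \<longrightarrow>
           (\<exists>s. rp (tuple C p q) = Some s \<and> names A s x))))"

definition m_less ::
    "'c coding_system \<Rightarrow> ('c, 'a) rep_space \<Rightarrow> ('c, 'a) rep_space \<Rightarrow>
     ('c, 'b) rep_space \<Rightarrow> ('c, 'b) rep_space \<Rightarrow> bool" where
  "m_less C X A Y B \<longleftrightarrow> m_reducible C X A Y B \<and> \<not> m_reducible C Y B X A"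

abbreviation baire_less ::
    "('c, nat \<Rightarrow> nat) rep_space \<Rightarrow> 'c coding_system \<Rightarrow> ('c, nat \<Rightarrow> nat) rep_space \<Rightarrow> bool"
    ("(_ /\<prec>\<^bsub>_\<^esub> _)" [51, 0, 51] 50) where
  "A \<prec>\<^bsub>C\<^esub> B \<equiv> m_less C (baire C) A (baire C) B"


section \<open>The subobjects of Baire space\<close>

definition Fin :: "'c coding_system \<Rightarrow> ('c, nat \<Rightarrow> nat) rep_space" where
  "Fin C = \<lparr>
     points = {x \<in> points (baire C). \<exists>n. \<forall>m\<ge>n. x m = 0},
     names = (\<lambda>c x. \<exists>n p. c = tuple C (nat_name C n) p \<and> names (baire C) p x \<and>
                (\<forall>m\<ge>n. x m = 0))\<rparr>"

definition BddSeq :: "'c coding_system \<Rightarrow> ('c, nat \<Rightarrow> nat) rep_space" where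
  "BddSeq C = \<lparr>
     points = {x \<in> points (baire C). \<exists>b. \<forall>n. x n \<le> b},
     names = (\<lambda>c x. \<exists>b p. c = tuple C (nat_name C b) p \<and> names (baire C) p x \<and>
                (\<forall>n. x n \<le> b))\<rparr>"

text \<open>The \<open>n\<close>-th entry of the sequence of elements of Baire space that \<open>x\<close> stands for.\<close>

definition row :: "(nat \<Rightarrow> nat) \<Rightarrow> nat \<Rightarrow> nat \<Rightarrow> nat" where
  "row x n = (\<lambda>m. x (prod_encode (n, m)))"

definition HalfTruth :: "'c coding_system \<Rightarrow> ('c, nat \<Rightarrow> nat) rep_space" where
  "HalfTruth C = \<lparr>
     points = {x \<in> points (baire C). \<exists>n. row x n = (\<lambda>_. 0)},
     names = (\<lambda>c x. \<exists>n m p. c = tuple C (nat_name C n) (tuple C (nat_name C m) p) \<and>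
                names (baire C) p x \<and> (row x n = (\<lambda>_. 0) \<or> row x m = (\<lambda>_. 0)))\<rparr>"

definition Truth :: "'c coding_system \<Rightarrow> ('c, nat \<Rightarrow> nat) rep_space" where
  "Truth C = \<lparr>
     points = {x \<in> points (baire C). \<exists>n. row x n = (\<lambda>_. 0)},
     names = (\<lambda>c x. \<exists>n p. c = tuple C (nat_name C n) p \<and> names (baire C) p x \<and>
                row x n = (\<lambda>_. 0))\<rparr>"

text \<open>
  Not every \<open>x\<close> codes a graph, but \<open>V\<close> and \<open>E\<close> are determined by \<open>x\<close> if it does.  An edge
  \<open>{u, v}\<close> is listed once, as \<open>(u, v)\<close> with \<open>u < v\<close>.
\<close>

definition codes_graph :: "(nat \<Rightarrow> nat) \<Rightarrow> nat set \<Rightarrow> (nat \<times> nat) set \<Rightarrow> bool" where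
  "codes_graph x V E \<longleftrightarrow>
     E \<subseteq> {(u, v). u \<in> V \<and> v \<in> V \<and> u < v} \<and>
     x = join (\<lambda>u. of_bool (u \<in> V)) (\<lambda>k. of_bool (prod_decode k \<in> E))"

definition path_connected :: "(nat \<times> nat) set \<Rightarrow> nat \<Rightarrow> nat \<Rightarrow> bool" where
  "path_connected E a b \<longleftrightarrow> (a, b) \<in> (E \<union> E\<inverse>)\<^sup>*"

definition DisConn :: "'c coding_system \<Rightarrow> ('c, nat \<Rightarrow> nat) rep_space" where
  "DisConn C = \<lparr>
     points = {x \<in> points (baire C). \<exists>V E. codes_graph x V E \<and>
                 \<not> (\<forall>a\<in>V. \<forall>b\<in>V. path_connected E a b)},
     names = (\<lambda>c x. \<exists>a b p V E. c = tuple C (nat_name C a) (tuple C (nat_name C b) p) \<and>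
                names (baire C) p x \<and> codes_graph x V E \<and>
                a \<in> V \<and> b \<in> V \<and> \<not> path_connected E a b)\<rparr>"

end

theory Submission
  imports Defs
begin

text \<open>
  The proof separates what holds in every coding system from what has to be known about the three
  given ones.

  The four reductions are explicit transformations \<open>F\<close> of Baire space, and \<open>F x n\<close> depends
  computably on an initial segment of \<open>x\<close> whose length is linear in \<open>n\<close>.  The maps on names only
  recombine the numbers occurring in a name and apply \<open>F\<close> to the Baire name.  So all that a
  coding system has to provide are computable operations on numbers, projections and pairing of
  codes, and a realizer for each such \<open>F\<close>; this is the locale \<open>effective_coding\<close>.

  The four separations rest on one principle (locale \<open>perturbable_coding\<close>).  Suppose that a
  semidecidable relation \<open>S p d\<close> between names and numbers has an answer \<open>d\<close> for every name \<open>p\<close>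
  of a point \<open>x\<close>, and that the points \<open>z d s\<close> agree with \<open>x\<close> below \<open>s\<close>, uniformly computably in
  \<open>d\<close> and \<open>s\<close>.  Then some \<open>z d s\<close> has a name \<open>p\<close> with \<open>S p d\<close>: one may watch how the
  reduction treats \<open>x\<close> and afterwards continue \<open>x\<close> against the observed answers, which still
  count.  In Kleene's second algebra this is continuity: an answer depends on finitely many
  entries of \<open>x\<close>.  For partial computable functions an answer may depend on the index, and the
  principle is an instance of the recursion theorem: the program with index \<open>e\<close> prints \<open>x\<close>
  until it finds an answer to the question about \<open>e\<close> itself, and prints \<open>z d s\<close> from then on.
  This needs decidability of halting within a given number of steps, obtained from a machine
  that executes codes of programs.

  Each separation is then a finite argument about a hypothetical reduction.

  \<^item> \<open>BddSeq\<close> to \<open>Fin\<close>, at the zero sequence.  A fixed \<open>n0\<close> bounds the support of its image, so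
    the reduction returns some bound \<open>b\<close> from \<open>n0\<close>.  The bound \<open>b + 1\<close> is correct as well and
    yields some \<open>n\<close> bounding the support.  Once the image is known to vanish on \<open>[n0, n)\<close>, putting
    the value \<open>b + 1\<close> into the sequence leaves \<open>n\<close>, and hence \<open>n0\<close>, correct, so \<open>b\<close> would still
    have to be a bound.
  \<^item> \<open>HalfTruth\<close> to \<open>BddSeq\<close>, when all rows are zero.  The rows 0, 1 and 2 yield three bounds, and
    their sum yields two candidates.  Killing both candidates spares one of the rows 0, 1, 2, so
    the sum is still a bound.
  \<^item> \<open>DisConn\<close> to \<open>HalfTruth\<close>, for the graph on four isolated vertices.  The disconnected pairs
    \<open>{0, 1}\<close> and \<open>{2, 3}\<close> yield two candidates each.  For either choice of one candidate from each
    pair the reduction names a pair of vertices.  There are five ways of splitting the vertices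
    into two components for which these four answers cannot all be right (\<open>ex_refuted\<close>).
  \<^item> \<open>Truth\<close> to \<open>DisConn\<close>, when all rows are zero.  The rows 0 and 1 yield pairs \<open>a, b\<close> and \<open>c, e\<close> of
    vertices.  For any two of these vertices that are not connected the reduction names a row.  If
    only row \<open>j\<close> survives, disconnected vertices must have been assigned row \<open>j\<close>, so that any two
    vertices are connected when only row 0 survives or when only row 1 survives.  But if the
    union of two equivalence relations is total, one of them is, contrary to the pair belonging
    to its row.
\<close>

section \<open>A calculus of computable functions\<close>

abbreviation pr :: "nat \<Rightarrow> nat \<Rightarrow> nat" where "pr m n \<equiv> prod_encode (m, n)"
abbreviation p1 :: "nat \<Rightarrow> nat" where "p1 n \<equiv> fst (prod_decode n)"
abbreviation p2 :: "nat \<Rightarrow> nat" where "p2 n \<equiv> snd (prod_decode n)"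

lemma pr_eta [simp]: "pr (p1 n) (p2 n) = n"
  by simp

lemma computableI: "(\<And>x. run c x = Some (f x)) \<Longrightarrow> computable f"
  unfolding computable_def by (intro exI[of _ c] ext) simp

lemma computable_iff: "computable f \<longleftrightarrow> (\<exists>c. \<forall>x. run c x = Some (f x))"
  by (simp add: computable_def fun_eq_iff)

named_theorems computable_intros

definition IdP :: prog where "IdP = Pair Left Right"

lemma run_IdP [simp]: "run IdP x = Some x"
  by (simp add: IdP_def)

primrec ConstP :: "nat \<Rightarrow> prog" where
  "ConstP 0 = Zero"
| "ConstP (Suc n) = Comp Succ (ConstP n)"

lemma run_ConstP [simp]: "run (ConstP n) x = Some n"
  by (induction n) auto

lemma computable_id [computable_intros]: "computable (\<lambda>x. x)"
  by (rule computableI[of IdP]) simp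

lemma computable_const [computable_intros]: "computable (\<lambda>x. n)"
  by (rule computableI[of "ConstP n"]) simp

lemma computable_comp:
  assumes "computable f" "computable g"
  shows "computable (\<lambda>x. f (g x))"
proof -
  obtain c where "\<forall>x. run c x = Some (f x)" using assms(1) unfolding computable_iff ..
  moreover obtain d where "\<forall>x. run d x = Some (g x)" using assms(2) unfolding computable_iff ..
  ultimately show ?thesis by (intro computableI[of "Comp c d"]) simp
qed

lemma computable_Suc [computable_intros]: "computable f \<Longrightarrow> computable (\<lambda>x. Suc (f x))"
  by (rule computable_comp[of Suc, OF computableI[of Succ]]) auto

lemma computable_p1 [computable_intros]: "computable f \<Longrightarrow> computable (\<lambda>x. p1 (f x))"
  by (rule computable_comp[of p1, OF computableI[of Left]]) auto

lemma computable_p2 [computable_intros]: "computable f \<Longrightarrow> computable (\<lambda>x. p2 (f x))"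
  by (rule computable_comp[of p2, OF computableI[of Right]]) auto

lemma computable_pr [computable_intros]:
  assumes "computable f" "computable g"
  shows "computable (\<lambda>x. pr (f x) (g x))"
proof -
  obtain c where "\<forall>x. run c x = Some (f x)" using assms(1) unfolding computable_iff ..
  moreover obtain d where "\<forall>x. run d x = Some (g x)" using assms(2) unfolding computable_iff ..
  ultimately show ?thesis by (intro computableI[of "Pair c d"]) simp
qed

text \<open>
  The form in which a computable operation of two arguments enters further compositions.
\<close>

lemma computable_comp2:
  assumes "computable (\<lambda>y. h (p1 y) (p2 y))" "computable f" "computable g"
  shows "computable (\<lambda>x. h (f x) (g x))"
  using computable_comp[OF assms(1) computable_pr[OF assms(2,3)]] by simp

lemma run_Prec_total:
  assumes "\<And>x. run c x = Some (f x)" "\<And>x. run d x = Some (g x)"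
  shows "run (Prec c d) (pr a n) = Some (rec_nat (f a) (\<lambda>m h. g (pr a (pr m h))) n)"
  by (induction n) (use assms in auto)

text \<open>
  The parameter of a primitive recursion is the whole context \<open>x\<close>, which the program gets as first
  component of its argument; this is why the second premise speaks about decoded triples.
\<close>

lemma computable_rec [computable_intros]:
  assumes "computable f" "computable (\<lambda>y. g (p1 y) (p1 (p2 y)) (p2 (p2 y)))" "computable n"
  shows "computable (\<lambda>x. rec_nat (f x) (g x) (n x))"
proof -
  obtain c where c: "\<forall>x. run c x = Some (f x)" using assms(1) unfolding computable_iff ..
  obtain d where d: "\<forall>y. run d y = Some (g (p1 y) (p1 (p2 y)) (p2 (p2 y)))"
    using assms(2) unfolding computable_iff ..
  obtain e where e: "\<forall>x. run e x = Some (n x)" using assms(3) unfolding computable_iff ..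
  have "run (Comp (Prec c d) (Pair IdP e)) x = Some (rec_nat (f x) (g x) (n x))" for x
    using run_Prec_total[OF c[rule_format] d[rule_format], of x "n x"] by (simp add: e del: run.simps(7))
  then show ?thesis by (rule computableI)
qed

lemma computable_add [computable_intros]:
  assumes "computable f" "computable g"
  shows "computable (\<lambda>x. f x + g x)"
proof -
  have eq: "a + n = rec_nat a (\<lambda>m h. Suc h) n" for a n :: nat
    by (induction n) auto
  have *: "(\<lambda>x. f x + g x) = (\<lambda>x. rec_nat (f x) (\<lambda>m h. Suc h) (g x))" by (rule ext, rule eq)
  show ?thesis unfolding * by (intro computable_intros assms)
qed

lemma computable_mult [computable_intros]:
  assumes "computable f" "computable g"
  shows "computable (\<lambda>x. f x * g x)"
proof -
  have eq: "a * n = rec_nat 0 (\<lambda>m h. a + h) n" for a n :: nat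
    by (induction n) auto
  have *: "(\<lambda>x. f x * g x) = (\<lambda>x. rec_nat 0 (\<lambda>m h. f x + h) (g x))" by (rule ext, rule eq)
  show ?thesis unfolding * by (intro computable_intros computable_comp[OF assms(1)] assms)
qed

lemma computable_diff [computable_intros]:
  assumes "computable f" "computable g"
  shows "computable (\<lambda>x. f x - g x)"
proof -
  have pred: "n - 1 = rec_nat 0 (\<lambda>m h. m) n" for n :: nat
    by (cases n) auto
  have base: "computable (\<lambda>x. rec_nat 0 (\<lambda>m h. m) x)"
    by (intro computable_intros)
  have dec: "computable (\<lambda>x. h x - 1)" if "computable h" for h
    using computable_comp[OF base that] unfolding pred .
  have eq: "a - n = rec_nat a (\<lambda>m h. h - 1) n" for a n :: nat
    by (induction n) auto
  have *: "(\<lambda>x. f x - g x) = (\<lambda>x. rec_nat (f x) (\<lambda>m h. h - 1) (g x))" by (rule ext, rule eq)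
  show ?thesis unfolding * by (intro computable_intros dec assms)
qed

text \<open>Predicates are represented by their characteristic functions.\<close>

definition decidable :: "(nat \<Rightarrow> bool) \<Rightarrow> bool" where
  "decidable P \<longleftrightarrow> computable (\<lambda>x. of_bool (P x))"

lemma decidable_computable [computable_intros]:
  "decidable P \<Longrightarrow> computable (\<lambda>x. of_bool (P x))"
  by (simp add: decidable_def)

lemma decidable_le [computable_intros]:
  assumes "computable f" "computable g"
  shows "decidable (\<lambda>x. f x \<le> g x)"
proof -
  have *: "of_bool (a \<le> b) = 1 - (a - b)" for a b :: nat by auto
  show ?thesis unfolding decidable_def * by (intro computable_intros assms)
qed

lemma decidable_not [computable_intros]:
  assumes "decidable P" shows "decidable (\<lambda>x. \<not> P x)"
proof -
  have *: "of_bool (\<not> p) = 1 - (of_bool p :: nat)" for p by auto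
  show ?thesis unfolding decidable_def *
    by (intro computable_diff computable_const assms[unfolded decidable_def])
qed

lemma decidable_conj [computable_intros]:
  assumes "decidable P" "decidable Q" shows "decidable (\<lambda>x. P x \<and> Q x)"
  unfolding decidable_def of_bool_conj by (intro computable_intros assms)

lemma decidable_disj [computable_intros]:
  assumes "decidable P" "decidable Q" shows "decidable (\<lambda>x. P x \<or> Q x)"
proof -
  have "decidable (\<lambda>x. \<not> (\<not> P x \<and> \<not> Q x))" by (intro computable_intros assms)
  then show ?thesis by simp
qed

lemma decidable_imp [computable_intros]:
  assumes "decidable P" "decidable Q" shows "decidable (\<lambda>x. P x \<longrightarrow> Q x)"
  using decidable_disj[OF decidable_not[OF assms(1)] assms(2)] by simp

lemma decidable_eq [computable_intros]:
  assumes "computable f" "computable g"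
  shows "decidable (\<lambda>x. f x = g x)"
  unfolding order_eq_iff by (intro computable_intros assms)

lemma decidable_less [computable_intros]:
  assumes "computable f" "computable g"
  shows "decidable (\<lambda>x. f x < g x)"
  unfolding less_eq_Suc_le by (intro computable_intros assms)

lemma decidable_iff [computable_intros]:
  assumes "decidable P" "decidable Q" shows "decidable (\<lambda>x. P x = Q x)"
  unfolding iff_conv_conj_imp by (intro computable_intros assms)

lemma computable_if [computable_intros]:
  assumes "decidable P" "computable f" "computable g"
  shows "computable (\<lambda>x. if P x then f x else g x)"
proof -
  have *: "(if p then a else b) = of_bool p * a + of_bool (\<not> p) * b" for p and a b :: nat by auto
  show ?thesis unfolding * by (intro computable_intros assms)
qed

lemma decidable_comp: "decidable P \<Longrightarrow> computable f \<Longrightarrow> decidable (\<lambda>x. P (f x))"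
  unfolding decidable_def by (rule computable_comp)

lemma computable_sum [computable_intros]:
  assumes "computable (\<lambda>y. f (p1 y) (p2 y))" "computable n"
  shows "computable (\<lambda>x. \<Sum>i<n x. f x i)"
proof -
  have *: "(\<Sum>i<k. f x i) = rec_nat 0 (\<lambda>m h. h + f x m) k" for x k
    by (induction k) auto
  show ?thesis unfolding *
    by (intro computable_intros computable_comp2[where h=f, OF assms(1)] assms)
qed

lemma decidable_ball [computable_intros]:
  assumes "decidable (\<lambda>y. P (p1 y) (p2 y))" "computable n"
  shows "decidable (\<lambda>x. \<forall>i<n x. P x i)"
proof -
  have *: "(\<forall>i<k. P x i) \<longleftrightarrow> (\<Sum>i<k. of_bool (\<not> P x i)) = (0::nat)" for x k
    by auto
  show ?thesis unfolding * by (intro computable_intros assms)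
qed

lemma computable_div [computable_intros]:
  assumes "computable f" "0 < k"
  shows "computable (\<lambda>x. f x div k)"
proof -
  have *: "n div k = (\<Sum>i<n. of_bool (k * Suc i \<le> n))" for n :: nat
  proof -
    have "{i. i < n \<and> k * Suc i \<le> n} = {..<n div k}"
    proof (intro equalityI subsetI)
      fix i assume "i \<in> {i. i < n \<and> k * Suc i \<le> n}"
      then have "Suc i \<le> n div k" using assms(2) by (simp add: less_eq_div_iff_mult_less_eq mult.commute)
      then show "i \<in> {..<n div k}" by simp
    next
      fix i assume "i \<in> {..<n div k}"
      then have "Suc i \<le> n div k" by simp
      then have *: "Suc i * k \<le> n" using assms(2) by (simp add: less_eq_div_iff_mult_less_eq)
      moreover have "Suc i * 1 \<le> Suc i * k" using assms(2) by (intro mult_le_mono2) simp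
      ultimately show "i \<in> {i. i < n \<and> k * Suc i \<le> n}" by (simp add: mult.commute)
    qed
    moreover have "(\<Sum>i<n. of_bool (k * Suc i \<le> n)) = card {i. i < n \<and> k * Suc i \<le> n}"
      by (simp add: sum_of_bool_eq Collect_conj_eq lessThan_def)
    ultimately show ?thesis by simp
  qed
  show ?thesis unfolding * by (intro computable_intros computable_comp[OF assms(1)] assms)
qed

lemma computable_mod [computable_intros]:
  assumes "computable f" "0 < k"
  shows "computable (\<lambda>x. f x mod k)"
proof -
  have *: "n mod k = n - k * (n div k)" for n :: nat by (simp add: minus_mult_div_eq_mod)
  show ?thesis unfolding * by (intro computable_intros assms)
qed

lemma decidable_even [computable_intros]:
  assumes "computable f" shows "decidable (\<lambda>x. even (f x))"
  unfolding even_iff_mod_2_eq_zero by (intro computable_intros assms) simp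

text \<open>
  A bounded search; the value \<open>n\<close> signals failure.  In the recursion, \<open>h < m\<close> says that the search
  has succeeded already.
\<close>

definition least_below :: "nat \<Rightarrow> (nat \<Rightarrow> bool) \<Rightarrow> nat" where
  "least_below n P = rec_nat 0 (\<lambda>m h. if h < m \<or> P h then h else Suc m) n"

lemma least_below_eq:
  "least_below n P = (if \<exists>i<n. P i then LEAST i. P i else n)"
proof (induction n)
  case 0
  then show ?case by (simp add: least_below_def)
next
  case (Suc n)
  have step: "least_below (Suc n) P =
    (if least_below n P < n \<or> P (least_below n P) then least_below n P else Suc n)"
    by (simp add: least_below_def)
  show ?case
  proof (cases "\<exists>i<n. P i")
    case True
    then obtain i where i: "i < n" "P i" by blast
    then have "(LEAST i. P i) < n" by (meson Least_le order.strict_trans1)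
    then show ?thesis using True Suc step by (auto simp: less_Suc_eq)
  next
    case False
    then show ?thesis using Suc step
      by (auto simp: less_Suc_eq intro!: Least_equality[symmetric] leI)
  qed
qed

lemma computable_least_below [computable_intros]:
  assumes "decidable (\<lambda>y. P (p1 y) (p2 y))" "computable n"
  shows "computable (\<lambda>x. least_below (n x) (P x))"
proof -
  have "decidable (\<lambda>y. P (p1 y) (p2 (p2 y)))"
    using decidable_comp[OF assms(1), of "\<lambda>y. pr (p1 y) (p2 (p2 y))"]
      computable_pr[OF computable_p1[OF computable_id] computable_p2[OF computable_p2[OF computable_id]]]
    by simp
  then show ?thesis unfolding least_below_def
    by (intro computable_intros assms)
qed

section \<open>Lists coded by numbers\<close>

text \<open>
  The list functions are needed only on codes of lists that are long enough, so head and tail are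
  given by arithmetic that has some value on every number.
\<close>

definition tlc :: "nat \<Rightarrow> nat" where "tlc L = p2 (L - 1)"

definition nthc :: "nat \<Rightarrow> nat \<Rightarrow> nat" where
  "nthc L i = p1 ((tlc ^^ i) L - 1)"

lemma funpow_rec: "(f ^^ n) x = rec_nat x (\<lambda>_. f) n"
  by (induction n) auto

lemma computable_funpow:
  assumes "computable f" "computable g" "computable n"
  shows "computable (\<lambda>x. (f ^^ n x) (g x))"
  unfolding funpow_rec by (intro computable_rec computable_comp[OF assms(1)] assms computable_intros)

lemma computable_tlc [computable_intros]: "computable f \<Longrightarrow> computable (\<lambda>x. tlc (f x))"
  unfolding tlc_def by (intro computable_intros)

lemma computable_nthc [computable_intros]:
  assumes "computable f" "computable g" shows "computable (\<lambda>x. nthc (f x) (g x))"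
proof -
  have "computable tlc" using computable_tlc[OF computable_id] .
  then show ?thesis unfolding nthc_def by (intro computable_intros computable_funpow assms)
qed

lemma tlc_Cons [simp]: "tlc (list_encode (x # xs)) = list_encode xs"
  by (simp add: tlc_def)

lemma nthc_Cons_0 [simp]: "nthc (list_encode (x # xs)) 0 = x"
  by (simp add: nthc_def)

lemma nthc_Cons_Suc [simp]: "nthc (list_encode (x # xs)) (Suc i) = nthc (list_encode xs) i"
  by (simp only: nthc_def funpow_Suc_right o_apply tlc_Cons)

lemma nthc_list_encode: "i < length xs \<Longrightarrow> nthc (list_encode xs) i = xs ! i"
proof (induction xs arbitrary: i)
  case (Cons x xs)
  then show ?case by (cases i) (simp_all del: list_encode.simps)
qed simp

lemma nthc_map [simp]: "i < k \<Longrightarrow> nthc (list_encode (map f [0..<k])) i = f i"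
  by (simp add: nthc_list_encode)

text \<open>
  A list code is built from its last entry, since only prepending an entry is a simple operation
  on codes.
\<close>

lemma list_encode_map_rec:
  "list_encode (map f [0..<n]) = rec_nat 0 (\<lambda>j h. Suc (pr (f (n - Suc j)) h)) n"
proof -
  have "rec_nat 0 (\<lambda>j h. Suc (pr (f (n - Suc j)) h)) j = list_encode (map f [n - j..<n])"
    if "j \<le> n" for j
    using that
  proof (induction j)
    case (Suc j)
    then have "[n - Suc j..<n] = (n - Suc j) # [n - j..<n]"
      by (subst upt_conv_Cons) (auto simp: Suc_diff_Suc)
    then show ?case using Suc by simp
  qed simp
  from this[of n] show ?thesis by simp
qed

lemma computable_list_encode_map [computable_intros]:
  assumes "computable (\<lambda>y. f (p1 y) (p2 y))" "computable k"
  shows "computable (\<lambda>x. list_encode (map (f x) [0..<k x]))"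
proof -
  have k: "computable (\<lambda>y. k (p1 y))" by (rule computable_comp[OF assms(2)]) (intro computable_intros)
  show ?thesis unfolding list_encode_map_rec
    by (intro computable_intros computable_comp2[where h=f, OF assms(1)] assms k)
qed

section \<open>A universal machine\<close>

text \<open>
  A state of the machine either asks for the value of the program with code \<open>c\<close> at \<open>x\<close> or returns a
  value \<open>y\<close>, in both cases to the stack \<open>k\<close>.  A frame \<open>push t u v k\<close> carries a tag and the data
  with which to resume: 0 and 1 for the two halves of a pair, 2 for a composition, 3 for a
  primitive recursion with data \<open>(a, (m, n))\<close> and 4 for a minimization with data \<open>(a, n)\<close>.
  The empty stack is 0.
\<close>

definition EvS :: "nat \<Rightarrow> nat \<Rightarrow> nat \<Rightarrow> nat" where "EvS c x k = pr 0 (pr c (pr x k))"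
definition RtS :: "nat \<Rightarrow> nat \<Rightarrow> nat" where "RtS y k = pr 1 (pr 0 (pr y k))"
definition push :: "nat \<Rightarrow> nat \<Rightarrow> nat \<Rightarrow> nat \<Rightarrow> nat" where "push t u v k = Suc (pr t (pr u (pr v k)))"

text \<open>
  The numbers 4 to 7 in \<open>goedel\<close> fix the program constructor by the remainder modulo 4, and
  \<open>(c - 4) div 4\<close> is the code of its arguments.
\<close>

definition ev_step :: "nat \<Rightarrow> nat \<Rightarrow> nat \<Rightarrow> nat" where
  "ev_step c x k =
    (if c = 0 then RtS 0 k
     else if c = 1 then RtS (Suc x) k
     else if c = 2 then RtS (p1 x) k
     else if c = 3 then RtS (p2 x) k
     else if c mod 4 = 0 then EvS (p1 ((c - 4) div 4)) x (push 0 (p2 ((c - 4) div 4)) x k)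
     else if c mod 4 = 1 then EvS (p2 ((c - 4) div 4)) x (push 2 (p1 ((c - 4) div 4)) 0 k)
     else if c mod 4 = 2 then
       EvS (p1 ((c - 4) div 4)) (p1 x) (push 3 (p2 ((c - 4) div 4)) (pr (p1 x) (pr 0 (p2 x))) k)
     else EvS ((c - 4) div 4) (pr x 0) (push 4 ((c - 4) div 4) (pr x 0) k))"

definition ret_step :: "nat \<Rightarrow> nat \<Rightarrow> nat \<Rightarrow> nat \<Rightarrow> nat \<Rightarrow> nat" where
  "ret_step y t u v k =
    (if t = 0 then EvS u v (push 1 y 0 k)
     else if t = 1 then RtS (pr u y) k
     else if t = 2 then EvS u y k
     else if t = 3 then
       (if p1 (p2 v) = p2 (p2 v) then RtS y k
        else EvS u (pr (p1 v) (pr (p1 (p2 v)) y))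
               (push 3 u (pr (p1 v) (pr (Suc (p1 (p2 v))) (p2 (p2 v)))) k))
     else
       (if y = 0 then RtS (p2 v) k
        else EvS u (pr (p1 v) (Suc (p2 v))) (push 4 u (pr (p1 v) (Suc (p2 v))) k)))"

text \<open>
  A value returned to the empty stack is a fixed point, so that halting is a property of all
  later states.
\<close>

definition mstep :: "nat \<Rightarrow> nat" where
  "mstep s =
    (if p1 s = 0 then ev_step (p1 (p2 s)) (p1 (p2 (p2 s))) (p2 (p2 (p2 s)))
     else if p2 (p2 (p2 s)) = 0 then s
     else ret_step (p1 (p2 (p2 s)))
            (p1 (p2 (p2 (p2 s)) - 1)) (p1 (p2 (p2 (p2 (p2 s)) - 1)))
            (p1 (p2 (p2 (p2 (p2 (p2 s)) - 1)))) (p2 (p2 (p2 (p2 (p2 (p2 s)) - 1)))))"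

lemma computable_mstep: "computable mstep"
  unfolding mstep_def[abs_def] ev_step_def ret_step_def EvS_def RtS_def push_def
  by (intro computable_intros) simp_all

lemma mstep_Ev [simp]: "mstep (EvS c x k) = ev_step c x k"
  by (simp add: mstep_def EvS_def)

lemma mstep_Rt_push [simp]: "mstep (RtS y (push t u v k)) = ret_step y t u v k"
  by (simp add: mstep_def RtS_def push_def)

lemma mstep_Rt_0 [simp]: "mstep (RtS y 0) = RtS y 0"
  by (simp add: mstep_def RtS_def)

lemma EvS_neq_RtS [simp]: "EvS c x k \<noteq> RtS y l"
  by (simp add: EvS_def RtS_def)

lemma RtS_eq [simp]: "RtS y k = RtS z l \<longleftrightarrow> y = z \<and> k = l"
  by (simp add: RtS_def)

lemma eq_RtS_iff: "s = RtS y k \<longleftrightarrow> p1 s = 1 \<and> p1 (p2 s) = 0 \<and> p1 (p2 (p2 s)) = y \<and> p2 (p2 (p2 s)) = k"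
proof -
  have "s = pr (p1 s) (pr (p1 (p2 s)) (pr (p1 (p2 (p2 s))) (p2 (p2 (p2 s)))))" by simp
  then show ?thesis unfolding RtS_def by (metis fst_conv prod_encode_inverse snd_conv)
qed

lemma push_neq_0 [simp]: "push t u v k \<noteq> 0"
  by (simp add: push_def)

lemma ev_step_goedel [simp]:
  "ev_step (goedel Zero) x k = RtS 0 k"
  "ev_step (goedel Succ) x k = RtS (Suc x) k"
  "ev_step (goedel Left) x k = RtS (p1 x) k"
  "ev_step (goedel Right) x k = RtS (p2 x) k"
  "ev_step (goedel (Pair f g)) x k = EvS (goedel f) x (push 0 (goedel g) x k)"
  "ev_step (goedel (Comp f g)) x k = EvS (goedel g) x (push 2 (goedel f) 0 k)"
  "ev_step (goedel (Prec f g)) x k =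
     EvS (goedel f) (p1 x) (push 3 (goedel g) (pr (p1 x) (pr 0 (p2 x))) k)"
  "ev_step (goedel (Mu f)) x k = EvS (goedel f) (pr x 0) (push 4 (goedel f) (pr x 0) k)"
proof -
  have q: "(4 * q + 4 - 4) div 4 = q" "(4 * q + 5 - 4) div 4 = q" "(4 * q + 6 - 4) div 4 = q"
    "(4 * q + 7 - 4) div 4 = q" "(4 * q + 4) mod 4 = 0" "(4 * q + 5) mod 4 = 1"
    "(4 * q + 6) mod 4 = 2" "(4 * q + 7) mod 4 = 3" for q :: nat
    by presburger+
  show "ev_step (goedel Zero) x k = RtS 0 k"
    "ev_step (goedel Succ) x k = RtS (Suc x) k"
    "ev_step (goedel Left) x k = RtS (p1 x) k"
    "ev_step (goedel Right) x k = RtS (p2 x) k"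
    by (simp_all add: ev_step_def)
  show "ev_step (goedel (Pair f g)) x k = EvS (goedel f) x (push 0 (goedel g) x k)"
    "ev_step (goedel (Comp f g)) x k = EvS (goedel g) x (push 2 (goedel f) 0 k)"
    "ev_step (goedel (Prec f g)) x k =
       EvS (goedel f) (p1 x) (push 3 (goedel g) (pr (p1 x) (pr 0 (p2 x))) k)"
    "ev_step (goedel (Mu f)) x k = EvS (goedel f) (pr x 0) (push 4 (goedel f) (pr x 0) k)"
    unfolding ev_step_def goedel.simps q by simp_all
qed

declare goedel.simps [simp del]

definition reaches :: "nat \<Rightarrow> nat \<Rightarrow> bool" where
  "reaches s s' \<longleftrightarrow> (\<exists>t. (mstep ^^ t) s = s')"

lemma reaches_refl: "reaches s s"
  unfolding reaches_def by (rule exI[of _ 0]) simp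

lemma reaches_step: "reaches (mstep s) s' \<Longrightarrow> reaches s s'"
  unfolding reaches_def by (metis funpow_swap1 funpow_simps_right(2) o_apply)

lemma reaches_trans: "reaches s s' \<Longrightarrow> reaches s' s'' \<Longrightarrow> reaches s s''"
  unfolding reaches_def by (metis funpow_add o_apply)

lemma reaches_Ev: "reaches (ev_step c x k) s \<Longrightarrow> reaches (EvS c x k) s"
  by (rule reaches_step) simp

lemma reaches_Rt: "reaches (ret_step y t u v k) s \<Longrightarrow> reaches (RtS y (push t u v k)) s"
  by (rule reaches_step) simp

lemma run_Mu_SomeD:
  assumes "run (Mu f) a = Some n"
  shows "run f (pr a n) = Some 0" "m < n \<Longrightarrow> \<exists>v. run f (pr a m) = Some (Suc v)"
proof -
  define P where "P n \<longleftrightarrow> run f (pr a n) = Some 0 \<and> (\<forall>m<n. run f (pr a m) \<noteq> None)" for n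
  have "\<exists>n. P n" "(LEAST n. P n) = n"
    using assms unfolding P_def by (auto simp: Let_def split: if_splits)
  then have P: "P n" and least: "\<And>m. m < n \<Longrightarrow> \<not> P m"
    by (metis LeastI_ex, metis not_less_Least)
  show "run f (pr a n) = Some 0" using P by (simp add: P_def)
  show "\<exists>v. run f (pr a m) = Some (Suc v)" if lt: "m < n"
  proof -
    have "run f (pr a m) \<noteq> Some 0" using least[OF lt] P lt unfolding P_def by (meson order.strict_trans)
    moreover obtain v where "run f (pr a m) = Some v" using P lt by (auto simp: P_def)
    ultimately show ?thesis by (cases v) auto
  qed
qed

lemma run_Mu_SomeI:
  assumes "run f (pr a n) = Some 0" "\<And>m. m < n \<Longrightarrow> \<exists>v. run f (pr a m) = Some (Suc v)"
  shows "run (Mu f) a = Some n"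
proof -
  define P where "P n \<longleftrightarrow> run f (pr a n) = Some 0 \<and> (\<forall>m<n. run f (pr a m) \<noteq> None)" for n
  have "P n" using assms unfolding P_def by fastforce
  moreover have "(LEAST n. P n) = n"
    using \<open>P n\<close> assms(2) by (intro Least_equality) (fastforce simp: P_def not_le[symmetric])+
  ultimately show ?thesis unfolding P_def by (auto simp: Let_def)
qed

lemma run_Prec: "run (Prec f g) (pr a 0) = run f a"
  "run (Prec f g) (pr a (Suc n)) = Option.bind (run (Prec f g) (pr a n)) (\<lambda>h. run g (pr a (pr n h)))"
  by simp_all

text \<open>
  The stack is arbitrary, as the machine evaluates the parts of a program on top of what remains
  to be done.
\<close>

lemma run_reaches: "run c x = Some y \<Longrightarrow> reaches (EvS (goedel c) x k) (RtS y k)"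
proof (induction c arbitrary: x y k)
  case (Pair f g)
  then obtain u v where "run f x = Some u" "run g x = Some v" "y = pr u v"
    by (auto split: bind_splits)
  then show ?case
    by (intro reaches_Ev; simp) (auto intro!: reaches_trans[OF Pair.IH(1)] reaches_trans[OF Pair.IH(2)] reaches_Rt
        simp: ret_step_def reaches_refl)
next
  case (Comp f g)
  then obtain u where "run g x = Some u" "run f u = Some y"
    by (auto split: bind_splits)
  then show ?case
    by (intro reaches_Ev; simp) (auto intro!: reaches_trans[OF Comp.IH(2)] Comp.IH(1) reaches_Rt
        simp: ret_step_def reaches_refl)
next
  case (Prec f g)
  define a n where "a = p1 x" and "n = p2 x"
  have x: "x = pr a n" by (simp add: a_def n_def)
  have loop: "reaches (EvS (goedel f) a (push 3 (goedel g) (pr a (pr 0 n)) k))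
      (RtS h (push 3 (goedel g) (pr a (pr m n)) k))"
    if "m \<le> n" "run (Prec f g) (pr a m) = Some h" for m h
    using that
  proof (induction m arbitrary: h)
    case 0
    then show ?case by (intro Prec.IH(1)) (simp only: run_Prec)
  next
    case (Suc m)
    then obtain h' where h': "run (Prec f g) (pr a m) = Some h'" "run g (pr a (pr m h')) = Some h"
      by (auto simp only: run_Prec split: bind_splits)
    have "reaches (RtS h' (push 3 (goedel g) (pr a (pr m n)) k)) (RtS h (push 3 (goedel g) (pr a (pr (Suc m) n)) k))"
      using Suc.prems(1) by (intro reaches_Rt) (auto simp: ret_step_def intro: Prec.IH(2) h'(2))
    then show ?case using reaches_trans Suc.IH[OF _ h'(1)] Suc.prems(1) by (meson Suc_leD)
  qed
  have "reaches (RtS y (push 3 (goedel g) (pr a (pr n n)) k)) (RtS y k)"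
    by (intro reaches_Rt) (auto simp: ret_step_def reaches_refl)
  then show ?case
    using reaches_trans[OF loop[of n y]] Prec.prems by (intro reaches_Ev) (auto simp: x simp del: run.simps)
next
  case (Mu f)
  have loop: "reaches (EvS (goedel f) (pr x 0) (push 4 (goedel f) (pr x 0) k))
      (EvS (goedel f) (pr x m) (push 4 (goedel f) (pr x m) k))" if "m \<le> y" for m
    using that
  proof (induction m)
    case (Suc m)
    then obtain v where "run f (pr x m) = Some (Suc v)"
      using run_Mu_SomeD(2)[OF Mu.prems] by (meson Suc_le_lessD)
    then have "reaches (EvS (goedel f) (pr x m) (push 4 (goedel f) (pr x m) k))
        (RtS (Suc v) (push 4 (goedel f) (pr x m) k))"
      by (rule Mu.IH)
    moreover have "reaches (RtS (Suc v) (push 4 (goedel f) (pr x m) k))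
        (EvS (goedel f) (pr x (Suc m)) (push 4 (goedel f) (pr x (Suc m)) k))"
      by (intro reaches_Rt) (auto simp: ret_step_def reaches_refl)
    ultimately show ?case using Suc reaches_trans by (meson Suc_leD)
  qed (simp add: reaches_refl)
  have "reaches (EvS (goedel f) (pr x y) (push 4 (goedel f) (pr x y) k)) (RtS 0 (push 4 (goedel f) (pr x y) k))"
    by (rule Mu.IH[OF run_Mu_SomeD(1)[OF Mu.prems]])
  moreover have "reaches (RtS 0 (push 4 (goedel f) (pr x y) k)) (RtS y k)"
    by (intro reaches_Rt) (auto simp: ret_step_def reaches_refl)
  ultimately have "reaches (EvS (goedel f) (pr x 0) (push 4 (goedel f) (pr x 0) k)) (RtS y k)"
    using reaches_trans[OF loop[OF order_refl]] reaches_trans by blast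
  then show ?case by (intro reaches_Ev) simp
qed (auto intro!: reaches_Ev simp: reaches_refl)

lemma halts_step:
  assumes "(mstep ^^ t) s = RtS y 0" "s \<noteq> RtS y 0"
  obtains t' where "t' < t" "(mstep ^^ t') (mstep s) = RtS y 0"
  using assms by (cases t) (auto simp: funpow_swap1)

lemma halts_Ev:
  assumes "(mstep ^^ t) (EvS c x k) = RtS y 0"
  obtains t' where "t' < t" "(mstep ^^ t') (ev_step c x k) = RtS y 0"
  using halts_step[OF assms] by auto

lemma halts_Rt:
  assumes "(mstep ^^ t) (RtS z (push a u v k)) = RtS y 0"
  obtains t' where "t' < t" "(mstep ^^ t') (ret_step z a u v k) = RtS y 0"
  using halts_step[OF assms] by auto

text \<open>
  Without this converse a divergent program could be mistaken for a halting one.  The machine works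
  off the value of a subprogram before anything below it on the stack, so a halting computation
  passes through the return of that value; the decrease of the number of steps makes the
  induction for a minimization possible.
\<close>

lemma halts_run:
  assumes "(mstep ^^ t) (EvS (goedel c) x k) = RtS y 0"
  shows "\<exists>z t'. t' < t \<and> run c x = Some z \<and> (mstep ^^ t') (RtS z k) = RtS y 0"
  using assms
proof (induction c arbitrary: x k t)
  case (Pair f g)
  obtain t1 where t1: "t1 < t" "(mstep ^^ t1) (EvS (goedel f) x (push 0 (goedel g) x k)) = RtS y 0"
    using halts_Ev[OF Pair.prems] by auto
  obtain u t2 where u: "t2 < t1" "run f x = Some u" "(mstep ^^ t2) (RtS u (push 0 (goedel g) x k)) = RtS y 0"
    using Pair.IH(1)[OF t1(2)] by blast
  obtain t3 where t3: "t3 < t2" "(mstep ^^ t3) (EvS (goedel g) x (push 1 u 0 k)) = RtS y 0"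
    using halts_Rt[OF u(3)] by (auto simp: ret_step_def)
  obtain v t4 where v: "t4 < t3" "run g x = Some v" "(mstep ^^ t4) (RtS v (push 1 u 0 k)) = RtS y 0"
    using Pair.IH(2)[OF t3(2)] by blast
  obtain t5 where t5: "t5 < t4" "(mstep ^^ t5) (RtS (pr u v) k) = RtS y 0"
    using halts_Rt[OF v(3)] by (auto simp: ret_step_def)
  show ?case using t1(1) u(1,2) t3(1) v(1,2) t5 by (intro exI[of _ "pr u v"] exI[of _ t5]) auto
next
  case (Comp f g)
  obtain t1 where t1: "t1 < t" "(mstep ^^ t1) (EvS (goedel g) x (push 2 (goedel f) 0 k)) = RtS y 0"
    using halts_Ev[OF Comp.prems] by auto
  obtain u t2 where u: "t2 < t1" "run g x = Some u" "(mstep ^^ t2) (RtS u (push 2 (goedel f) 0 k)) = RtS y 0"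
    using Comp.IH(2)[OF t1(2)] by blast
  obtain t3 where t3: "t3 < t2" "(mstep ^^ t3) (EvS (goedel f) u k) = RtS y 0"
    using halts_Rt[OF u(3)] by (auto simp: ret_step_def)
  obtain v t4 where v: "t4 < t3" "run f u = Some v" "(mstep ^^ t4) (RtS v k) = RtS y 0"
    using Comp.IH(1)[OF t3(2)] by blast
  show ?case using t1(1) u(1,2) t3(1) v by (intro exI[of _ v] exI[of _ t4]) auto
next
  case (Prec f g)
  define a n where "a = p1 x" and "n = p2 x"
  have x: "x = pr a n" by (simp add: a_def n_def)
  have loop: "\<exists>z t'. t' < t \<and> run (Prec f g) (pr a n) = Some z \<and> (mstep ^^ t') (RtS z k) = RtS y 0"
    if "m \<le> n" "run (Prec f g) (pr a m) = Some h"
      "(mstep ^^ t) (RtS h (push 3 (goedel g) (pr a (pr m n)) k)) = RtS y 0" for m h t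
    using that
  proof (induction "n - m" arbitrary: m h t)
    case 0
    then have "m = n" by simp
    moreover obtain t' where "t' < t" "(mstep ^^ t') (RtS h k) = RtS y 0"
      using halts_Rt[OF "0.prems"(3)] \<open>m = n\<close> by (auto simp: ret_step_def)
    ultimately show ?case using "0.prems"(2) by blast
  next
    case (Suc d)
    then have "m \<noteq> n" by simp
    then obtain t1 where t1: "t1 < t" "(mstep ^^ t1) (EvS (goedel g) (pr a (pr m h))
        (push 3 (goedel g) (pr a (pr (Suc m) n)) k)) = RtS y 0"
      using halts_Rt[OF Suc.prems(3)] by (auto simp: ret_step_def)
    obtain h' t2 where h': "t2 < t1" "run g (pr a (pr m h)) = Some h'"
      "(mstep ^^ t2) (RtS h' (push 3 (goedel g) (pr a (pr (Suc m) n)) k)) = RtS y 0"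
      using Prec.IH(2)[OF t1(2)] by blast
    have "run (Prec f g) (pr a (Suc m)) = Some h'"
      using Suc.prems(2) h'(2) by (simp only: run_Prec) simp
    moreover have "d = n - Suc m" "Suc m \<le> n" using Suc.hyps(2) by auto
    ultimately show ?case using Suc.hyps(1)[OF _ _ _ h'(3)] t1(1) h'(1) by (meson order.strict_trans)
  qed
  obtain t1 where t1: "t1 < t" "(mstep ^^ t1) (EvS (goedel f) a (push 3 (goedel g) (pr a (pr 0 n)) k)) = RtS y 0"
    using halts_Ev[OF Prec.prems] by (auto simp: x)
  obtain u t2 where u: "t2 < t1" "run f a = Some u" "(mstep ^^ t2) (RtS u (push 3 (goedel g) (pr a (pr 0 n)) k)) = RtS y 0"
    using Prec.IH(1)[OF t1(2)] by blast
  then obtain z t' where "t' < t2" "run (Prec f g) (pr a n) = Some z" "(mstep ^^ t') (RtS z k) = RtS y 0"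
    using loop[of 0 u t2] by (auto simp only: run_Prec)
  then show ?case unfolding x using t1(1) u(1) by (meson order.strict_trans)
next
  case (Mu f)
  have loop: "\<exists>z t'. t' < t \<and> run (Mu f) x = Some z \<and> (mstep ^^ t') (RtS z k) = RtS y 0"
    if "\<And>m. m < n \<Longrightarrow> \<exists>v. run f (pr x m) = Some (Suc v)"
      "(mstep ^^ t) (EvS (goedel f) (pr x n) (push 4 (goedel f) (pr x n) k)) = RtS y 0" for n t
    using that
  proof (induction t arbitrary: n rule: less_induct)
    case (less t)
    obtain u t1 where u: "t1 < t" "run f (pr x n) = Some u"
      "(mstep ^^ t1) (RtS u (push 4 (goedel f) (pr x n) k)) = RtS y 0"
      using Mu.IH[OF less.prems(2)] by blast
    show ?case
    proof (cases u)
      case 0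
      then have "run (Mu f) x = Some n"
        using u(2) less.prems(1) by (intro run_Mu_SomeI) auto
      moreover obtain t2 where "t2 < t1" "(mstep ^^ t2) (RtS n k) = RtS y 0"
        using halts_Rt[OF u(3)] 0 by (auto simp: ret_step_def)
      ultimately show ?thesis using u(1) by (meson order.strict_trans)
    next
      case (Suc v)
      obtain t2 where t2: "t2 < t1" "(mstep ^^ t2) (EvS (goedel f) (pr x (Suc n)) (push 4 (goedel f) (pr x (Suc n)) k)) = RtS y 0"
        using halts_Rt[OF u(3)] Suc by (auto simp: ret_step_def)
      have "\<exists>v. run f (pr x m) = Some (Suc v)" if "m < Suc n" for m
        using that less.prems(1) u(2) Suc by (auto simp: less_Suc_eq)
      then have "\<exists>z t'. t' < t2 \<and> run (Mu f) x = Some z \<and> (mstep ^^ t') (RtS z k) = RtS y 0"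
        using t2 u(1) by (intro less.IH) auto
      then show ?thesis using t2(1) u(1) by (meson order.strict_trans)
    qed
  qed
  obtain t1 where "t1 < t" "(mstep ^^ t1) (EvS (goedel f) (pr x 0) (push 4 (goedel f) (pr x 0) k)) = RtS y 0"
    using halts_Ev[OF Mu.prems] by auto
  then show ?case using loop[of 0 t1] by (meson less_nat_zero_code order.strict_trans)
qed (auto elim!: halts_Ev)

lemma phi_goedel [simp]: "phi (goedel c) = run c"
  by (simp add: phi_def inv_f_f[OF bij_is_inj[OF bij_goedel]])

lemma ex_goedel: "\<exists>c. e = goedel c"
  using bij_is_surj[OF bij_goedel] by (metis surjD)

text \<open>
  Halting becomes an existential statement over a decidable matrix.
\<close>

theorem phi_iff_halts: "phi e x = Some y \<longleftrightarrow> (\<exists>t. (mstep ^^ t) (EvS e x 0) = RtS y 0)"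
proof -
  obtain c where c: "e = goedel c" using ex_goedel by blast
  have halt: "(mstep ^^ t) (RtS z 0) = RtS z 0" for t z
    by (induction t) auto
  show ?thesis
    using run_reaches[of c x y 0] halts_run[of _ c x 0 y] by (auto simp: c reaches_def halt)
qed

section \<open>Semidecidable predicates and the recursion theorem\<close>

definition semidecidable :: "(nat \<Rightarrow> bool) \<Rightarrow> bool" where
  "semidecidable P \<longleftrightarrow> (\<exists>R. decidable R \<and> (\<forall>x. P x \<longleftrightarrow> (\<exists>t. R (pr x t))))"

lemma ex_pr_iff: "(\<exists>t. Q (p1 t) (p2 t)) \<longleftrightarrow> (\<exists>a b. Q a b)"
  by (metis prod_encode_inverse fst_conv snd_conv)

lemma semidecidableI:
  "decidable R \<Longrightarrow> (\<And>x. P x \<longleftrightarrow> (\<exists>t. R (pr x t))) \<Longrightarrow> semidecidable P"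
  unfolding semidecidable_def by blast

lemma semidecidable_decidable:
  assumes "decidable P" shows "semidecidable P"
  by (rule semidecidableI[of "\<lambda>y. P (p1 y)"]) (auto intro!: decidable_comp[OF assms] computable_intros)

lemma semidecidable_conj:
  assumes "semidecidable P" "semidecidable Q" shows "semidecidable (\<lambda>x. P x \<and> Q x)"
proof -
  obtain R S where R: "decidable R" "\<And>x. P x \<longleftrightarrow> (\<exists>t. R (pr x t))"
    and S: "decidable S" "\<And>x. Q x \<longleftrightarrow> (\<exists>t. S (pr x t))"
    using assms unfolding semidecidable_def by blast
  show ?thesis
  proof (rule semidecidableI)
    show "decidable (\<lambda>y. R (pr (p1 y) (p1 (p2 y))) \<and> S (pr (p1 y) (p2 (p2 y))))"
      by (intro computable_intros decidable_comp[OF R(1)] decidable_comp[OF S(1)])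
    show "P x \<and> Q x \<longleftrightarrow> (\<exists>t. R (pr (p1 (pr x t)) (p1 (p2 (pr x t)))) \<and> S (pr (p1 (pr x t)) (p2 (p2 (pr x t)))))" for x
      unfolding R(2) S(2) by (simp add: ex_pr_iff[of "\<lambda>a b. R (pr x a) \<and> S (pr x b)"])
  qed
qed

lemma semidecidable_disj:
  assumes "semidecidable P" "semidecidable Q" shows "semidecidable (\<lambda>x. P x \<or> Q x)"
proof -
  obtain R S where R: "decidable R" "\<And>x. P x \<longleftrightarrow> (\<exists>t. R (pr x t))"
    and S: "decidable S" "\<And>x. Q x \<longleftrightarrow> (\<exists>t. S (pr x t))"
    using assms unfolding semidecidable_def by blast
  show ?thesis
  proof (rule semidecidableI)
    show "decidable (\<lambda>y. R y \<or> S y)"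
      by (intro computable_intros R(1) S(1))
    show "P x \<or> Q x \<longleftrightarrow> (\<exists>t. R (pr x t) \<or> S (pr x t))" for x
      unfolding R(2) S(2) by blast
  qed
qed

lemma semidecidable_ex:
  assumes "semidecidable (\<lambda>z. P (p1 z) (p2 z))" shows "semidecidable (\<lambda>x. \<exists>y. P x y)"
proof -
  obtain R where R: "decidable R" "\<And>z. P (p1 z) (p2 z) \<longleftrightarrow> (\<exists>t. R (pr z t))"
    using assms unfolding semidecidable_def by blast
  have R2: "P x y \<longleftrightarrow> (\<exists>t. R (pr (pr x y) t))" for x y
    using R(2)[of "pr x y"] by simp
  show ?thesis
  proof (rule semidecidableI)
    show "decidable (\<lambda>y. R (pr (pr (p1 y) (p1 (p2 y))) (p2 (p2 y))))"
      by (intro computable_intros decidable_comp[OF R(1)])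
    show "(\<exists>y. P x y) \<longleftrightarrow> (\<exists>t. R (pr (pr (p1 (pr x t)) (p1 (p2 (pr x t)))) (p2 (p2 (pr x t)))))" for x
      unfolding R2 by (simp add: ex_pr_iff[of "\<lambda>a b. R (pr (pr x a) b)"])
  qed
qed

text \<open>
  The index may vary computably, which is what makes relations about all programs available at
  once.
\<close>

lemma semidecidable_phi:
  assumes "computable e" "computable a" "computable b"
  shows "semidecidable (\<lambda>x. phi (e x) (a x) = Some (b x))"
proof (rule semidecidableI)
  show "decidable (\<lambda>y. (mstep ^^ p2 y) (EvS (e (p1 y)) (a (p1 y)) 0) = RtS (b (p1 y)) 0)"
    unfolding EvS_def RtS_def
    by (intro computable_intros computable_funpow[OF computable_mstep]
        computable_comp[OF assms(1)] computable_comp[OF assms(2)] computable_comp[OF assms(3)])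
qed (simp add: phi_iff_halts)

text \<open>
  Self-application: \<open>D v\<close> is an index of the program with index \<open>v\<close> whose first argument is fixed
  to \<open>v\<close>.  If \<open>v\<close> is an index of \<open>(w, n) \<mapsto> G (D w) n\<close>, then \<open>D v\<close> computes \<open>G (D v)\<close>.
\<close>

theorem recursion_theorem:
  assumes "computable (\<lambda>y. G (p1 y) (p2 y))"
  obtains e where "phi e = Some \<circ> G e"
proof -
  define D where "D v = 4 * pr v (4 * pr (goedel (ConstP v)) (goedel IdP) + 4) + 5" for v
  \<comment> \<open>\<open>D\<close> spells out the Goedel number of a program as arithmetic in the number of its part.\<close>
  have D: "D (goedel c) = goedel (Comp c (Pair (ConstP (goedel c)) IdP))" for c
    by (simp add: D_def goedel.simps)
  have g: "goedel (ConstP v) = rec_nat 0 (\<lambda>_ h. 4 * pr 1 h + 5) v" for v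
    by (induction v) (simp_all add: goedel.simps)
  have "computable (\<lambda>y. G (D (p1 y)) (p2 y))"
    unfolding D_def g by (intro computable_intros computable_comp2[where h=G, OF assms])
  then obtain c where c: "\<forall>y. run c y = Some (G (D (p1 y)) (p2 y))"
    unfolding computable_iff ..
  have "phi (D (goedel c)) n = Some (G (D (goedel c)) n)" for n
    unfolding phi_goedel D by (simp add: c D[symmetric])
  then show thesis by (intro that[of "D (goedel c)"] ext) simp
qed

section \<open>Functionals computable from linearly long prefixes\<close>

text \<open>
  The argument \<open>L\<close> may be any code of a list extending the required initial segment of \<open>x\<close>.  This
  makes it harmless to enlarge the bound, and the linear bound \<open>a * Suc n\<close> is closed under
  composition with only the constants being multiplied.
\<close>

definition prefix_computable :: "((nat \<Rightarrow> nat) \<Rightarrow> nat \<Rightarrow> nat) \<Rightarrow> bool" where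
  "prefix_computable G \<longleftrightarrow> (\<exists>g a. computable g \<and>
     (\<forall>x n L. (\<forall>i<a * Suc n. nthc L i = x i) \<longrightarrow> G x n = g (pr n L)))"

lemma prefix_computableI:
  assumes "computable (\<lambda>y. g (p1 y) (p2 y))"
    "\<And>x n L. (\<And>i. i < a * Suc n \<Longrightarrow> nthc L i = x i) \<Longrightarrow> G x n = g n L"
  shows "prefix_computable G"
  unfolding prefix_computable_def
  by (rule exI[of _ "\<lambda>y. g (p1 y) (p2 y)"], rule exI[of _ a]) (use assms in simp)

lemma prefix_computable_values:
  assumes "prefix_computable G"
  obtains g a where "computable g" "\<And>x n k. a * Suc n \<le> k \<Longrightarrow> G x n = g (pr n (list_encode (map x [0..<k])))"
proof -
  obtain g a where g: "computable g"
    "\<And>x n L. (\<forall>i<a * Suc n. nthc L i = x i) \<Longrightarrow> G x n = g (pr n L)"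
    using assms unfolding prefix_computable_def by blast
  show thesis by (rule that[OF g(1), of a], rule g(2)) (auto intro!: nthc_map)
qed

text \<open>
  The initial segment of \<open>H x\<close> that \<open>G\<close> asks for is itself computed from \<open>L\<close>.
\<close>

lemma prefix_computable_comp:
  assumes "prefix_computable G" "prefix_computable H"
  shows "prefix_computable (\<lambda>x. G (H x))"
proof -
  obtain g a where g: "computable g"
    "\<And>x n L. (\<forall>i<a * Suc n. nthc L i = x i) \<Longrightarrow> G x n = g (pr n L)"
    using assms(1) unfolding prefix_computable_def by blast
  obtain h b where h: "computable h"
    "\<And>x n L. (\<forall>i<b * Suc n. nthc L i = x i) \<Longrightarrow> H x n = h (pr n L)"
    using assms(2) unfolding prefix_computable_def by blast
  show ?thesis
  proof (rule prefix_computableI[where a = "b * a"])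
    show "computable (\<lambda>y. g (pr (p1 y) (list_encode (map (\<lambda>i. h (pr i (p2 y))) [0..<a * Suc (p1 y)]))))"
      by (intro computable_comp[OF g(1)] computable_intros computable_comp[OF h(1)])
    fix x n L assume L: "\<And>i. i < b * a * Suc n \<Longrightarrow> nthc L i = x i"
    have "h (pr i L) = H x i" if "i < a * Suc n" for i
    proof -
      have "b * Suc i \<le> b * (a * Suc n)" using that by (intro mult_le_mono2) simp
      then have "j < b * a * Suc n" if "j < b * Suc i" for j
        using that by (metis mult.assoc order.strict_trans2)
      then show ?thesis using L by (intro h(2)[symmetric]) blast
    qed
    then show "G (H x) n = g (pr n (list_encode (map (\<lambda>i. h (pr i L)) [0..<a * Suc n])))"
      by (intro g(2)) simp
  qed
qed

section \<open>Reductions between the five subobjects\<close>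

text \<open>
  Total operations on codes suffice for the reductions, since they recombine the parts of a name
  without ever waiting for information.
\<close>

locale effective_coding =
  fixes C :: "'c coding_system"
    and total_maps :: "('c \<Rightarrow> 'c) set"
    and fst_code snd_code :: "'c \<Rightarrow> 'c"
  assumes total_maps_realizable: "t \<in> total_maps \<Longrightarrow> (\<lambda>c. Some (t c)) \<in> realizable C"
    and total_maps_id: "(\<lambda>c. c) \<in> total_maps"
    and total_maps_comp: "s \<in> total_maps \<Longrightarrow> t \<in> total_maps \<Longrightarrow> (\<lambda>c. s (t c)) \<in> total_maps"
    and total_maps_tuple: "s \<in> total_maps \<Longrightarrow> t \<in> total_maps \<Longrightarrow> (\<lambda>c. tuple C (s c) (t c)) \<in> total_maps"
    and total_maps_fst_code: "fst_code \<in> total_maps"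
    and total_maps_snd_code: "snd_code \<in> total_maps"
    and fst_code_tuple [simp]: "fst_code (tuple C p q) = p"
    and snd_code_tuple [simp]: "snd_code (tuple C p q) = q"
    and total_maps_nat: "computable f \<Longrightarrow>
      \<exists>t \<in> total_maps. \<forall>m n. t (tuple C (nat_name C m) (nat_name C n)) = nat_name C (f (pr m n))"
    and total_maps_functional: "prefix_computable F \<Longrightarrow>
      \<exists>t \<in> total_maps. \<forall>p x. names (baire C) p x \<longrightarrow> names (baire C) (t p) (F x)"
    and nat_name_eq [simp]: "nat_name C m = nat_name C n \<longleftrightarrow> m = n"
    and represented_baire: "represented_space (baire C)"
    and computable_points: "computable x \<Longrightarrow> x \<in> points (baire C)"
begin

lemma tuple_eq [simp]: "tuple C p q = tuple C p' q' \<longleftrightarrow> p = p' \<and> q = q'"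
  by (metis fst_code_tuple snd_code_tuple)

text \<open>
  A fixed choice of operations lets maps on names be written down as terms.
\<close>

definition nat_op :: "(nat \<Rightarrow> nat) \<Rightarrow> 'c \<Rightarrow> 'c" where
  "nat_op f = (SOME t. t \<in> total_maps \<and>
     (\<forall>m n. t (tuple C (nat_name C m) (nat_name C n)) = nat_name C (f (pr m n))))"

definition functional_op :: "((nat \<Rightarrow> nat) \<Rightarrow> nat \<Rightarrow> nat) \<Rightarrow> 'c \<Rightarrow> 'c" where
  "functional_op F = (SOME t. t \<in> total_maps \<and>
     (\<forall>p x. names (baire C) p x \<longrightarrow> names (baire C) (t p) (F x)))"

lemma nat_op:
  assumes "computable f"
  shows "nat_op f \<in> total_maps" "nat_op f (tuple C (nat_name C m) (nat_name C n)) = nat_name C (f (pr m n))"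
  using someI_ex[OF total_maps_nat[OF assms, unfolded Bex_def]] unfolding nat_op_def by auto

lemma functional_op:
  assumes "prefix_computable F"
  shows "functional_op F \<in> total_maps"
    "names (baire C) p x \<Longrightarrow> names (baire C) (functional_op F p) (F x)"
  using someI_ex[OF total_maps_functional[OF assms, unfolded Bex_def]] unfolding functional_op_def by auto

lemma baire_points: "x \<in> points (baire C) \<longleftrightarrow> (\<exists>p. names (baire C) p x)"
  using represented_baire unfolding represented_space_def by blast

lemma baire_names_unique: "names (baire C) p x \<Longrightarrow> names (baire C) p y \<Longrightarrow> x = y"
  using represented_baire unfolding represented_space_def by blast

lemmas total_maps_intros = total_maps_id total_maps_tuple total_maps_comp[OF total_maps_fst_code] total_maps_comp[OF total_maps_snd_code]
  total_maps_comp[OF nat_op(1)] total_maps_comp[OF functional_op(1)]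

lemma points_functional:
  "prefix_computable F \<Longrightarrow> x \<in> points (baire C) \<Longrightarrow> F x \<in> points (baire C)"
  unfolding baire_points using functional_op(2) by blast

lemma morphism_functional:
  assumes "prefix_computable F" shows "morphism C (baire C) (baire C) F"
  unfolding morphism_def
  using points_functional[OF assms]
  by (auto intro!: bexI[OF _ total_maps_realizable[OF functional_op(1)[OF assms]]] functional_op(2)[OF assms])

lemma subobjectI:
  assumes "\<And>c x. names A c x \<Longrightarrow> x \<in> points A \<and> names (baire C) (t c) x"
    "\<And>x. x \<in> points A \<Longrightarrow> \<exists>c. names A c x" "points A \<subseteq> points (baire C)" "t \<in> total_maps"
  shows "subobject C A (baire C)"
  unfolding subobject_def
proof (intro conjI)
  show "represented_space A"
    unfolding represented_space_def
  proof (intro conjI allI impI ballI)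
    show "x = y" if "names A c x" "names A c y" for c x y
      using assms(1)[OF that(1)] assms(1)[OF that(2)] baire_names_unique by blast
  qed (use assms(1,2) in simp_all)
  show "\<exists>r\<in>realizable C. \<forall>p x. names A p x \<longrightarrow> (\<exists>q. r p = Some q \<and> names (baire C) q x)"
    by (rule bexI[OF _ total_maps_realizable[OF assms(4)]]) (use assms(1) in simp)
qed (rule represented_baire, rule assms(3))

lemma subobject_Fin: "subobject C (Fin C) (baire C)"
  by (rule subobjectI[where t = snd_code]) (auto simp: Fin_def baire_points total_maps_snd_code)

lemma subobject_BddSeq: "subobject C (BddSeq C) (baire C)"
  by (rule subobjectI[where t = snd_code]) (auto simp: BddSeq_def baire_points total_maps_snd_code)

lemma subobject_Truth: "subobject C (Truth C) (baire C)"
  by (rule subobjectI[where t = snd_code]) (auto simp: Truth_def baire_points total_maps_snd_code)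

lemma subobject_HalfTruth: "subobject C (HalfTruth C) (baire C)"
proof (rule subobjectI)
  show "(\<lambda>c. snd_code (snd_code c)) \<in> total_maps" by (intro total_maps_intros)
  show "x \<in> points (HalfTruth C) \<and> names (baire C) (snd_code (snd_code c)) x"
    if "names (HalfTruth C) c x" for c x
    using that by (auto simp: HalfTruth_def baire_points)
  show "\<exists>c. names (HalfTruth C) c x" if "x \<in> points (HalfTruth C)" for x
    using that unfolding HalfTruth_def baire_points by simp
qed (auto simp: HalfTruth_def)

lemma subobject_DisConn: "subobject C (DisConn C) (baire C)"
proof (rule subobjectI)
  show "(\<lambda>c. snd_code (snd_code c)) \<in> total_maps" by (intro total_maps_intros)
  show "x \<in> points (DisConn C) \<and> names (baire C) (snd_code (snd_code c)) x"
    if "names (DisConn C) c x" for c x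
    using that by (auto simp: DisConn_def baire_points)
  show "\<exists>c. names (DisConn C) c x" if "x \<in> points (DisConn C)" for x
    using that unfolding DisConn_def baire_points by simp blast
qed (auto simp: DisConn_def)

lemma names_DisConnI:
  "names (baire C) p x \<Longrightarrow> codes_graph x V E \<Longrightarrow> a \<in> V \<Longrightarrow> b \<in> V \<Longrightarrow>
    \<not> path_connected E a b \<Longrightarrow>
    names (DisConn C) (tuple C (nat_name C a) (tuple C (nat_name C b) p)) x"
  unfolding DisConn_def by auto

text \<open>
  The reductions below all have a prefix computable \<open>\<phi>\<close> and total maps on names.
\<close>

lemma m_reducibleI:
  assumes "subobject C A (baire C)" "subobject C B (baire C)" "prefix_computable F"
    "rm \<in> total_maps" "rp \<in> total_maps"
    "\<And>x. x \<in> points (baire C) \<Longrightarrow> x \<in> points A \<longleftrightarrow> F x \<in> points B"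
    "\<And>p x. names A p x \<Longrightarrow> names B (rm p) (F x)"
    "\<And>p q x. names (baire C) p x \<Longrightarrow> names B q (F x) \<Longrightarrow> names A (rp (tuple C p q)) x"
  shows "m_reducible C (baire C) A (baire C) B"
  unfolding m_reducible_def
proof (intro conjI exI[of _ F])
  show "\<exists>rm\<in>realizable C. \<exists>rp\<in>realizable C.
        (\<forall>x\<in>points (baire C). (x \<in> points A) = (F x \<in> points B)) \<and>
        (\<forall>p. \<forall>x\<in>points A. names A p x \<longrightarrow> (\<exists>q. rm p = Some q \<and> names B q (F x))) \<and>
        (\<forall>p q. \<forall>x\<in>points A. names (baire C) p x \<and> names B q (F x) \<longrightarrow>
           (\<exists>s. rp (tuple C p q) = Some s \<and> names A s x))"
    by (rule bexI[OF _ total_maps_realizable[OF assms(4)]], rule bexI[OF _ total_maps_realizable[OF assms(5)]])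
      (use assms(6-8) in auto)
qed (rule assms morphism_functional[OF assms(3)])+

end

subsection \<open>From finite support to boundedness\<close>

text \<open>
  Each nonzero entry is replaced by a number exceeding its position, so bounding the values and
  bounding the support is the same, with the same bound.
\<close>

definition mark_support :: "(nat \<Rightarrow> nat) \<Rightarrow> nat \<Rightarrow> nat" where
  "mark_support x m = (if x m \<noteq> 0 then Suc m else 0)"

lemma prefix_computable_mark_support: "prefix_computable mark_support"
proof (rule prefix_computableI[where a = 1])
  show "computable (\<lambda>y. if nthc (p2 y) (p1 y) \<noteq> 0 then Suc (p1 y) else 0)"
    by (intro computable_intros)
qed (simp add: mark_support_def)

lemma mark_support_le_iff: "(\<forall>n. mark_support x n \<le> b) \<longleftrightarrow> (\<forall>m\<ge>b. x m = 0)"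
  by (auto simp: mark_support_def not_less_eq_eq)

lemma (in effective_coding) Fin_reducible_BddSeq: "m_reducible C (baire C) (Fin C) (baire C) (BddSeq C)"
proof (rule m_reducibleI[OF subobject_Fin subobject_BddSeq prefix_computable_mark_support])
  show "(\<lambda>c. tuple C (fst_code c) (functional_op mark_support (snd_code c))) \<in> total_maps"
    by (intro total_maps_intros prefix_computable_mark_support)
  show "(\<lambda>c. tuple C (fst_code (snd_code c)) (fst_code c)) \<in> total_maps"
    by (intro total_maps_intros)
qed (auto simp: Fin_def BddSeq_def mark_support_le_iff points_functional
    prefix_computable_mark_support functional_op(2))

subsection \<open>From boundedness to one of two candidates\<close>

text \<open>
  Row \<open>n\<close> is zero exactly if \<open>n\<close> is a bound.  Of two numbers one of which is a bound, the larger
  one is a bound, so half of the truth is enough.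
\<close>

definition exceeds :: "(nat \<Rightarrow> nat) \<Rightarrow> nat \<Rightarrow> nat" where
  "exceeds x j = of_bool (p1 j < x (p2 j))"

lemma p1_le: "p1 n \<le> n"
  by (metis le_prod_encode_1 pr_eta)

lemma p2_le: "p2 n \<le> n"
  by (metis le_prod_encode_2 pr_eta)

lemma prefix_computable_exceeds: "prefix_computable exceeds"
proof (rule prefix_computableI[where a = 1])
  show "computable (\<lambda>y. of_bool (p1 (p1 y) < nthc (p2 y) (p2 (p1 y))))"
    by (intro computable_intros)
qed (simp add: exceeds_def p2_le le_imp_less_Suc)

lemma row_exceeds: "row (exceeds x) n = (\<lambda>_. 0) \<longleftrightarrow> (\<forall>k. x k \<le> n)"
  by (auto simp: row_def exceeds_def fun_eq_iff not_less)

lemma (in effective_coding) BddSeq_reducible_HalfTruth: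
  "m_reducible C (baire C) (BddSeq C) (baire C) (HalfTruth C)"
proof (rule m_reducibleI[OF subobject_BddSeq subobject_HalfTruth prefix_computable_exceeds])
  have max: "computable (\<lambda>y. if p1 y \<le> p2 y then p2 y else p1 y)"
    by (intro computable_intros)
  show "(\<lambda>c. tuple C (fst_code c) (tuple C (fst_code c) (functional_op exceeds (snd_code c)))) \<in> total_maps"
    by (intro total_maps_intros prefix_computable_exceeds)
  show "(\<lambda>c. tuple C (nat_op (\<lambda>y. if p1 y \<le> p2 y then p2 y else p1 y)
      (tuple C (fst_code (snd_code c)) (fst_code (snd_code (snd_code c))))) (fst_code c)) \<in> total_maps"
    by (intro total_maps_intros max)
  show "names (BddSeq C) (tuple C (nat_op (\<lambda>y. if p1 y \<le> p2 y then p2 y else p1 y)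
      (tuple C (fst_code (snd_code (tuple C p q))) (fst_code (snd_code (snd_code (tuple C p q))))))
      (fst_code (tuple C p q))) x"
    if p: "names (baire C) p x" and q: "names (HalfTruth C) q (exceeds x)" for p q x
  proof -
    obtain n m q' where nm: "q = tuple C (nat_name C n) (tuple C (nat_name C m) q')"
      "(\<forall>k. x k \<le> n) \<or> (\<forall>k. x k \<le> m)"
      using q by (auto simp: HalfTruth_def row_exceeds)
    then show ?thesis using p
      by (auto simp: BddSeq_def nat_op(2)[OF max] intro: order_trans)
  qed
qed (auto simp: BddSeq_def HalfTruth_def row_exceeds points_functional
    prefix_computable_exceeds functional_op(2))

subsection \<open>From one of two candidates to disconnectedness\<close>

lemma codes_graph_iff:
  assumes "codes_graph x V E"
  shows "u \<in> V \<longleftrightarrow> x (2 * u) \<noteq> 0" "(u, v) \<in> E \<longleftrightarrow> x (2 * pr u v + 1) \<noteq> 0"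
  using assms by (auto simp: codes_graph_def join_def)

lemma path_connected_refl [simp]: "path_connected E a a"
  by (simp add: path_connected_def)

lemma path_connected_edge: "(a, b) \<in> E \<Longrightarrow> path_connected E a b"
  by (auto simp: path_connected_def)

lemma path_connected_sym: "path_connected E a b \<Longrightarrow> path_connected E b a"
  unfolding path_connected_def by (metis converse_Un converse_converse rtrancl_converseI sup_commute)

lemma path_connected_trans: "path_connected E a b \<Longrightarrow> path_connected E b c \<Longrightarrow> path_connected E a c"
  unfolding path_connected_def by (rule rtrancl_trans)

lemma path_connected_isolated:
  assumes "path_connected E a b" "\<And>v. (a, v) \<notin> E" "\<And>v. (v, a) \<notin> E" shows "a = b"
  using assms unfolding path_connected_def by (auto elim: converse_rtranclE)

text \<open>
  The graph has a root 0, a vertex \<open>2 * n + 1\<close> for each row \<open>n\<close>, and a vertex \<open>2 * i + 2\<close> for each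
  position \<open>i\<close>, which always hangs on the root and is joined to the vertex of its row if the entry
  at \<open>i\<close> is nonzero.  So a row vertex is isolated if its row is zero and lies in the component of
  the root otherwise.  All vertices are present, and edges are decided by a single entry.
\<close>

definition star_edges :: "(nat \<Rightarrow> nat) \<Rightarrow> (nat \<times> nat) set" where
  "star_edges x = {(u, v). even v \<and> v \<noteq> 0 \<and>
     (u = 0 \<or> u = 2 * p1 ((v - 2) div 2) + 1 \<and> x ((v - 2) div 2) \<noteq> 0)}"

definition star_graph :: "(nat \<Rightarrow> nat) \<Rightarrow> nat \<Rightarrow> nat" where
  "star_graph x = join (\<lambda>_. 1) (\<lambda>k. of_bool (prod_decode k \<in> star_edges x))"

lemma even_nonzero: "even v \<Longrightarrow> v \<noteq> 0 \<Longrightarrow> v = 2 * ((v - 2) div 2) + 2" for v :: nat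
  by presburger

lemma codes_star_graph: "codes_graph (star_graph x) UNIV (star_edges x)"
proof -
  have "u < v" if "(u, v) \<in> star_edges x" for u v
  proof -
    define i where "i = (v - 2) div 2"
    have "v = 2 * i + 2" "u = 0 \<or> u = 2 * p1 i + 1"
      using that even_nonzero[of v] by (auto simp: star_edges_def i_def)
    then show ?thesis using p1_le[of i] by auto
  qed
  then show ?thesis by (auto simp: codes_graph_def star_graph_def)
qed

lemma codes_star_graph_iff: "codes_graph (star_graph x) V E \<longleftrightarrow> V = UNIV \<and> E = star_edges x"
proof -
  have "u \<in> V" "(u, v) \<in> E \<longleftrightarrow> (u, v) \<in> star_edges x" if "codes_graph (star_graph x) V E" for u v
    using codes_graph_iff[OF that] codes_graph_iff[OF codes_star_graph[of x]] by auto
  then show ?thesis using codes_star_graph[of x] by (metis UNIV_eq_I subrelI subset_antisym)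
qed

lemma star_edges_iff: "(u, 2 * i + 2) \<in> star_edges x \<longleftrightarrow> u = 0 \<or> u = 2 * p1 i + 1 \<and> x i \<noteq> 0"
  by (simp add: star_edges_def)

lemma star_isolated:
  assumes "row x n = (\<lambda>_. 0)" "path_connected (star_edges x) (2 * n + 1) b"
  shows "b = 2 * n + 1"
proof (rule sym, rule path_connected_isolated[OF assms(2)])
  have "x i = 0" if "p1 i = n" for i
    using fun_cong[OF assms(1), of "p2 i"] that by (auto simp: row_def)
  then show "(2 * n + 1, v) \<notin> star_edges x" for v by (auto simp: star_edges_def)
  show "(v, 2 * n + 1) \<notin> star_edges x" for v by (simp add: star_edges_def)
qed

text \<open>
  Halving sends a row vertex to its row, and all other vertices are connected to the root by
  construction.  Hence two vertices that are not connected yield two rows one of which is zero.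
\<close>

lemma star_connected:
  assumes "row x (a div 2) \<noteq> (\<lambda>_. 0)" shows "path_connected (star_edges x) 0 a"
proof (cases "even a")
  case True
  then consider "a = 0" | i where "a = 2 * i + 2"
    using even_nonzero by blast
  then show ?thesis
    by cases (auto intro!: path_connected_edge simp: star_edges_iff[simplified])
next
  case False
  obtain k where k: "x (pr (a div 2) k) \<noteq> 0" using assms by (auto simp: row_def)
  define w where "w = 2 * pr (a div 2) k + 2"
  have "(0, w) \<in> star_edges x" "(a, w) \<in> star_edges x"
    unfolding w_def star_edges_iff using False k by (auto simp: odd_two_times_div_two_succ)
  then show ?thesis
    by (meson path_connected_edge path_connected_sym path_connected_trans)
qed

lemma prefix_computable_star_graph: "prefix_computable star_graph"
proof (rule prefix_computableI[where a = 1])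
  show "computable (\<lambda>y. if even (p1 y) then 1 else
      of_bool (even (p2 (p1 y div 2)) \<and> p2 (p1 y div 2) \<noteq> 0 \<and>
        (p1 (p1 y div 2) = 0 \<or> p1 (p1 y div 2) = 2 * p1 ((p2 (p1 y div 2) - 2) div 2) + 1 \<and>
          nthc (p2 y) ((p2 (p1 y div 2) - 2) div 2) \<noteq> 0)))"
    by (intro computable_intros) simp_all
  fix x n L assume L: "\<And>i. i < 1 * Suc n \<Longrightarrow> nthc L i = x i"
  have "(p2 (n div 2) - 2) div 2 \<le> n" using p2_le[of "n div 2"] by linarith
  then have "nthc L ((p2 (n div 2) - 2) div 2) = x ((p2 (n div 2) - 2) div 2)"
    by (intro L) simp
  then show "star_graph x n = (if even n then 1 else
      of_bool (even (p2 (n div 2)) \<and> p2 (n div 2) \<noteq> 0 \<and>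
        (p1 (n div 2) = 0 \<or> p1 (n div 2) = 2 * p1 ((p2 (n div 2) - 2) div 2) + 1 \<and>
          nthc L ((p2 (n div 2) - 2) div 2) \<noteq> 0)))"
    by (simp add: star_graph_def join_def star_edges_def split_beta)
qed

text \<open>
  If one of two different rows is zero, the vertex of that row is isolated, whichever it is, and
  the two row vertices are not connected.  If both candidates are the same row, the root serves as
  the second vertex.
\<close>

lemma (in effective_coding) HalfTruth_reducible_DisConn:
  "m_reducible C (baire C) (HalfTruth C) (baire C) (DisConn C)"
proof (rule m_reducibleI[OF subobject_HalfTruth subobject_DisConn prefix_computable_star_graph])
  have maps: "computable (\<lambda>y. Suc (2 * p1 y))" "computable (\<lambda>y. if p1 y = p2 y then 0 else Suc (2 * p2 y))"
    "computable (\<lambda>y. p1 y div 2)"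
    by (intro computable_intros; simp)+
  have sep: "\<not> path_connected (star_edges x) (Suc (2 * n)) (if n = m then 0 else Suc (2 * m))"
    if "row x n = (\<lambda>_. 0) \<or> row x m = (\<lambda>_. 0)" for x n m
    using that star_isolated[of x n] star_isolated[of x m]
      path_connected_sym[of "star_edges x" "2 * n + 1" "2 * m + 1"]
    by (cases "n = m") force+
  have sep': "row x (a div 2) = (\<lambda>_. 0) \<or> row x (b div 2) = (\<lambda>_. 0)"
    if "\<not> path_connected (star_edges x) a b" for x a b
    using that by (meson star_connected path_connected_sym path_connected_trans)
  show "(\<lambda>c. tuple C (nat_op (\<lambda>y. Suc (2 * p1 y)) (tuple C (fst_code c) (fst_code (snd_code c))))
      (tuple C (nat_op (\<lambda>y. if p1 y = p2 y then 0 else Suc (2 * p2 y))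
        (tuple C (fst_code c) (fst_code (snd_code c))))
        (functional_op star_graph (snd_code (snd_code c))))) \<in> total_maps"
    by (intro total_maps_intros maps prefix_computable_star_graph)
  show "(\<lambda>c. tuple C (nat_op (\<lambda>y. p1 y div 2) (tuple C (fst_code (snd_code c)) (fst_code (snd_code c))))
      (tuple C (nat_op (\<lambda>y. p1 y div 2)
          (tuple C (fst_code (snd_code (snd_code c))) (fst_code (snd_code (snd_code c)))))
        (fst_code c))) \<in> total_maps"
    by (intro total_maps_intros maps)
  show "x \<in> points (HalfTruth C) \<longleftrightarrow> star_graph x \<in> points (DisConn C)"
    if "x \<in> points (baire C)" for x
  proof -
    have "(\<exists>n. row x n = (\<lambda>_. 0)) \<longleftrightarrow> (\<exists>a b. \<not> path_connected (star_edges x) a b)"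
      using sep[of x] sep'[of x] by blast
    then show ?thesis using that points_functional[OF prefix_computable_star_graph]
      by (simp add: HalfTruth_def DisConn_def codes_star_graph_iff)
  qed
  show "names (DisConn C) (tuple C
      (nat_op (\<lambda>y. Suc (2 * p1 y)) (tuple C (fst_code p) (fst_code (snd_code p))))
      (tuple C (nat_op (\<lambda>y. if p1 y = p2 y then 0 else Suc (2 * p2 y))
        (tuple C (fst_code p) (fst_code (snd_code p))))
        (functional_op star_graph (snd_code (snd_code p))))) (star_graph x)"
    if "names (HalfTruth C) p x" for p x
  proof -
    obtain n m p' where nm: "p = tuple C (nat_name C n) (tuple C (nat_name C m) p')"
      "names (baire C) p' x" "row x n = (\<lambda>_. 0) \<or> row x m = (\<lambda>_. 0)"
      using \<open>names (HalfTruth C) p x\<close> unfolding HalfTruth_def by auto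
    have "\<not> path_connected (star_edges x) (Suc (2 * n)) (if n = m then 0 else Suc (2 * m))"
      by (rule sep[OF nm(3)])
    then show ?thesis using functional_op(2)[OF prefix_computable_star_graph nm(2)]
      unfolding nm(1) fst_code_tuple snd_code_tuple nat_op(2)[OF maps(1)] nat_op(2)[OF maps(2)]
        prod_encode_inverse fst_conv snd_conv
      by (intro names_DisConnI[OF _ codes_star_graph]) auto
  qed
  show "names (HalfTruth C) (tuple C
      (nat_op (\<lambda>y. p1 y div 2)
        (tuple C (fst_code (snd_code (tuple C p q))) (fst_code (snd_code (tuple C p q)))))
      (tuple C (nat_op (\<lambda>y. p1 y div 2)
          (tuple C (fst_code (snd_code (snd_code (tuple C p q)))) (fst_code (snd_code (snd_code (tuple C p q))))))
        (fst_code (tuple C p q)))) x"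
    if "names (baire C) p x" "names (DisConn C) q (star_graph x)" for p q x
    using that sep'[of x]
    by (auto simp: HalfTruth_def DisConn_def codes_star_graph_iff nat_op(2)[OF maps(3)])
qed

subsection \<open>From disconnectedness to a disconnected pair among all pairs\<close>

text \<open>
  What a graph code has to satisfy, as far as positions below \<open>B\<close> are concerned.
\<close>

definition graph_below :: "(nat \<Rightarrow> nat) \<Rightarrow> nat \<Rightarrow> bool" where
  "graph_below x B \<longleftrightarrow> (\<forall>i<B. x i \<le> 1 \<and> (odd i \<and> x i \<noteq> 0 \<longrightarrow>
     p1 (i div 2) < p2 (i div 2) \<and> x (2 * p1 (i div 2)) \<noteq> 0 \<and> x (2 * p2 (i div 2)) \<noteq> 0))"

definition adjacent_below :: "(nat \<Rightarrow> nat) \<Rightarrow> nat \<Rightarrow> nat \<Rightarrow> nat \<Rightarrow> bool" where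
  "adjacent_below x B u v \<longleftrightarrow>
     2 * pr u v + 1 < B \<and> x (2 * pr u v + 1) \<noteq> 0 \<or> 2 * pr v u + 1 < B \<and> x (2 * pr v u + 1) \<noteq> 0"

text \<open>
  No evidence found below \<open>B\<close> against \<open>x\<close> coding a graph in which \<open>a\<close> and \<open>b\<close> are disconnected
  vertices: \<open>w\<close> and \<open>l\<close> code a possible path of length \<open>l\<close>.
\<close>

definition unlinked :: "(nat \<Rightarrow> nat) \<Rightarrow> nat \<Rightarrow> nat \<Rightarrow> nat \<Rightarrow> nat \<Rightarrow> nat \<Rightarrow> bool" where
  "unlinked x a b B w l \<longleftrightarrow> graph_below x B \<and> x (2 * a) \<noteq> 0 \<and> x (2 * b) \<noteq> 0 \<and>
     \<not> (nthc w 0 = a \<and> nthc w l = b \<and> (\<forall>i<l. adjacent_below x B (nthc w i) (nthc w (Suc i))))"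

text \<open>
  Row \<open>(a, b)\<close> searches for evidence that \<open>a\<close> and \<open>b\<close> are not a disconnected pair of vertices.  The
  bound \<open>B\<close> is part of the position searched, so that the value at a position \<open>j\<close> depends on entries
  at positions linear in \<open>j\<close> only.
\<close>

definition link_search :: "(nat \<Rightarrow> nat) \<Rightarrow> nat \<Rightarrow> nat" where
  "link_search x j = of_bool (\<not> unlinked x (p1 (p1 j)) (p2 (p1 j)) (p1 (p2 j)) (p1 (p2 (p2 j))) (p2 (p2 (p2 j))))"

lemma row_link_search:
  "row (link_search x) n = (\<lambda>_. 0) \<longleftrightarrow> (\<forall>B w l. unlinked x (p1 n) (p2 n) B w l)"
proof -
  have "(\<forall>m. unlinked x (p1 n) (p2 n) (p1 m) (p1 (p2 m)) (p2 (p2 m))) \<longleftrightarrow>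
      (\<forall>B w l. unlinked x (p1 n) (p2 n) B w l)"
    by (metis fst_conv snd_conv prod_encode_inverse)
  then show ?thesis
    by (simp add: row_def link_search_def fun_eq_iff)
qed

text \<open>
  Vertices and edges can be read off from \<open>x\<close>, so being a graph code is a condition on all entries
  and is refuted by a finite part of \<open>x\<close> if it fails.
\<close>

lemma ex_codes_graph_iff: "(\<exists>V E. codes_graph x V E) \<longleftrightarrow> (\<forall>B. graph_below x B)"
proof
  assume "\<exists>V E. codes_graph x V E"
  then obtain V E where g: "codes_graph x V E" by blast
  have le: "x i \<le> 1" for i
    using g by (auto simp: codes_graph_def join_def)
  have edge: "p1 k < p2 k \<and> x (2 * p1 k) \<noteq> 0 \<and> x (2 * p2 k) \<noteq> 0" if "x (2 * k + 1) \<noteq> 0" for k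
  proof -
    have "(p1 k, p2 k) \<in> E" using codes_graph_iff(2)[OF g, of "p1 k" "p2 k"] that by simp
    then show ?thesis using g codes_graph_iff(1)[OF g] by (auto simp: codes_graph_def)
  qed
  show "\<forall>B. graph_below x B"
    unfolding graph_below_def using le edge by (metis odd_two_times_div_two_succ)
next
  assume "\<forall>B. graph_below x B"
  then have g: "x i \<le> 1" "odd i \<Longrightarrow> x i \<noteq> 0 \<Longrightarrow>
      p1 (i div 2) < p2 (i div 2) \<and> x (2 * p1 (i div 2)) \<noteq> 0 \<and> x (2 * p2 (i div 2)) \<noteq> 0" for i
    unfolding graph_below_def by blast+
  have "codes_graph x {u. x (2 * u) \<noteq> 0} {(u, v). x (2 * pr u v + 1) \<noteq> 0}"
    unfolding codes_graph_def
  proof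
    show "{(u, v). x (2 * pr u v + 1) \<noteq> 0}
        \<subseteq> {(u, v). u \<in> {u. x (2 * u) \<noteq> 0} \<and> v \<in> {u. x (2 * u) \<noteq> 0} \<and> u < v}"
      using g(2)[of "2 * pr u v + 1" for u v] by auto
    have "x i = of_bool (x i \<noteq> 0)" for i using g(1)[of i] by (cases "x i") auto
    then show "x = join (\<lambda>u. of_bool (u \<in> {u. x (2 * u) \<noteq> 0}))
        (\<lambda>k. of_bool (prod_decode k \<in> {(u, v). x (2 * pr u v + 1) \<noteq> 0}))"
      by (auto simp: fun_eq_iff join_def split_beta)
  qed
  then show "\<exists>V E. codes_graph x V E" by blast
qed

lemma path_connected_iff_links:
  assumes "codes_graph x V E"
  shows "path_connected E a b \<longleftrightarrow> (\<exists>B w l. nthc w 0 = a \<and> nthc w l = b \<and>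
    (\<forall>i<l. adjacent_below x B (nthc w i) (nthc w (Suc i))))"
proof
  assume "path_connected E a b"
  then obtain l where "(a, b) \<in> (E \<union> E\<inverse>) ^^ l"
    unfolding path_connected_def using rtrancl_imp_relpow by blast
  then obtain f where f: "f 0 = a" "f l = b" "\<And>i. i < l \<Longrightarrow> (f i, f (Suc i)) \<in> E \<union> E\<inverse>"
    unfolding relpow_fun_conv by blast
  define w where "w = list_encode (map f [0..<Suc l])"
  define B where "B = (\<Sum>i<l. 2 * pr (f i) (f (Suc i)) + 2 * pr (f (Suc i)) (f i) + 2)"
  have w: "nthc w i = f i" if "i \<le> l" for i
    unfolding w_def using that by (intro nthc_map) simp
  have "adjacent_below x B (f i) (f (Suc i))" if "i < l" for i
  proof -
    have "2 * pr (f i) (f (Suc i)) + 2 * pr (f (Suc i)) (f i) + 2 \<le> B"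
      unfolding B_def using that by (intro member_le_sum) auto
    then show ?thesis using f(3)[OF that] codes_graph_iff(2)[OF assms]
      by (auto simp: adjacent_below_def)
  qed
  then show "\<exists>B w l. nthc w 0 = a \<and> nthc w l = b \<and>
      (\<forall>i<l. adjacent_below x B (nthc w i) (nthc w (Suc i)))"
    using w f(1,2) by (intro exI[of _ B] exI[of _ w] exI[of _ l]) auto
next
  assume "\<exists>B w l. nthc w 0 = a \<and> nthc w l = b \<and>
    (\<forall>i<l. adjacent_below x B (nthc w i) (nthc w (Suc i)))"
  then obtain B w l where w: "nthc w 0 = a" "nthc w l = b"
    "\<And>i. i < l \<Longrightarrow> adjacent_below x B (nthc w i) (nthc w (Suc i))" by blast
  have "(nthc w i, nthc w (Suc i)) \<in> E \<union> E\<inverse>" if "i < l" for i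
    using w(3)[OF that] codes_graph_iff(2)[OF assms] by (auto simp: adjacent_below_def)
  then have "(a, b) \<in> (E \<union> E\<inverse>) ^^ l"
    unfolding relpow_fun_conv using w(1,2) by (intro exI[of _ "nthc w"]) simp
  then show "path_connected E a b"
    unfolding path_connected_def by (rule relpow_imp_rtrancl)
qed

text \<open>
  Both directions of the reduction to \<open>Truth\<close> are contained in this equivalence: a name of one side
  is, up to pairing, a name of the other.
\<close>

lemma row_link_search_iff:
  "row (link_search x) n = (\<lambda>_. 0) \<longleftrightarrow>
    (\<exists>V E. codes_graph x V E \<and> p1 n \<in> V \<and> p2 n \<in> V \<and> \<not> path_connected E (p1 n) (p2 n))"
proof (cases "\<exists>V E. codes_graph x V E")
  case True
  then obtain V E where g: "codes_graph x V E" by blast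
  have unique: "V' = V" "E' = E" if "codes_graph x V' E'" for V' E'
    using codes_graph_iff[OF g] codes_graph_iff[OF that] by (auto simp: set_eq_iff)
  show ?thesis
    unfolding row_link_search unlinked_def
    using True[unfolded ex_codes_graph_iff] path_connected_iff_links[OF g, of "p1 n" "p2 n"]
      codes_graph_iff(1)[OF g] unique g by blast
next
  case False
  then show ?thesis using ex_codes_graph_iff[of x] unfolding row_link_search unlinked_def by blast
qed

lemma unlinked_cong:
  assumes "\<And>i. i < N \<Longrightarrow> y i = x i" "B \<le> N" "2 * a < N" "2 * b < N"
  shows "unlinked y a b B w l \<longleftrightarrow> unlinked x a b B w l"
proof -
  have "2 * p1 (i div 2) < N" "2 * p2 (i div 2) < N" "i < N" if "i < B" for i
    using that assms(2) p1_le[of "i div 2"] p2_le[of "i div 2"] by linarith+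
  then have "graph_below y B \<longleftrightarrow> graph_below x B"
    unfolding graph_below_def using assms(1) by (intro all_cong) simp
  moreover have "adjacent_below y B u v \<longleftrightarrow> adjacent_below x B u v" for u v
    unfolding adjacent_below_def
    using assms(1)[of "2 * pr u v + 1"] assms(1)[of "2 * pr v u + 1"] assms(2) by auto
  ultimately show ?thesis
    unfolding unlinked_def using assms(1,3,4) by simp
qed

lemma prefix_computable_link_search: "prefix_computable link_search"
proof (rule prefix_computableI[where a = 2])
  show "computable (\<lambda>y. of_bool (\<not> unlinked (nthc (p2 y)) (p1 (p1 (p1 y))) (p2 (p1 (p1 y)))
      (p1 (p2 (p1 y))) (p1 (p2 (p2 (p1 y)))) (p2 (p2 (p2 (p1 y))))))"
    unfolding unlinked_def graph_below_def adjacent_below_def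
    by (intro computable_intros) simp_all
  fix x n L assume L: "\<And>i. i < 2 * Suc n \<Longrightarrow> nthc L i = x i"
  have "p1 (p1 n) \<le> n" "p2 (p1 n) \<le> n" "p1 (p2 n) \<le> n"
    using p1_le p2_le order_trans by blast+
  then show "link_search x n = of_bool (\<not> unlinked (nthc L) (p1 (p1 n)) (p2 (p1 n))
      (p1 (p2 n)) (p1 (p2 (p2 n))) (p2 (p2 (p2 n))))"
    unfolding link_search_def using unlinked_cong[OF L] by simp
qed

lemma (in effective_coding) DisConn_reducible_Truth:
  "m_reducible C (baire C) (DisConn C) (baire C) (Truth C)"
proof (rule m_reducibleI[OF subobject_DisConn subobject_Truth prefix_computable_link_search])
  have maps: "computable (\<lambda>y. y)" "computable (\<lambda>y. p1 (p1 y))" "computable (\<lambda>y. p2 (p1 y))"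
    by (intro computable_intros)+
  show "(\<lambda>c. tuple C (nat_op (\<lambda>y. y) (tuple C (fst_code c) (fst_code (snd_code c))))
      (functional_op link_search (snd_code (snd_code c)))) \<in> total_maps"
    by (intro total_maps_intros maps prefix_computable_link_search)
  show "(\<lambda>c. tuple C (nat_op (\<lambda>y. p1 (p1 y)) (tuple C (fst_code (snd_code c)) (fst_code (snd_code c))))
      (tuple C (nat_op (\<lambda>y. p2 (p1 y)) (tuple C (fst_code (snd_code c)) (fst_code (snd_code c))))
        (fst_code c))) \<in> total_maps"
    by (intro total_maps_intros maps)
  show "x \<in> points (DisConn C) \<longleftrightarrow> link_search x \<in> points (Truth C)"
    if "x \<in> points (baire C)" for x
  proof -
    have "(\<exists>n. row (link_search x) n = (\<lambda>_. 0)) \<longleftrightarrow>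
        (\<exists>a b V E. codes_graph x V E \<and> a \<in> V \<and> b \<in> V \<and> \<not> path_connected E a b)"
      unfolding row_link_search_iff by (metis fst_conv snd_conv prod_encode_inverse)
    then show ?thesis using that points_functional[OF prefix_computable_link_search]
      by (auto simp: Truth_def DisConn_def)
  qed
  show "names (Truth C) (tuple C (nat_op (\<lambda>y. y) (tuple C (fst_code p) (fst_code (snd_code p))))
      (functional_op link_search (snd_code (snd_code p)))) (link_search x)"
    if "names (DisConn C) p x" for p x
    using that functional_op(2)[OF prefix_computable_link_search]
    by (auto simp: Truth_def DisConn_def row_link_search_iff nat_op(2)[OF maps(1)]) blast
  show "names (DisConn C) (tuple C (nat_op (\<lambda>y. p1 (p1 y))
        (tuple C (fst_code (snd_code (tuple C p q))) (fst_code (snd_code (tuple C p q)))))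
      (tuple C (nat_op (\<lambda>y. p2 (p1 y))
        (tuple C (fst_code (snd_code (tuple C p q))) (fst_code (snd_code (tuple C p q)))))
        (fst_code (tuple C p q)))) x"
    if "names (baire C) p x" "names (Truth C) q (link_search x)" for p q x
    using that
    by (auto simp: Truth_def row_link_search_iff nat_op(2)[OF maps(2)] nat_op(2)[OF maps(3)]
        intro: names_DisConnI)
qed

section \<open>Separations by perturbation\<close>

text \<open>
  The predicates \<open>observable\<close> stand for the semidecidable relations between codes and numbers, and
  \<open>code_maps\<close> for the maps under which they are stable.  A value of a realizer is inspected only
  through \<open>first_number\<close> and \<open>second_number\<close>, the numbers in a pair or triple, and a name of a
  sequence only through \<open>value_at\<close>; in Baire space each of these depends on finitely many entries,
  whereas the domain of a realizer need not be open.  For the same reason \<open>code_maps_realizable\<close>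
  composes only with realizers that are defined on all names of sequences.
\<close>

locale perturbable_coding = effective_coding C total_maps fst_code snd_code
  for C :: "'c coding_system" and total_maps fst_code snd_code +
  fixes code_maps :: "('c \<Rightarrow> nat \<Rightarrow> 'c option) set"
    and observable :: "('c \<Rightarrow> nat \<Rightarrow> bool) \<Rightarrow> bool"
    and first_number second_number :: "('c \<rightharpoonup> 'c) \<Rightarrow> 'c \<Rightarrow> nat \<Rightarrow> bool"
    and value_at :: "'c \<Rightarrow> nat \<Rightarrow> nat \<Rightarrow> bool"
  assumes code_maps_id: "(\<lambda>p n. Some p) \<in> code_maps"
    and code_maps_nat: "computable a \<Longrightarrow> (\<lambda>p n. Some (nat_name C (a n))) \<in> code_maps"
    and code_maps_tuple: "E \<in> code_maps \<Longrightarrow> F \<in> code_maps \<Longrightarrow>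
      (\<lambda>p n. Option.bind (E p n) (\<lambda>c. Option.bind (F p n) (\<lambda>d. Some (tuple C c d)))) \<in> code_maps"
    and code_maps_realizable: "E \<in> code_maps \<Longrightarrow> h \<in> realizable C \<Longrightarrow>
      (\<And>p x. names (baire C) p x \<Longrightarrow> h p \<noteq> None) \<Longrightarrow> (\<lambda>p n. Option.bind (E p n) h) \<in> code_maps"
    and first_number: "r \<in> realizable C \<Longrightarrow> r c = Some (tuple C (nat_name C k) q) \<Longrightarrow>
      first_number r c l \<longleftrightarrow> l = k"
    and second_number: "r \<in> realizable C \<Longrightarrow> r c = Some (tuple C u (tuple C (nat_name C k) q)) \<Longrightarrow>
      second_number r c l \<longleftrightarrow> l = k"
    and value_at: "names (baire C) q y \<Longrightarrow> value_at q i v \<longleftrightarrow> y i = v"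
    and observable_out1: "E \<in> code_maps \<Longrightarrow> r \<in> realizable C \<Longrightarrow> computable a \<Longrightarrow>
      observable (\<lambda>p n. \<exists>c. E p n = Some c \<and> first_number r c (a n))"
    and observable_out2: "E \<in> code_maps \<Longrightarrow> r \<in> realizable C \<Longrightarrow> computable a \<Longrightarrow>
      observable (\<lambda>p n. \<exists>c. E p n = Some c \<and> second_number r c (a n))"
    and observable_val: "E \<in> code_maps \<Longrightarrow> computable a \<Longrightarrow> computable b \<Longrightarrow>
      observable (\<lambda>p n. \<exists>c. E p n = Some c \<and> value_at c (a n) (b n))"
    and observable_decidable: "decidable D \<Longrightarrow> observable (\<lambda>p n. D n)"
    and observable_conj: "observable P \<Longrightarrow> observable Q \<Longrightarrow> observable (\<lambda>p n. P p n \<and> Q p n)"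
    and observable_disj: "observable P \<Longrightarrow> observable Q \<Longrightarrow> observable (\<lambda>p n. P p n \<or> Q p n)"
    and perturbation: "observable S \<Longrightarrow> computable (\<lambda>y. z (p1 y) (p1 (p2 y)) (p2 (p2 y))) \<Longrightarrow>
      (\<And>d s k. k < s \<Longrightarrow> z d s k = x k) \<Longrightarrow> (\<And>p. names (baire C) p x \<Longrightarrow> \<exists>d. S p d) \<Longrightarrow>
      \<exists>p d s. names (baire C) p (z d s) \<and> S p d"
begin

lemma observable_out_nat:
  assumes "r \<in> realizable C" "computable a" "computable b"
  shows "observable (\<lambda>p n. first_number r (tuple C (nat_name C (a n)) p) (b n))"
    "observable (\<lambda>p n. second_number r (tuple C (nat_name C (a n)) p) (b n))"
  using observable_out1[OF code_maps_tuple[OF code_maps_nat[OF assms(2)] code_maps_id] assms(1,3)]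
    observable_out2[OF code_maps_tuple[OF code_maps_nat[OF assms(2)] code_maps_id] assms(1,3)] by simp_all

lemma observable_out_nat_nat:
  assumes "r \<in> realizable C" "computable a" "computable b" "computable c"
  shows "observable (\<lambda>p n. first_number r (tuple C (nat_name C (a n)) (tuple C (nat_name C (b n)) p)) (c n))"
    "observable (\<lambda>p n. second_number r (tuple C (nat_name C (a n)) (tuple C (nat_name C (b n)) p)) (c n))"
  using observable_out1[OF code_maps_tuple[OF code_maps_nat[OF assms(2)]
        code_maps_tuple[OF code_maps_nat[OF assms(3)] code_maps_id]] assms(1,4)]
    observable_out2[OF code_maps_tuple[OF code_maps_nat[OF assms(2)]
        code_maps_tuple[OF code_maps_nat[OF assms(3)] code_maps_id]] assms(1,4)] by simp_all

end

text \<open>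
  A hypothetical reduction of \<open>A\<close> to \<open>B\<close>, with its realizers.
\<close>

locale reduction_setting = perturbable_coding C total_maps fst_code snd_code code_maps observable first_number second_number value_at
  for C :: "'c coding_system" and total_maps fst_code snd_code code_maps observable first_number second_number value_at +
  fixes A B :: "('c, nat \<Rightarrow> nat) rep_space" and \<phi> h rm rp
  assumes realizable: "h \<in> realizable C" "rm \<in> realizable C" "rp \<in> realizable C"
    and h_ex: "names (baire C) p x \<Longrightarrow> \<exists>q. h p = Some q \<and> names (baire C) q (\<phi> x)"
    and points_iff: "x \<in> points (baire C) \<Longrightarrow> x \<in> points A \<longleftrightarrow> \<phi> x \<in> points B"
    and rm_ex: "names A p x \<Longrightarrow> \<exists>q. rm p = Some q \<and> names B q (\<phi> x)"
    and rp_ex: "names (baire C) p x \<Longrightarrow> names B q (\<phi> x) \<Longrightarrow>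
      \<exists>s. rp (tuple C p q) = Some s \<and> names A s x"
begin

lemma h_code_map: "(\<lambda>p n. h p) \<in> code_maps"
proof -
  have "h p \<noteq> None" if "names (baire C) p x" for p x
    using h_ex[OF that] by auto
  then show ?thesis using code_maps_realizable[OF code_maps_id realizable(1)] by simp
qed

lemma observable_val_h:
  assumes "computable a" "computable b"
  shows "observable (\<lambda>p n. \<exists>q. h p = Some q \<and> value_at q (a n) (b n))"
  using observable_val[OF h_code_map assms] .

lemma observable_val_functional:
  assumes "prefix_computable F" "computable a" "computable b"
  shows "observable (\<lambda>p n. \<exists>q. h p = Some q \<and> value_at (functional_op F q) (a n) (b n))"
proof -
  have "(\<lambda>p n. Option.bind (h p) (\<lambda>c. Some (functional_op F c))) \<in> code_maps"
    by (rule code_maps_realizable[OF h_code_map total_maps_realizable[OF functional_op(1)[OF assms(1)]]]) simp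
  moreover have "(\<lambda>p n. \<exists>q. h p = Some q \<and> value_at (functional_op F q) (a n) (b n)) =
      (\<lambda>p n. \<exists>c. Option.bind (h p) (\<lambda>c. Some (functional_op F c)) = Some c \<and> value_at c (a n) (b n))"
    by (auto simp: fun_eq_iff bind_eq_Some_conv)
  ultimately show ?thesis using observable_val assms(2,3) by (simp only:)
qed

lemma observable_rp:
  assumes "computable a" "computable b"
  shows "observable (\<lambda>p n. \<exists>q. h p = Some q \<and> first_number rp (tuple C p (tuple C (nat_name C (a n)) q)) (b n))"
    (is "observable ?P")
    "observable (\<lambda>p n. \<exists>q. h p = Some q \<and> second_number rp (tuple C p (tuple C (nat_name C (a n)) q)) (b n))"
    (is "observable ?Q")
proof -
  let ?E = "\<lambda>p n. Option.bind (Some p) (\<lambda>c. Option.bind (Option.bind (Some (nat_name C (a n)))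
      (\<lambda>c. Option.bind (h p) (\<lambda>d. Some (tuple C c d)))) (\<lambda>d. Some (tuple C c d)))"
  have E: "?E \<in> code_maps"
    by (intro code_maps_tuple code_maps_id code_maps_nat h_code_map assms)
  have "?P = (\<lambda>p n. \<exists>d. ?E p n = Some d \<and> first_number rp d (b n))"
    "?Q = (\<lambda>p n. \<exists>d. ?E p n = Some d \<and> second_number rp d (b n))"
    by (auto simp: fun_eq_iff bind_eq_Some_conv)
  then show "observable ?P" "observable ?Q"
    using observable_out1[OF E realizable(3) assms(2)] observable_out2[OF E realizable(3) assms(2)]
    by (simp_all only:)
qed

lemma observable_rp_rp:
  assumes "computable a" "computable b" "computable c"
  shows "observable (\<lambda>p n. \<exists>q. h p = Some q \<and>
      first_number rp (tuple C p (tuple C (nat_name C (a n)) (tuple C (nat_name C (b n)) q))) (c n))"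
    (is "observable ?P")
    "observable (\<lambda>p n. \<exists>q. h p = Some q \<and>
      second_number rp (tuple C p (tuple C (nat_name C (a n)) (tuple C (nat_name C (b n)) q))) (c n))"
    (is "observable ?Q")
proof -
  let ?E = "\<lambda>p n. Option.bind (Some p) (\<lambda>c. Option.bind (Option.bind (Some (nat_name C (a n)))
      (\<lambda>c. Option.bind (Option.bind (Some (nat_name C (b n)))
        (\<lambda>c. Option.bind (h p) (\<lambda>d. Some (tuple C c d)))) (\<lambda>d. Some (tuple C c d))))
      (\<lambda>d. Some (tuple C c d)))"
  have E: "?E \<in> code_maps"
    by (intro code_maps_tuple code_maps_id code_maps_nat h_code_map assms)
  have "?P = (\<lambda>p n. \<exists>d. ?E p n = Some d \<and> first_number rp d (c n))"
    "?Q = (\<lambda>p n. \<exists>d. ?E p n = Some d \<and> second_number rp d (c n))"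
    by (auto simp: fun_eq_iff bind_eq_Some_conv)
  then show "observable ?P" "observable ?Q"
    using observable_out1[OF E realizable(3) assms(3)] observable_out2[OF E realizable(3) assms(3)]
    by (simp_all only:)
qed

lemmas observable_intros = observable_conj observable_disj observable_val_h observable_val_functional observable_rp observable_rp_rp
  observable_out_nat[OF realizable(2)] observable_out_nat_nat[OF realizable(2)] observable_decidable

end

lemma (in perturbable_coding) reduction_settingE:
  assumes "m_reducible C (baire C) A (baire C) B"
  obtains \<phi> h rm rp where
    "reduction_setting C total_maps fst_code snd_code code_maps observable first_number second_number value_at A B \<phi> h rm rp"
proof -
  have sub: "subobject C A (baire C)" "subobject C B (baire C)"
    using assms by (simp_all add: m_reducible_def)
  obtain \<phi> where morph: "morphism C (baire C) (baire C) \<phi>"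
    and ex: "\<exists>rm\<in>realizable C. \<exists>rp\<in>realizable C.
        (\<forall>x\<in>points (baire C). (x \<in> points A) = (\<phi> x \<in> points B)) \<and>
        (\<forall>p. \<forall>x\<in>points A. names A p x \<longrightarrow> (\<exists>q. rm p = Some q \<and> names B q (\<phi> x))) \<and>
        (\<forall>p q. \<forall>x\<in>points A. names (baire C) p x \<and> names B q (\<phi> x) \<longrightarrow>
           (\<exists>s. rp (tuple C p q) = Some s \<and> names A s x))"
    using assms unfolding m_reducible_def by (elim conjE exE)
  obtain rm rp where r: "rm \<in> realizable C" "rp \<in> realizable C"
    and iff: "\<forall>x\<in>points (baire C). (x \<in> points A) = (\<phi> x \<in> points B)"
    and rm: "\<forall>p. \<forall>x\<in>points A. names A p x \<longrightarrow> (\<exists>q. rm p = Some q \<and> names B q (\<phi> x))"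
    and rp: "\<forall>p q. \<forall>x\<in>points A. names (baire C) p x \<and> names B q (\<phi> x) \<longrightarrow>
           (\<exists>s. rp (tuple C p q) = Some s \<and> names A s x)"
    using ex by (elim bexE conjE)
  obtain h where h: "h \<in> realizable C"
    "\<forall>p x. names (baire C) p x \<longrightarrow> (\<exists>q. h p = Some q \<and> names (baire C) q (\<phi> x))"
    using morph unfolding morphism_def by (elim conjE bexE)
  have A: "x \<in> points A" if "names A p x" for p x
    using sub(1) that unfolding subobject_def represented_space_def by metis
  have B: "x \<in> points B" if "names B p x" for p x
    using sub(2) that unfolding subobject_def represented_space_def by metis
  have "reduction_setting C total_maps fst_code snd_code code_maps observable first_number second_number value_at A B \<phi> h rm rp"
  proof unfold_locales
    show "\<exists>s. rp (tuple C p q) = Some s \<and> names A s x"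
      if "names (baire C) p x" "names B q (\<phi> x)" for p q x
    proof -
      have "x \<in> points (baire C)" using that(1) baire_points by metis
      then have "x \<in> points A" using iff B[OF that(2)] by simp
      then show ?thesis using rp that by simp
    qed
  qed (use h r iff rm A in simp_all)
  then show thesis by (rule that)
qed

subsection \<open>Boundedness does not reduce to finite support\<close>

text \<open>
  Vanishing on \<open>[k, n)\<close> is expressed by one value of a transformed sequence, which makes it
  observable.
\<close>

definition tail_sum :: "nat \<Rightarrow> (nat \<Rightarrow> nat) \<Rightarrow> nat \<Rightarrow> nat" where
  "tail_sum k y n = (\<Sum>i<n. if i < k then 0 else y i)"

lemma prefix_computable_tail_sum: "prefix_computable (tail_sum k)"
proof (rule prefix_computableI[where a = 1])
  show "computable (\<lambda>y. \<Sum>i<p1 y. if i < k then 0 else nthc (p2 y) i)"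
    by (intro computable_intros)
qed (auto simp: tail_sum_def intro!: sum.cong)

lemma tail_sum_eq_0_iff: "tail_sum k y n = 0 \<longleftrightarrow> (\<forall>i. k \<le> i \<and> i < n \<longrightarrow> y i = 0)"
  by (auto simp: tail_sum_def not_less)

lemma (in perturbable_coding) BddSeq_not_reducible_Fin:
  "\<not> m_reducible C (baire C) (BddSeq C) (baire C) (Fin C)"
proof
  assume "m_reducible C (baire C) (BddSeq C) (baire C) (Fin C)"
  then obtain \<phi> h rm rp where
    "reduction_setting C total_maps fst_code snd_code code_maps observable first_number second_number value_at (BddSeq C) (Fin C) \<phi> h rm rp"
    by (rule reduction_settingE)
  then interpret reduction_setting C total_maps fst_code snd_code code_maps observable first_number second_number value_at "BddSeq C" "Fin C" \<phi> h rm rp .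
  have BddSeqI: "names (BddSeq C) (tuple C (nat_name C b) p) x"
    if "names (baire C) p x" "\<And>n. x n \<le> b" for b p x
    using that by (auto simp: BddSeq_def)
  have FinI: "names (Fin C) (tuple C (nat_name C n) p) x"
    if "names (baire C) p x" "\<And>m. m \<ge> n \<Longrightarrow> x m = 0" for n p x
    using that by (auto simp: Fin_def)
  have rm_obs: "\<exists>n. (\<forall>n'. first_number rm (tuple C (nat_name C b) p) n' \<longleftrightarrow> n' = n) \<and> (\<forall>m\<ge>n. \<phi> x m = 0)"
    if "names (baire C) p x" "\<And>n. x n \<le> b" for b p x
    using rm_ex[OF BddSeqI[OF that]] first_number[OF realizable(2)] unfolding Fin_def by fastforce
  have rp_obs: "\<exists>b. (\<forall>b'. first_number rp (tuple C p (tuple C (nat_name C n) q)) b' \<longleftrightarrow> b' = b) \<and> (\<forall>k. x k \<le> b)"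
    if "names (baire C) p x" "names (baire C) q (\<phi> x)" "\<And>m. m \<ge> n \<Longrightarrow> \<phi> x m = 0" for n p q x
    using rp_ex[OF that(1) FinI[OF that(2,3)]] first_number[OF realizable(3)] unfolding BddSeq_def by fastforce
  have "(\<lambda>_. 0) \<in> points (BddSeq C)"
    using computable_points[OF computable_const] by (simp add: BddSeq_def)
  then have "\<phi> (\<lambda>_. 0) \<in> points (Fin C)"
    using points_iff[of "\<lambda>_. 0"] computable_points[OF computable_const] by simp
  then obtain n0 where n0: "\<And>m. m \<ge> n0 \<Longrightarrow> \<phi> (\<lambda>_. 0) m = 0"
    unfolding Fin_def by auto
  \<comment> \<open>The number \<open>d\<close> is a pair: the bound obtained from \<open>n0\<close>, and the bound on the support
    obtained from its successor.\<close>
  define S where "S p d \<longleftrightarrow>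
      (\<exists>q. h p = Some q \<and> first_number rp (tuple C p (tuple C (nat_name C n0) q)) (p1 d)) \<and>
      first_number rm (tuple C (nat_name C (Suc (p1 d))) p) (p2 d) \<and>
      (\<exists>q. h p = Some q \<and> value_at (functional_op (tail_sum n0) q) (p2 d) 0)" for p d
  have val_sum: "value_at (functional_op (tail_sum n0) q) n 0 \<longleftrightarrow> (\<forall>i. n0 \<le> i \<and> i < n \<longrightarrow> y i = 0)"
    if "names (baire C) q y" for q y n
    using value_at[OF functional_op(2)[OF prefix_computable_tail_sum that]] tail_sum_eq_0_iff by simp
  have "\<exists>p d s. names (baire C) p (\<lambda>k. if k = s then Suc (p1 d) else 0) \<and> S p d"
  proof (rule perturbation)
    show "observable S" unfolding S_def[abs_def]
      by (intro observable_intros computable_intros prefix_computable_tail_sum)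
    show "computable (\<lambda>y. if p2 (p2 y) = p1 (p2 y) then Suc (p1 (p1 y)) else 0)"
      by (intro computable_intros)
    show "(if k = s then Suc (p1 d) else 0) = 0" if "k < s" for d s k :: nat
      using that by simp
    fix p assume p: "names (baire C) p (\<lambda>_. 0)"
    obtain q where q: "h p = Some q" "names (baire C) q (\<phi> (\<lambda>_. 0))" using h_ex[OF p] by blast
    obtain b where b: "first_number rp (tuple C p (tuple C (nat_name C n0) q)) b"
      using rp_obs[OF p q(2) n0] by blast
    obtain n where "first_number rm (tuple C (nat_name C (Suc b)) p) n"
      using rm_obs[OF p, of "Suc b"] by auto
    then have "S p (pr b n)" using b q n0 val_sum[OF q(2)] by (simp add: S_def)
    then show "\<exists>d. S p d" ..
  qed
  then obtain p d s where p: "names (baire C) p (\<lambda>k. if k = s then Suc (p1 d) else 0)" and S: "S p d"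
    by blast
  define x where "x = (\<lambda>k. if k = s then Suc (p1 d) else 0)"
  obtain q where q: "h p = Some q" "names (baire C) q (\<phi> x)" using h_ex[OF p] x_def by blast
  have "x k \<le> Suc (p1 d)" for k by (simp add: x_def)
  then obtain n where n: "\<forall>n'. first_number rm (tuple C (nat_name C (Suc (p1 d))) p) n' \<longleftrightarrow> n' = n"
      "\<forall>m\<ge>n. \<phi> x m = 0"
    using rm_obs[OF p[folded x_def]] by blast
  have "p2 d = n" using S n(1) unfolding S_def by simp
  then have "\<forall>m\<ge>p2 d. \<phi> x m = 0" using n(2) by simp
  moreover have "\<forall>i. n0 \<le> i \<and> i < p2 d \<longrightarrow> \<phi> x i = 0"
    using S val_sum[OF q(2)] q(1) unfolding S_def by auto
  ultimately have "\<And>m. m \<ge> n0 \<Longrightarrow> \<phi> x m = 0" by (meson not_le)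
  then obtain b where "\<forall>b'. first_number rp (tuple C p (tuple C (nat_name C n0) q)) b' \<longleftrightarrow> b' = b" "\<forall>k. x k \<le> b"
    using rp_obs[OF p[folded x_def] q(2)] by blast
  moreover have "first_number rp (tuple C p (tuple C (nat_name C n0) q)) (p1 d)"
    using S q(1) unfolding S_def by simp
  ultimately have "x s \<le> p1 d" by simp
  then show False by (simp add: x_def)
qed

subsection \<open>One of two candidates does not reduce to boundedness\<close>

lemma (in perturbable_coding) HalfTruth_not_reducible_BddSeq:
  "\<not> m_reducible C (baire C) (HalfTruth C) (baire C) (BddSeq C)"
proof
  assume "m_reducible C (baire C) (HalfTruth C) (baire C) (BddSeq C)"
  then obtain \<phi> h rm rp where
    "reduction_setting C total_maps fst_code snd_code code_maps observable first_number second_number value_at (HalfTruth C) (BddSeq C) \<phi> h rm rp"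
    by (rule reduction_settingE)
  then interpret reduction_setting C total_maps fst_code snd_code code_maps observable first_number second_number value_at "HalfTruth C" "BddSeq C" \<phi> h rm rp .
  have rm_obs: "\<exists>b. (\<forall>b'. first_number rm (tuple C (nat_name C i) (tuple C (nat_name C i) p)) b' \<longleftrightarrow> b' = b) \<and>
      (\<forall>n. \<phi> x n \<le> b)"
    if "names (baire C) p x" "row x i = (\<lambda>_. 0)" for i p x
  proof -
    have "names (HalfTruth C) (tuple C (nat_name C i) (tuple C (nat_name C i) p)) x"
      using that by (auto simp: HalfTruth_def)
    from rm_ex[OF this] show ?thesis using first_number[OF realizable(2)] unfolding BddSeq_def by fastforce
  qed
  have rp_obs: "\<exists>n m. (\<forall>n'. first_number rp (tuple C p (tuple C (nat_name C b) q)) n' \<longleftrightarrow> n' = n) \<and>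
      (\<forall>m'. second_number rp (tuple C p (tuple C (nat_name C b) q)) m' \<longleftrightarrow> m' = m) \<and>
      (row x n = (\<lambda>_. 0) \<or> row x m = (\<lambda>_. 0))"
    if "names (baire C) p x" "names (baire C) q (\<phi> x)" "\<And>n. \<phi> x n \<le> b" for b p q x
  proof -
    have "names (BddSeq C) (tuple C (nat_name C b) q) (\<phi> x)"
      using that by (auto simp: BddSeq_def)
    from rp_ex[OF that(1) this] show ?thesis
      using first_number[OF realizable(3)] second_number[OF realizable(3)] unfolding HalfTruth_def by fastforce
  qed
  \<comment> \<open>The entries of \<open>d\<close> are the bounds obtained from the rows 0, 1 and 2 and the two candidates
    obtained from their sum, which is at least as large as each of them.\<close>
  define S where "S p d \<longleftrightarrow>
      first_number rm (tuple C (nat_name C 0) (tuple C (nat_name C 0) p)) (nthc d 0) \<and>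
      first_number rm (tuple C (nat_name C 1) (tuple C (nat_name C 1) p)) (nthc d 1) \<and>
      first_number rm (tuple C (nat_name C 2) (tuple C (nat_name C 2) p)) (nthc d 2) \<and>
      (\<exists>q. h p = Some q \<and> first_number rp (tuple C p (tuple C (nat_name C (nthc d 0 + nthc d 1 + nthc d 2)) q)) (nthc d 3)) \<and>
      (\<exists>q. h p = Some q \<and> second_number rp (tuple C p (tuple C (nat_name C (nthc d 0 + nthc d 1 + nthc d 2)) q)) (nthc d 4))" for p d
  let ?z = "\<lambda>d s k. of_bool (s \<le> k \<and> (p1 k = nthc d 3 \<or> p1 k = nthc d 4)) :: nat"
  have "\<exists>p d s. names (baire C) p (?z d s) \<and> S p d"
  proof (rule perturbation)
    show "observable S" unfolding S_def[abs_def]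
      by (intro observable_intros computable_intros)
    show "computable (\<lambda>y. ?z (p1 y) (p1 (p2 y)) (p2 (p2 y)))"
      by (intro computable_intros)
    show "?z d s k = 0" if "k < s" for d s k
      using that by simp
    fix p assume p: "names (baire C) p (\<lambda>_. 0)"
    have row0: "row (\<lambda>_. 0) i = (\<lambda>_. 0)" for i by (simp add: row_def)
    obtain q where q: "h p = Some q" "names (baire C) q (\<phi> (\<lambda>_. 0))" using h_ex[OF p] by blast
    obtain b where b: "\<And>i. first_number rm (tuple C (nat_name C i) (tuple C (nat_name C i) p)) (b i)"
      "\<And>i n. \<phi> (\<lambda>_. 0) n \<le> b i"
      using rm_obs[OF p row0] by metis
    have "\<phi> (\<lambda>_. 0) n \<le> b 0 + b 1 + b 2" for n
      using b(2)[of n 0] by simp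
    then obtain n m where "first_number rp (tuple C p (tuple C (nat_name C (b 0 + b 1 + b 2)) q)) n"
      "second_number rp (tuple C p (tuple C (nat_name C (b 0 + b 1 + b 2)) q)) m"
      using rp_obs[OF p q(2), of "b 0 + b 1 + b 2"] by blast
    then have "S p (list_encode [b 0, b 1, b 2, n, m])"
      using b(1) q(1) by (simp add: S_def nthc_list_encode del: list_encode.simps)
    then show "\<exists>d. S p d" ..
  qed
  then obtain p d s where p: "names (baire C) p (?z d s)" and S: "S p d" by blast
  define x where "x = ?z d s"
  obtain q where q: "h p = Some q" "names (baire C) q (\<phi> x)" using h_ex[OF p] x_def by blast
  have "\<exists>i<3. i \<noteq> a \<and> i \<noteq> b" for a b :: nat by presburger
  then obtain i where i: "i < 3" "i \<noteq> nthc d 3" "i \<noteq> nthc d 4" by blast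
  have "row x i = (\<lambda>_. 0)" using i by (auto simp: row_def x_def)
  then obtain b where b: "\<forall>b'. first_number rm (tuple C (nat_name C i) (tuple C (nat_name C i) p)) b' \<longleftrightarrow> b' = b"
      "\<forall>n. \<phi> x n \<le> b"
    using rm_obs[OF p[folded x_def]] by blast
  have "i = 0 \<or> i = 1 \<or> i = 2" using i(1) by auto
  then have "b = nthc d i" using S b(1) unfolding S_def by metis
  then have "b \<le> nthc d 0 + nthc d 1 + nthc d 2" using \<open>i = 0 \<or> i = 1 \<or> i = 2\<close> by auto
  then have "\<And>n. \<phi> x n \<le> nthc d 0 + nthc d 1 + nthc d 2" using b(2) order_trans by blast
  then have "row x (nthc d 3) = (\<lambda>_. 0) \<or> row x (nthc d 4) = (\<lambda>_. 0)"
    using rp_obs[OF p[folded x_def] q(2)] S q(1) unfolding S_def by (metis option.inject)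
  moreover have "row x n s \<noteq> 0" if "n = nthc d 3 \<or> n = nthc d 4" for n
    using that le_prod_encode_2[of s n] by (auto simp: row_def x_def)
  ultimately show False by (metis (full_types))
qed

subsection \<open>Disconnectedness does not reduce to one of two candidates\<close>

definition side :: "nat \<Rightarrow> nat \<Rightarrow> bool" where
  "side t u \<longleftrightarrow> t < 4 \<and> u = t \<or> \<not> t < 4 \<and> (u = 0 \<or> u = 2)"

definition separates :: "nat \<Rightarrow> nat \<Rightarrow> nat \<Rightarrow> bool" where
  "separates t a b \<longleftrightarrow> side t a \<noteq> side t b"

text \<open>
  The bipartition \<open>t < 4\<close> isolates the vertex \<open>t\<close>, and the bipartition 4 is \<open>{0, 2}, {1, 3}\<close>.
  Think of a reduction to half truths that offers the candidates 0 and 1 for the pair \<open>{0, 1}\<close>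
  and two more candidates for \<open>{2, 3}\<close>, and let \<open>s t i j\<close> say that the pair of vertices returned
  for the candidates \<open>i\<close> and \<open>j\<close> is separated by \<open>t\<close>.  If \<open>t\<close> separates \<open>{0, 1}\<close>, one of the first
  two candidates is true, and then all pairs returned for it must be separated; likewise for
  \<open>{2, 3}\<close>.  So \<open>t\<close> is refuted by the answers if this fails for both candidates of a pair.
\<close>

definition refuted :: "nat \<Rightarrow> (nat \<Rightarrow> nat \<Rightarrow> nat \<Rightarrow> bool) \<Rightarrow> bool" where
  "refuted t s \<longleftrightarrow>
    separates t 0 1 \<and> \<not> (s t 0 0 \<and> s t 0 1) \<and> \<not> (s t 1 0 \<and> s t 1 1) \<or>
    separates t 2 3 \<and> \<not> (s t 0 0 \<and> s t 1 0) \<and> \<not> (s t 0 1 \<and> s t 1 1)"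

text \<open>
  Two isolating bipartitions determine the separated pair, which leaves no room for a third one of
  those listed.
\<close>

lemma separates_limits:
  "\<not> (separates 0 a b \<and> separates 1 a b \<and> separates 2 a b)"
  "\<not> (separates 0 a b \<and> separates 1 a b \<and> separates 3 a b)"
  "\<not> (separates 0 a b \<and> separates 2 a b \<and> separates 3 a b)"
  "\<not> (separates 1 a b \<and> separates 2 a b \<and> separates 3 a b)"
  "\<not> (separates 0 a b \<and> separates 2 a b \<and> separates 4 a b)"
  "\<not> (separates 1 a b \<and> separates 3 a b \<and> separates 4 a b)"
  by (auto simp: separates_def side_def)

text \<open>
  If no bipartition were refuted, the bipartitions 0 and 1 would need different candidates for
  \<open>{0, 1}\<close>, and 2 and 3 different candidates for \<open>{2, 3}\<close>, since no pair is separated by three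
  of them.  The candidates of 0 and 2 then return the pair \<open>{0, 2}\<close>, and those of 1 and 3 the pair
  \<open>{1, 3}\<close>.  So neither candidate for \<open>{0, 1}\<close> works for the bipartition 4.
\<close>

lemma ex_refuted:
  fixes a b :: "nat \<Rightarrow> nat \<Rightarrow> nat"
  shows "\<exists>t\<le>4. refuted t (\<lambda>t i j. separates t (a i j) (b i j))"
proof (rule ccontr)
  assume "\<not> ?thesis"
  then have n: "\<not> refuted 0 (\<lambda>t i j. separates t (a i j) (b i j))"
    "\<not> refuted 1 (\<lambda>t i j. separates t (a i j) (b i j))"
    "\<not> refuted 2 (\<lambda>t i j. separates t (a i j) (b i j))"
    "\<not> refuted 3 (\<lambda>t i j. separates t (a i j) (b i j))"
    "\<not> refuted 4 (\<lambda>t i j. separates t (a i j) (b i j))"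
    by auto
  have s: "separates 0 0 1" "separates 1 0 1" "separates 4 0 1" "separates 2 2 3" "separates 3 2 3"
    by (auto simp: separates_def side_def)
  show False
    using n[unfolded refuted_def] s separates_limits[of "a 0 0" "b 0 0"] separates_limits[of "a 0 1" "b 0 1"]
      separates_limits[of "a 1 0" "b 1 0"] separates_limits[of "a 1 1" "b 1 1"]
    by sat
qed

text \<open>
  Each of the four vertices is joined to one of two hubs, according to the bipartition \<open>t\<close>.  The hubs
  are large numbers, so that below position \<open>s\<close> the code looks like that of four isolated vertices
  without hubs.
\<close>

definition hub_edges :: "nat \<Rightarrow> nat \<Rightarrow> (nat \<times> nat) set" where
  "hub_edges t s = {(u, v). u < 4 \<and> v = s + 4 + of_bool (side t u)}"

definition hub_graph :: "nat \<Rightarrow> nat \<Rightarrow> nat \<Rightarrow> nat" where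
  "hub_graph t s = join (\<lambda>u. of_bool (u < 4 \<or> u = s + 4 \<or> u = s + 5))
    (\<lambda>k. of_bool (prod_decode k \<in> hub_edges t s))"

definition four_points :: "nat \<Rightarrow> nat" where
  "four_points = join (\<lambda>u. of_bool (u < 4)) (\<lambda>_. 0)"

lemma codes_four_points: "codes_graph four_points {..<4} {}"
  by (auto simp: codes_graph_def four_points_def)

lemma codes_hub_graph: "codes_graph (hub_graph t s) {u. u < 4 \<or> u = s + 4 \<or> u = s + 5} (hub_edges t s)"
  by (auto simp: codes_graph_def hub_graph_def hub_edges_def)

lemma hub_graph_below:
  assumes "k < s" shows "hub_graph t s k = four_points k"
proof -
  have "p2 (k div 2) \<noteq> s + 4 + n" for n using p2_le[of "k div 2"] assms by linarith
  then show ?thesis using assms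
    by (auto simp: hub_graph_def four_points_def join_def hub_edges_def split_beta)
qed

lemma path_connected_invariant:
  assumes "path_connected E a b" "\<And>u v. (u, v) \<in> E \<Longrightarrow> f u = f v" shows "f a = f b"
  using assms(1) unfolding path_connected_def
  by (induction rule: rtrancl_induct) (auto dest: assms(2))

text \<open>
  The side is invariant along edges if it is extended to the hubs.
\<close>

lemma path_connected_hub_edges:
  assumes "a < 4" "b < 4"
  shows "path_connected (hub_edges t s) a b \<longleftrightarrow> \<not> separates t a b"
proof
  assume *: "path_connected (hub_edges t s) a b"
  have "(if a < 4 then side t a else a = s + 5) = (if b < 4 then side t b else b = s + 5)"
    by (rule path_connected_invariant[OF *]) (auto simp: hub_edges_def)
  then show "\<not> separates t a b" using assms by (simp add: separates_def)
next
  assume "\<not> separates t a b"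
  then have "(a, s + 4 + of_bool (side t a)) \<in> hub_edges t s" "(b, s + 4 + of_bool (side t a)) \<in> hub_edges t s"
    using assms by (auto simp: hub_edges_def separates_def)
  then show "path_connected (hub_edges t s) a b"
    by (meson path_connected_edge path_connected_sym path_connected_trans)
qed

lemma codes_graph_unique:
  assumes "codes_graph x V E" "codes_graph x V' E'" shows "V = V'" "E = E'"
  using codes_graph_iff[OF assms(1)] codes_graph_iff[OF assms(2)] by (auto simp: set_eq_iff)

lemma (in perturbable_coding) DisConn_not_reducible_HalfTruth:
  "\<not> m_reducible C (baire C) (DisConn C) (baire C) (HalfTruth C)"
proof
  assume "m_reducible C (baire C) (DisConn C) (baire C) (HalfTruth C)"
  then obtain \<phi> h rm rp where
    "reduction_setting C total_maps fst_code snd_code code_maps observable first_number second_number value_at (DisConn C) (HalfTruth C) \<phi> h rm rp"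
    by (rule reduction_settingE)
  then interpret reduction_setting C total_maps fst_code snd_code code_maps observable first_number second_number value_at "DisConn C" "HalfTruth C" \<phi> h rm rp .
  have rm_obs: "\<exists>n m. (\<forall>n'. first_number rm (tuple C (nat_name C a) (tuple C (nat_name C b) p)) n' \<longleftrightarrow> n' = n) \<and>
      (\<forall>m'. second_number rm (tuple C (nat_name C a) (tuple C (nat_name C b) p)) m' \<longleftrightarrow> m' = m) \<and>
      (row (\<phi> x) n = (\<lambda>_. 0) \<or> row (\<phi> x) m = (\<lambda>_. 0))"
    if hyp: "names (baire C) p x" "codes_graph x V E" "a \<in> V" "b \<in> V" "\<not> path_connected E a b" for a b p x V E
  proof -
    obtain q where "rm (tuple C (nat_name C a) (tuple C (nat_name C b) p)) = Some q" "names (HalfTruth C) q (\<phi> x)"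
      using rm_ex[OF names_DisConnI[OF hyp]] by blast
    then show ?thesis using first_number[OF realizable(2)] second_number[OF realizable(2)] unfolding HalfTruth_def by fastforce
  qed
  have rp_obs: "\<exists>a b. (\<forall>a'. first_number rp (tuple C p (tuple C (nat_name C n) (tuple C (nat_name C m) q))) a' \<longleftrightarrow> a' = a) \<and>
      (\<forall>b'. second_number rp (tuple C p (tuple C (nat_name C n) (tuple C (nat_name C m) q))) b' \<longleftrightarrow> b' = b) \<and>
      a \<in> V \<and> b \<in> V \<and> \<not> path_connected E a b"
    if hyp: "names (baire C) p x" "names (baire C) q (\<phi> x)" "row (\<phi> x) n = (\<lambda>_. 0) \<or> row (\<phi> x) m = (\<lambda>_. 0)"
      "codes_graph x V E" for n m p q x V E
  proof -
    have "names (HalfTruth C) (tuple C (nat_name C n) (tuple C (nat_name C m) q)) (\<phi> x)"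
      using hyp(2,3) by (auto simp: HalfTruth_def)
    from rp_ex[OF hyp(1) this] obtain s where
      s: "rp (tuple C p (tuple C (nat_name C n) (tuple C (nat_name C m) q))) = Some s" "names (DisConn C) s x"
      by blast
    from s(2) obtain a b r V' E' where ab: "s = tuple C (nat_name C a) (tuple C (nat_name C b) r)"
      "codes_graph x V' E'" "a \<in> V'" "b \<in> V'" "\<not> path_connected E' a b"
      unfolding DisConn_def by auto
    then show ?thesis
      using s(1) first_number[OF realizable(3)] second_number[OF realizable(3)] codes_graph_unique[OF hyp(4) ab(2)] by fastforce
  qed
  \<comment> \<open>\<open>Z\<close>: row \<open>n\<close> of the image is seen to be nonzero, at position \<open>i\<close> with value \<open>v\<close>.
    \<open>Ans\<close>: the candidates \<open>n\<close> and \<open>m\<close> return the vertices \<open>a\<close> and \<open>b\<close>.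
    \<open>T\<close>: one of these happens; unless both rows are nonzero, the candidates are a correct half
    truth and must be answered.\<close>
  define Z where "Z p n i v \<longleftrightarrow> (\<exists>q. h p = Some q \<and> value_at q (pr n i) v) \<and> v \<noteq> 0" for p n i v
  define Ans where "Ans p n m a b \<longleftrightarrow>
      (\<exists>q. h p = Some q \<and> first_number rp (tuple C p (tuple C (nat_name C n) (tuple C (nat_name C m) q))) a) \<and>
      (\<exists>q. h p = Some q \<and> second_number rp (tuple C p (tuple C (nat_name C n) (tuple C (nat_name C m) q))) b) \<and>
      a < 4 \<and> b < 4" for p n m a b
  define T where "T p d i j a b \<longleftrightarrow> Ans p (nthc d i) (nthc d j) (nthc d a) (nthc d b) \<or>
      Z p (nthc d i) (nthc d (i + 4)) (nthc d (i + 8)) \<and> Z p (nthc d j) (nthc d (j + 4)) (nthc d (j + 8))"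
    for p d i j a b
  \<comment> \<open>The entries 0 to 3 of \<open>d\<close> are the candidates for \<open>{0, 1}\<close> and \<open>{2, 3}\<close>, the entries 4 to 11
    are positions and values at which their rows are nonzero, and from 12 on come the four
    returned pairs.\<close>
  define S where "S p d \<longleftrightarrow>
      first_number rm (tuple C (nat_name C 0) (tuple C (nat_name C 1) p)) (nthc d 0) \<and>
      second_number rm (tuple C (nat_name C 0) (tuple C (nat_name C 1) p)) (nthc d 1) \<and>
      first_number rm (tuple C (nat_name C 2) (tuple C (nat_name C 3) p)) (nthc d 2) \<and>
      second_number rm (tuple C (nat_name C 2) (tuple C (nat_name C 3) p)) (nthc d 3) \<and>
      T p d 0 2 12 13 \<and> T p d 0 3 14 15 \<and> T p d 1 2 16 17 \<and> T p d 1 3 18 19" for p d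
  define s where "s d t i j \<longleftrightarrow> separates t (nthc d (12 + 4 * i + 2 * j)) (nthc d (13 + 4 * i + 2 * j))"
    for d t i j
  \<comment> \<open>A bipartition refuted by the answers, chosen computably.\<close>
  define t where "t d = (if refuted 0 (s d) then 0 else if refuted 1 (s d) then 1
      else if refuted 2 (s d) then 2 else if refuted 3 (s d) then 3 else (4::nat))" for d
  have t: "refuted (t d) (s d)" for d
  proof -
    obtain r where "r \<le> 4" "refuted r (s d)"
      unfolding s_def using ex_refuted[of "\<lambda>i j. nthc d (12 + 4 * i + 2 * j)" "\<lambda>i j. nthc d (13 + 4 * i + 2 * j)"]
      by blast
    moreover have "r = 0 \<or> r = 1 \<or> r = 2 \<or> r = 3 \<or> r = 4" using \<open>r \<le> 4\<close> by linarith
    ultimately show ?thesis by (auto simp: t_def)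
  qed
  have "\<exists>p d k. names (baire C) p (hub_graph (t d) k) \<and> S p d"
  proof (rule perturbation)
    show "observable S" unfolding S_def[abs_def] T_def Ans_def Z_def
      by (intro observable_intros computable_intros)
    have comp: "computable t" unfolding t_def[abs_def] refuted_def s_def separates_def side_def
      by (intro computable_intros)
    show "computable (\<lambda>y. hub_graph (t (p1 y)) (p1 (p2 y)) (p2 (p2 y)))"
      unfolding hub_graph_def join_def hub_edges_def side_def mem_Collect_eq split_beta
      by (intro computable_intros computable_comp[OF comp]) simp_all
    show "hub_graph (t d) k i = four_points i" if "i < k" for d k i
      using that by (rule hub_graph_below)
    fix p assume p: "names (baire C) p four_points"
    obtain q where q: "h p = Some q" "names (baire C) q (\<phi> four_points)" using h_ex[OF p] by blast
    have disc: "path_connected {} a b \<longleftrightarrow> a = b" for a b by (simp add: path_connected_def)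
    note obs = rm_obs[OF p codes_four_points, unfolded disc]
    obtain P Q where PQ: "first_number rm (tuple C (nat_name C 0) (tuple C (nat_name C 1) p)) P"
      "second_number rm (tuple C (nat_name C 0) (tuple C (nat_name C 1) p)) Q"
      using obs[of 0 1] by auto
    obtain R U where RU: "first_number rm (tuple C (nat_name C 2) (tuple C (nat_name C 3) p)) R"
      "second_number rm (tuple C (nat_name C 2) (tuple C (nat_name C 3) p)) U"
      using obs[of 2 3] by auto
    \<comment> \<open>One position and value per row, so that the list \<open>d\<close> can be filled before it is known which
      of the alternatives in \<open>T\<close> occurs.\<close>
    have "\<exists>i v. row (\<phi> four_points) n = (\<lambda>_. 0) \<or> Z p n i v" for n
    proof -
      have "Z p n i (row (\<phi> four_points) n i)" if "row (\<phi> four_points) n i \<noteq> 0" for i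
        using that q value_at[OF q(2)] by (simp add: Z_def row_def)
      then show ?thesis by (metis ext)
    qed
    then obtain i v where Z: "\<And>n. row (\<phi> four_points) n = (\<lambda>_. 0) \<or> Z p n (i n) (v n)"
      by metis
    have "\<exists>a b. Ans p n m a b \<or> Z p n (i n) (v n) \<and> Z p m (i m) (v m)" for n m
      using Z[of n] Z[of m] rp_obs[OF p q(2) _ codes_four_points, of n m] q(1) unfolding Ans_def by auto
    then obtain a b where ab: "\<And>n m. Ans p n m (a n m) (b n m) \<or> Z p n (i n) (v n) \<and> Z p m (i m) (v m)"
      by metis
    have "S p (list_encode [P, Q, R, U, i P, i Q, i R, i U, v P, v Q, v R, v U,
        a P R, b P R, a P U, b P U, a Q R, b Q R, a Q U, b Q U])"
      unfolding S_def T_def using PQ RU ab by (simp add: nthc_list_encode del: list_encode.simps)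
    then show "\<exists>d. S p d" ..
  qed
  then obtain p d k where p: "names (baire C) p (hub_graph (t d) k)" and S: "S p d" by blast
  define x where "x = hub_graph (t d) k"
  note p = p[folded x_def]
  note graph = codes_hub_graph[of "t d" k, folded x_def]
  obtain q where q: "h p = Some q" "names (baire C) q (\<phi> x)" using h_ex[OF p] by blast
  define zero where "zero i \<longleftrightarrow> row (\<phi> x) (nthc d i) = (\<lambda>_. 0)" for i
  \<comment> \<open>If one of the two rows is zero, the alternative that both are nonzero is excluded, and the
    recorded answer is the one for the perturbed graph as well.\<close>
  have sep: "separates (t d) (nthc d a) (nthc d b)" if zero: "zero i \<or> zero j" and T: "T p d i j a b" for i j a b
  proof -
    have "\<not> Z p (nthc d l) n v" if "zero l" for l n v
      using that q value_at[OF q(2)] by (auto simp: Z_def zero_def row_def fun_eq_iff)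
    then have O: "Ans p (nthc d i) (nthc d j) (nthc d a) (nthc d b)"
      using zero T unfolding T_def by blast
    obtain a' b' where ab': "\<forall>a''. first_number rp (tuple C p (tuple C (nat_name C (nthc d i)) (tuple C (nat_name C (nthc d j)) q))) a'' \<longleftrightarrow> a'' = a'"
      "\<forall>b''. second_number rp (tuple C p (tuple C (nat_name C (nthc d i)) (tuple C (nat_name C (nthc d j)) q))) b'' \<longleftrightarrow> b'' = b'"
      "\<not> path_connected (hub_edges (t d) k) a' b'"
      using rp_obs[OF p q(2) zero[unfolded zero_def] graph] by blast
    have "nthc d a = a'" "nthc d b = b'" "nthc d a < 4" "nthc d b < 4"
      using O ab'(1,2) q(1) unfolding Ans_def by simp_all
    then show ?thesis using ab'(3) path_connected_hub_edges by blast
  qed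
  have zero01: "zero 0 \<or> zero 1" if "separates (t d) 0 1"
  proof -
    have "\<not> path_connected (hub_edges (t d) k) 0 1" using that path_connected_hub_edges[of 0 1] by simp
    then obtain n m where "\<forall>n'. first_number rm (tuple C (nat_name C 0) (tuple C (nat_name C 1) p)) n' \<longleftrightarrow> n' = n"
      "\<forall>m'. second_number rm (tuple C (nat_name C 0) (tuple C (nat_name C 1) p)) m' \<longleftrightarrow> m' = m"
      "row (\<phi> x) n = (\<lambda>_. 0) \<or> row (\<phi> x) m = (\<lambda>_. 0)"
      using rm_obs[OF p graph, of 0 1] by auto
    then show ?thesis using S unfolding S_def zero_def by metis
  qed
  have zero23: "zero 2 \<or> zero 3" if "separates (t d) 2 3"
  proof -
    have "\<not> path_connected (hub_edges (t d) k) 2 3" using that path_connected_hub_edges[of 2 3] by simp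
    then obtain n m where "\<forall>n'. first_number rm (tuple C (nat_name C 2) (tuple C (nat_name C 3) p)) n' \<longleftrightarrow> n' = n"
      "\<forall>m'. second_number rm (tuple C (nat_name C 2) (tuple C (nat_name C 3) p)) m' \<longleftrightarrow> m' = m"
      "row (\<phi> x) n = (\<lambda>_. 0) \<or> row (\<phi> x) m = (\<lambda>_. 0)"
      using rm_obs[OF p graph, of 2 3] by auto
    then show ?thesis using S unfolding S_def zero_def by metis
  qed
  have "zero 0 \<or> zero 2 \<Longrightarrow> s d (t d) 0 0" "zero 0 \<or> zero 3 \<Longrightarrow> s d (t d) 0 1"
    "zero 1 \<or> zero 2 \<Longrightarrow> s d (t d) 1 0" "zero 1 \<or> zero 3 \<Longrightarrow> s d (t d) 1 1"
    using sep[of 0 2 12 13] sep[of 0 3 14 15] sep[of 1 2 16 17] sep[of 1 3 18 19] S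
    unfolding S_def s_def by simp_all
  then show False using t[of d] zero01 zero23 unfolding refuted_def by sat
qed

subsection \<open>Finding a zero row does not reduce to disconnectedness\<close>

lemma (in perturbable_coding) Truth_not_reducible_DisConn:
  "\<not> m_reducible C (baire C) (Truth C) (baire C) (DisConn C)"
proof
  assume "m_reducible C (baire C) (Truth C) (baire C) (DisConn C)"
  then obtain \<phi> h rm rp where
    "reduction_setting C total_maps fst_code snd_code code_maps observable first_number second_number value_at (Truth C) (DisConn C) \<phi> h rm rp"
    by (rule reduction_settingE)
  then interpret reduction_setting C total_maps fst_code snd_code code_maps observable first_number second_number value_at "Truth C" "DisConn C" \<phi> h rm rp .
  have rm_obs: "\<exists>a b V E. (\<forall>a'. first_number rm (tuple C (nat_name C n) p) a' \<longleftrightarrow> a' = a) \<and>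
      (\<forall>b'. second_number rm (tuple C (nat_name C n) p) b' \<longleftrightarrow> b' = b) \<and>
      codes_graph (\<phi> x) V E \<and> a \<in> V \<and> b \<in> V \<and> \<not> path_connected E a b"
    if hyp: "names (baire C) p x" "row x n = (\<lambda>_. 0)" for n p x
  proof -
    have "names (Truth C) (tuple C (nat_name C n) p) x"
      using hyp by (auto simp: Truth_def)
    then obtain q where q: "rm (tuple C (nat_name C n) p) = Some q" "names (DisConn C) q (\<phi> x)"
      using rm_ex by blast
    from q(2) obtain a b r V E where ab: "q = tuple C (nat_name C a) (tuple C (nat_name C b) r)"
      "codes_graph (\<phi> x) V E" "a \<in> V" "b \<in> V" "\<not> path_connected E a b"
      unfolding DisConn_def by auto
    have "\<forall>a'. first_number rm (tuple C (nat_name C n) p) a' \<longleftrightarrow> a' = a"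
      "\<forall>b'. second_number rm (tuple C (nat_name C n) p) b' \<longleftrightarrow> b' = b"
      using first_number[OF realizable(2) q(1)[unfolded ab(1)]] second_number[OF realizable(2) q(1)[unfolded ab(1)]] by blast+
    then show ?thesis using ab(2-5) by blast
  qed
  have rp_obs: "\<exists>n. (\<forall>n'. first_number rp (tuple C p (tuple C (nat_name C a) (tuple C (nat_name C b) q))) n' \<longleftrightarrow> n' = n) \<and>
      row x n = (\<lambda>_. 0)"
    if "names (baire C) p x" "names (baire C) q (\<phi> x)" "codes_graph (\<phi> x) V E" "a \<in> V" "b \<in> V"
      "\<not> path_connected E a b" for a b p q x V E
    using rp_ex[OF that(1) names_DisConnI[OF that(2-6)]] first_number[OF realizable(3)]
    unfolding Truth_def by fastforce
  \<comment> \<open>\<open>Q\<close>: the vertices \<open>u\<close> and \<open>v\<close> return the row \<open>n\<close>, or they are found to be linked, which is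
    recorded by the dummy row 2.  No perturbation below keeps row 2, so this dummy never
    coincides with the surviving row.\<close>
  define Q where "Q p u v n k \<longleftrightarrow>
      (\<exists>q. h p = Some q \<and> first_number rp (tuple C p (tuple C (nat_name C u) (tuple C (nat_name C v) q))) n) \<or>
      n = 2 \<and> (\<exists>q. h p = Some q \<and> value_at (functional_op link_search q) (pr (pr u v) k) 1)" for p u v n k
  \<comment> \<open>Being a vertex has to be observed too: the pair belonging to a killed row need not be related
    to the perturbed graph otherwise.\<close>
  define Vert where "Vert p u \<longleftrightarrow> (\<exists>q. h p = Some q \<and> value_at q (2 * u) 1)" for p u
  define S where "S p d \<longleftrightarrow>
      first_number rm (tuple C (nat_name C 0) p) (nthc d 0) \<and> second_number rm (tuple C (nat_name C 0) p) (nthc d 1) \<and>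
      first_number rm (tuple C (nat_name C 1) p) (nthc d 2) \<and> second_number rm (tuple C (nat_name C 1) p) (nthc d 3) \<and>
      Vert p (nthc d 0) \<and> Vert p (nthc d 1) \<and> Vert p (nthc d 2) \<and> Vert p (nthc d 3) \<and>
      Q p (nthc d 0) (nthc d 1) (nthc d 4) (nthc d 10) \<and> Q p (nthc d 2) (nthc d 3) (nthc d 5) (nthc d 11) \<and>
      Q p (nthc d 0) (nthc d 2) (nthc d 6) (nthc d 12) \<and> Q p (nthc d 0) (nthc d 3) (nthc d 7) (nthc d 13) \<and>
      Q p (nthc d 1) (nthc d 2) (nthc d 8) (nthc d 14) \<and> Q p (nthc d 1) (nthc d 3) (nthc d 9) (nthc d 15)" for p d
  \<comment> \<open>The surviving row, chosen so that the answers contradict it.  The first two cases are those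
    in which the pair belonging to row 1 or to row 0 has been assigned another row.  If
    otherwise each of the vertices of row 0 has been linked in the graph for row 0 to one of row 1,
    row 0 is impossible; if not, the vertices of row 1 are linked in the graph for row 1 through a
    vertex of row 0.\<close>
  define j where "j d = (if nthc d 5 \<noteq> 1 then 1 else if nthc d 4 \<noteq> 0 then 0
      else if (nthc d 6 \<noteq> 0 \<or> nthc d 7 \<noteq> 0) \<and> (nthc d 8 \<noteq> 0 \<or> nthc d 9 \<noteq> 0) then 0 else 1::nat)" for d
  let ?z = "\<lambda>d s k. of_bool (s \<le> k \<and> p1 k \<noteq> j d) :: nat"
  have vert: "value_at q (2 * u) 1 \<longleftrightarrow> u \<in> V" if "names (baire C) q y" "codes_graph y V E" for q y V E u
    using that(2) value_at[OF that(1)] by (auto simp: codes_graph_def join_def)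
  have link: "(\<exists>k. value_at (functional_op link_search q) (pr (pr u v) k) 1) \<longleftrightarrow> \<not> (u \<in> V \<and> v \<in> V \<and> \<not> path_connected E u v)"
    if "names (baire C) q y" "codes_graph y V E" for q y V E u v
  proof -
    have "(\<exists>k. value_at (functional_op link_search q) (pr (pr u v) k) 1) \<longleftrightarrow> row (link_search y) (pr u v) \<noteq> (\<lambda>_. 0)"
      using value_at[OF functional_op(2)[OF prefix_computable_link_search that(1)]]
      by (auto simp: row_def fun_eq_iff link_search_def)
    moreover have "(\<exists>V' E'. codes_graph y V' E' \<and> u \<in> V' \<and> v \<in> V' \<and> \<not> path_connected E' u v) \<longleftrightarrow>
        u \<in> V \<and> v \<in> V \<and> \<not> path_connected E u v"
      using codes_graph_unique[OF that(2)] that(2) by metis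
    ultimately show ?thesis using row_link_search_iff[of y "pr u v"] by simp
  qed
  have "\<exists>p d s. names (baire C) p (?z d s) \<and> S p d"
  proof (rule perturbation)
    show "observable S" unfolding S_def[abs_def] Q_def Vert_def
      by (intro observable_intros computable_intros prefix_computable_link_search)
    have comp: "computable j" unfolding j_def[abs_def] by (intro computable_intros)
    show "computable (\<lambda>y. ?z (p1 y) (p1 (p2 y)) (p2 (p2 y)))"
      by (intro computable_intros computable_comp[OF comp])
    show "?z d s k = 0" if "k < s" for d s k
      using that by simp
    fix p assume p: "names (baire C) p (\<lambda>_. 0)"
    have row0: "row (\<lambda>_. 0) i = (\<lambda>_. 0)" for i by (simp add: row_def)
    obtain q where q: "h p = Some q" "names (baire C) q (\<phi> (\<lambda>_. 0))" using h_ex[OF p] by blast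
    obtain a b V E where ab: "\<forall>a'. first_number rm (tuple C (nat_name C 0) p) a' \<longleftrightarrow> a' = a"
        "\<forall>b'. second_number rm (tuple C (nat_name C 0) p) b' \<longleftrightarrow> b' = b"
      and g: "codes_graph (\<phi> (\<lambda>_. 0)) V E" and V: "a \<in> V" "b \<in> V"
      using rm_obs[OF p row0[of 0]] by (elim exE conjE)
    obtain c e V' E' where ce: "\<forall>a'. first_number rm (tuple C (nat_name C 1) p) a' \<longleftrightarrow> a' = c"
        "\<forall>b'. second_number rm (tuple C (nat_name C 1) p) b' \<longleftrightarrow> b' = e"
      and g': "codes_graph (\<phi> (\<lambda>_. 0)) V' E'" and V': "c \<in> V'" "e \<in> V'"
      using rm_obs[OF p row0[of 1]] by (elim exE conjE)
    have V': "c \<in> V" "e \<in> V" using V' codes_graph_unique[OF g g'] by simp_all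
    have "\<exists>n k. u \<in> V \<and> v \<in> V \<longrightarrow> Q p u v n k" for u v
      using rp_obs[OF p q(2) g, of u v] link[OF q(2) g, of u v] q(1) unfolding Q_def by blast
    then obtain n k where Q: "\<And>u v. u \<in> V \<and> v \<in> V \<Longrightarrow> Q p u v (n u v) (k u v)" by metis
    have "Vert p u" if "u \<in> V" for u using vert[OF q(2) g] q(1) that by (simp add: Vert_def)
    then have "S p (list_encode [a, b, c, e, n a b, n c e, n a c, n a e, n b c, n b e,
        k a b, k c e, k a c, k a e, k b c, k b e])"
      unfolding S_def using ab ce V V' Q by (simp add: nthc_list_encode del: list_encode.simps)
    then show "\<exists>d. S p d" ..
  qed
  then obtain p d s where p: "names (baire C) p (?z d s)" and S: "S p d" by blast
  define x where "x = ?z d s"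
  note p = p[folded x_def]
  obtain q where q: "h p = Some q" "names (baire C) q (\<phi> x)" using h_ex[OF p] by blast
  have row: "row x n = (\<lambda>_. 0) \<longleftrightarrow> n = j d" for n
  proof
    show "row x n = (\<lambda>_. 0)" if "n = j d" using that by (simp add: row_def x_def)
    show "n = j d" if "row x n = (\<lambda>_. 0)"
      using fun_cong[OF that, of s] le_prod_encode_2[of s n] by (simp add: row_def x_def split: if_splits)
  qed
  obtain a b V E where ab: "\<forall>a'. first_number rm (tuple C (nat_name C (j d)) p) a' \<longleftrightarrow> a' = a"
    "\<forall>b'. second_number rm (tuple C (nat_name C (j d)) p) b' \<longleftrightarrow> b' = b"
    and g: "codes_graph (\<phi> x) V E" and nc: "\<not> path_connected E a b"
    using rm_obs[OF p row[THEN iffD2, OF refl]] by (elim exE conjE)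
  have V: "u \<in> V" if "Vert p u" for u
    using that vert[OF q(2) g] q(1) by (simp add: Vert_def)
  have answer: "path_connected E u v" if hyp: "Q p u v n k" "n \<noteq> j d" "u \<in> V" "v \<in> V" for u v n k
  proof (rule ccontr)
    assume *: "\<not> path_connected E u v"
    then have "\<not> value_at (functional_op link_search q) (pr (pr u v) k) 1"
      using link[OF q(2) g] hyp(3,4) by blast
    then have "first_number rp (tuple C p (tuple C (nat_name C u) (tuple C (nat_name C v) q))) n"
      using hyp(1) q(1) unfolding Q_def by simp
    moreover obtain m where "\<forall>n'. first_number rp (tuple C p (tuple C (nat_name C u) (tuple C (nat_name C v) q))) n' \<longleftrightarrow> n' = m"
      "row x m = (\<lambda>_. 0)"
      using rp_obs[OF p q(2) g hyp(3,4) *] by blast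
    ultimately show False using row hyp(2) by simp
  qed
  have con: "nthc d 4 \<noteq> j d \<Longrightarrow> path_connected E (nthc d 0) (nthc d 1)"
    "nthc d 5 \<noteq> j d \<Longrightarrow> path_connected E (nthc d 2) (nthc d 3)"
    "nthc d 6 \<noteq> j d \<Longrightarrow> path_connected E (nthc d 0) (nthc d 2)"
    "nthc d 7 \<noteq> j d \<Longrightarrow> path_connected E (nthc d 0) (nthc d 3)"
    "nthc d 8 \<noteq> j d \<Longrightarrow> path_connected E (nthc d 1) (nthc d 2)"
    "nthc d 9 \<noteq> j d \<Longrightarrow> path_connected E (nthc d 1) (nthc d 3)"
    using S V unfolding S_def by (auto intro: answer)
  have sym: "path_connected E u v \<longleftrightarrow> path_connected E v u" for u v
    using path_connected_sym by blast
  have "j d = 0 \<or> j d = 1" by (simp add: j_def)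
  then show False
  proof
    assume j: "j d = 0"
    then have "a = nthc d 0" "b = nthc d 1" using S ab unfolding S_def by simp_all
    then have "\<not> path_connected E (nthc d 0) (nthc d 1)" using nc by simp
    then show False using con j unfolding j_def
      by (simp split: if_splits) (metis sym path_connected_trans)
  next
    assume j: "j d = 1"
    then have "a = nthc d 2" "b = nthc d 3" using S ab unfolding S_def by simp_all
    then have nc: "\<not> path_connected E (nthc d 2) (nthc d 3)" using nc by simp
    then have "nthc d 5 = 1" using con(2) j by metis
    then have eq: "j d = (if nthc d 4 \<noteq> 0 then 0
      else if (nthc d 6 \<noteq> 0 \<or> nthc d 7 \<noteq> 0) \<and> (nthc d 8 \<noteq> 0 \<or> nthc d 9 \<noteq> 0) then 0 else 1)"
      by (simp only: j_def) simp
    have "nthc d 6 = 0 \<and> nthc d 7 = 0 \<or> nthc d 8 = 0 \<and> nthc d 9 = 0"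
    proof (rule ccontr)
      assume "\<not> (nthc d 6 = 0 \<and> nthc d 7 = 0 \<or> nthc d 8 = 0 \<and> nthc d 9 = 0)"
      then have "j d = 0" unfolding eq by simp
      then show False using j by simp
    qed
    then show False
    proof
      assume "nthc d 6 = 0 \<and> nthc d 7 = 0"
      then have "path_connected E (nthc d 2) (nthc d 0)" "path_connected E (nthc d 0) (nthc d 3)"
        using con(3,4) j sym by simp_all
      then show False using nc path_connected_trans by blast
    next
      assume "nthc d 8 = 0 \<and> nthc d 9 = 0"
      then have "path_connected E (nthc d 2) (nthc d 1)" "path_connected E (nthc d 1) (nthc d 3)"
        using con(5,6) j sym by simp_all
      then show False using nc path_connected_trans by blast
    qed
  qed
qed

section \<open>The system of partial computable functions\<close>

lemma K1_simps [simp]: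
  "realizable K1 = range run" "tuple K1 p q = pr p q" "nat_name K1 n = n"
  "points (baire K1) = {x. computable x}" "names (baire K1) e x \<longleftrightarrow> phi e = Some \<circ> x"
  by (simp_all add: K1_def)

text \<open>
  The program for \<open>F x\<close> contains the program for \<open>x\<close> as a part, so its index is an arithmetical
  expression in the given index; no evaluation of the given program takes place.
\<close>

lemma index_of_functional:
  assumes "prefix_computable F"
  shows "\<exists>t. computable t \<and> (\<forall>e x. phi e = Some \<circ> x \<longrightarrow> phi (t e) = Some \<circ> F x)"
proof -
  obtain g a where g: "computable g"
    "\<And>x n k. a * Suc n \<le> k \<Longrightarrow> F x n = g (pr n (list_encode (map x [0..<k])))"
    using prefix_computable_values[OF assms] by blast
  obtain cg where cg: "\<forall>y. run cg y = Some (g y)" using g(1) unfolding computable_iff ..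
  have "computable (\<lambda>y. p1 y - Suc (p1 (p2 y)))" "computable (\<lambda>n. a * Suc n)"
    by (intro computable_intros)+
  then obtain ci ck where ci: "\<forall>y. run ci y = Some (p1 y - Suc (p1 (p2 y)))"
    and ck: "\<forall>n. run ck n = Some (a * Suc n)"
    unfolding computable_iff by (elim exE)
  \<comment> \<open>The primitive recursion computes the code of the initial segment of \<open>x\<close> of length
    \<open>a * Suc n\<close>, with \<open>c\<close> computing \<open>x\<close>.\<close>
  define P where "P c = Comp cg (Pair IdP
    (Comp (Prec Zero (Comp Succ (Pair (Comp c ci) (Comp Right Right)))) (Pair ck ck)))" for c
  define t where "t e = 4 * pr (goedel cg) (4 * pr (goedel IdP)
      (4 * pr (4 * pr 0 (4 * pr 1 (4 * pr (4 * pr e (goedel ci) + 5) (goedel (Comp Right Right)) + 4) + 5) + 6)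
        (goedel (Pair ck ck)) + 5) + 4) + 5" for e
  have t: "t (goedel c) = goedel (P c)" for c
    by (simp add: t_def P_def goedel.simps)
  have "computable t" unfolding t_def[abs_def] by (intro computable_intros)
  moreover have "phi (t e) = Some \<circ> F x" if "phi e = Some \<circ> x" for e x
  proof -
    obtain c where c: "e = goedel c" using ex_goedel by blast
    then have run: "run c i = Some (x i)" for i using that by (simp add: fun_eq_iff)
    have "run (Prec Zero (Comp Succ (Pair (Comp c ci) (Comp Right Right)))) (pr k k) =
        Some (list_encode (map x [0..<k]))" for k
      by (subst run_Prec_total[where f = "\<lambda>_. 0" and g = "\<lambda>y. Suc (pr (x (p1 y - Suc (p1 (p2 y)))) (p2 (p2 y)))"])
        (simp_all add: ci run list_encode_map_rec)
    then have "run (P c) n = Some (F x n)" for n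
      using g(2)[of n "a * Suc n" x] by (simp add: P_def ck cg del: run.simps(7))
    then show ?thesis by (simp add: c t fun_eq_iff)
  qed
  ultimately show ?thesis by blast
qed

interpretation K1: effective_coding K1 "{t. computable t}" p1 p2
proof unfold_locales
  show "(\<lambda>c. Some (t c)) \<in> realizable K1" if t: "t \<in> {t. computable t}" for t
  proof -
    obtain c where "\<forall>x. run c x = Some (t x)" using t unfolding computable_iff by blast
    then have "(\<lambda>c. Some (t c)) = run c" by (simp add: fun_eq_iff)
    then show ?thesis by simp
  qed
  show "p1 \<in> {t. computable t}" "p2 \<in> {t. computable t}"
    using computable_p1[OF computable_id] computable_p2[OF computable_id] by simp_all
  show "represented_space (baire K1)"
    unfolding represented_space_def
  proof (intro conjI allI impI ballI)
    show "x \<in> points (baire K1)" if "names (baire K1) p x" for p x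
      using that ex_goedel[of p] by (auto simp: computable_def)
    show "x = y" if "names (baire K1) p x" "names (baire K1) p y" for p x y
      using that by (simp add: fun_eq_iff)
    show "\<exists>p. names (baire K1) p x" if "x \<in> points (baire K1)" for x
      using that by (auto simp: computable_def) (metis phi_goedel)
  qed
qed (use index_of_functional in \<open>auto intro: computable_intros computable_comp\<close>)

text \<open>
  A program that knows its own index \<open>e\<close> prints \<open>x\<close> while it searches for an answer \<open>d\<close> for \<open>e\<close>.
  If the search succeeds at \<open>s\<close>, it has printed \<open>x\<close> below \<open>s\<close> only, hence it can continue with
  \<open>z d s\<close>.  If the search never succeeded, \<open>e\<close> would be an index of \<open>x\<close>, and there is an answer.
\<close>

lemma K1_perturbation:
  assumes S: "semidecidable (\<lambda>y. S (p1 y) (p2 y))"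
    and z: "computable (\<lambda>y. z (p1 y) (p1 (p2 y)) (p2 (p2 y)))"
    and agree: "\<And>d s k. k < s \<Longrightarrow> z d s k = x k"
    and total: "\<And>e. phi e = Some \<circ> x \<Longrightarrow> \<exists>d. S e d"
  shows "\<exists>e d s. phi e = Some \<circ> z d s \<and> S e d"
proof -
  obtain R where R: "decidable R" "\<forall>y. S (p1 y) (p2 y) \<longleftrightarrow> (\<exists>t. R (pr y t))"
    using S unfolding semidecidable_def by blast
  define found where "found e i \<longleftrightarrow> R (pr (pr e (p1 i)) (p2 i))" for e i
  have SR: "S e d \<longleftrightarrow> (\<exists>t. R (pr (pr e d) t))" for e d
    using R(2)[rule_format, of "pr e d"] by simp
  \<comment> \<open>The search number \<open>s\<close> codes the answer and a witness and also serves as the time of success.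
    Since \<open>z 0 (Suc k) k = x k\<close>, the function \<open>x\<close> is available without being mentioned.\<close>
  define G where "G e k = (if least_below (Suc k) (found e) \<le> k
    then z (p1 (least_below (Suc k) (found e))) (least_below (Suc k) (found e)) k
    else z 0 (Suc k) k)" for e k
  have zc: "computable (\<lambda>y. z (a y) (b y) (c y))" if "computable a" "computable b" "computable c" for a b c
    using computable_comp[OF z computable_pr[OF that(1) computable_pr[OF that(2,3)]]] by simp
  have "decidable (\<lambda>y. found (p1 y) (p2 y))"
    unfolding found_def by (intro decidable_comp[OF R(1)] computable_intros)
  then have "decidable (\<lambda>y. found (p1 (p1 y)) (p2 y))"
    using decidable_comp[of "\<lambda>y. found (p1 y) (p2 y)" "\<lambda>y. pr (p1 (p1 y)) (p2 y)"]
      computable_pr[OF computable_p1[OF computable_p1[OF computable_id]] computable_p2[OF computable_id]]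
    by simp
  then have least: "computable (\<lambda>y. least_below (Suc (p2 y)) (found (p1 y)))"
    by (intro computable_least_below computable_intros)
  have "computable (\<lambda>y. G (p1 y) (p2 y))"
    unfolding G_def by (intro computable_if decidable_le zc least computable_intros)
  then obtain e where e: "phi e = Some \<circ> G e" by (rule recursion_theorem)
  show ?thesis
  proof (cases "\<exists>i. found e i")
    case True
    define s where "s = (LEAST i. found e i)"
    have s: "found e s" "\<And>i. found e i \<Longrightarrow> s \<le> i"
      using LeastI_ex[OF True] Least_le unfolding s_def by metis+
    have "G e k = z (p1 s) s k" for k
    proof (cases "s \<le> k")
      case True
      then have "least_below (Suc k) (found e) = s"
        using s(1) le_imp_less_Suc[OF True] unfolding least_below_eq s_def[symmetric] by auto
      then show ?thesis using True by (simp add: G_def)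
    next
      case False
      then have "least_below (Suc k) (found e) = Suc k"
        using s(2) unfolding least_below_eq by (meson less_Suc_eq_le order_trans)
      then show ?thesis using False agree[of k s] agree[of k "Suc k"] by (simp add: G_def)
    qed
    then have "phi e = Some \<circ> z (p1 s) s" using e by (simp add: fun_eq_iff)
    moreover have "S e (p1 s)" using s(1) SR unfolding found_def by blast
    ultimately show ?thesis by blast
  next
    case False
    then have "G e k = x k" for k
      using agree[of k "Suc k"] by (simp add: G_def least_below_eq)
    then have "phi e = Some \<circ> x" using e by (simp add: fun_eq_iff)
    then obtain d t where "R (pr (pr e d) t)" using total SR by blast
    then have "found e (pr d t)" by (simp add: found_def)
    then show ?thesis using False by blast
  qed
qed

interpretation K1: perturbable_coding K1 "{t. computable t}" p1 p2
  "{E. \<exists>c. \<forall>p n. E p n = run c (pr p n)}" "\<lambda>P. semidecidable (\<lambda>y. P (p1 y) (p2 y))"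
  "\<lambda>r c k. \<exists>w. r c = Some w \<and> p1 w = k" "\<lambda>r c k. \<exists>w. r c = Some w \<and> p1 (p2 w) = k"
  "\<lambda>q i v. phi q i = Some v"
proof unfold_locales
  let ?maps = "{E. \<exists>c. \<forall>p n. E p n = run c (pr p n)}"
  show "(\<lambda>p n. Some p) \<in> ?maps"
    by (auto intro: exI[of _ Left])
  show "(\<lambda>p n. Some (nat_name K1 (a n))) \<in> ?maps" if a: "computable a" for a
  proof -
    obtain c where "\<forall>n. run c n = Some (a n)" using a unfolding computable_iff ..
    then show ?thesis by (auto intro!: exI[of _ "Comp c Right"])
  qed
  show "(\<lambda>p n. Option.bind (E p n) (\<lambda>c. Option.bind (F p n) (\<lambda>d. Some (tuple K1 c d)))) \<in> ?maps"
    if EF: "E \<in> ?maps" "F \<in> ?maps" for E F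
  proof -
    obtain c d where "\<forall>p n. E p n = run c (pr p n)" "\<forall>p n. F p n = run d (pr p n)" using EF by blast
    then show ?thesis by (auto intro!: exI[of _ "Pair c d"])
  qed
  show "(\<lambda>p n. Option.bind (E p n) h) \<in> ?maps" if Eh: "E \<in> ?maps" "h \<in> realizable K1" for E h
  proof -
    obtain c d where "\<forall>p n. E p n = run c (pr p n)" "h = run d" using Eh by auto
    then show ?thesis by (auto intro!: exI[of _ "Comp d c"])
  qed
  have out: "semidecidable (\<lambda>y. \<exists>c. E (p1 y) (p2 y) = Some c \<and> (\<exists>w. r c = Some w \<and> f w = a (p2 y)))"
    if E: "E \<in> ?maps" "r \<in> realizable K1" and a: "computable a" "computable f" for E r a f
  proof -
    obtain c d where cd: "\<forall>p n. E p n = run c (pr p n)" "r = run d" using E by auto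
    have *: "(\<lambda>y. \<exists>c. E (p1 y) (p2 y) = Some c \<and> (\<exists>w. r c = Some w \<and> f w = a (p2 y))) =
        (\<lambda>y. \<exists>w. phi (goedel (Comp d c)) y = Some w \<and> f w = a (p2 y))"
      by (auto simp: cd fun_eq_iff bind_eq_Some_conv)
    show ?thesis unfolding *
      by (intro semidecidable_ex semidecidable_conj semidecidable_phi semidecidable_decidable
          computable_intros computable_comp[OF a(1)] computable_comp[OF a(2)])
  qed
  show "semidecidable (\<lambda>y. \<exists>c. E (p1 y) (p2 y) = Some c \<and> (\<exists>w. r c = Some w \<and> p1 w = a (p2 y)))"
    "semidecidable (\<lambda>y. \<exists>c. E (p1 y) (p2 y) = Some c \<and> (\<exists>w. r c = Some w \<and> p1 (p2 w) = a (p2 y)))"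
    if "E \<in> ?maps" "r \<in> realizable K1" "computable a" for E r a
    by (intro out that computable_intros)+
  show "semidecidable (\<lambda>y. \<exists>c. E (p1 y) (p2 y) = Some c \<and> phi c (a (p2 y)) = Some (b (p2 y)))"
    if E: "E \<in> ?maps" and ab: "computable a" "computable b" for E a b
  proof -
    obtain c where c: "\<forall>p n. E p n = run c (pr p n)" using E by auto
    have *: "(\<lambda>y. \<exists>c. E (p1 y) (p2 y) = Some c \<and> phi c (a (p2 y)) = Some (b (p2 y))) =
        (\<lambda>y. \<exists>w. phi (goedel c) y = Some w \<and> phi w (a (p2 y)) = Some (b (p2 y)))"
      by (simp add: c)
    show ?thesis unfolding *
      by (intro semidecidable_ex semidecidable_conj semidecidable_phi
          computable_intros computable_comp[OF ab(1)] computable_comp[OF ab(2)])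
  qed
  show "\<exists>p d s. names (baire K1) p (z d s) \<and> S p d"
    if "semidecidable (\<lambda>y. S (p1 y) (p2 y))" "computable (\<lambda>y. z (p1 y) (p1 (p2 y)) (p2 (p2 y)))"
      "\<And>d s k. k < s \<Longrightarrow> z d s k = x k" "\<And>p. names (baire K1) p x \<Longrightarrow> \<exists>d. S p d" for S z x
    using K1_perturbation[OF that(1-3)] that(4) by simp
  show "semidecidable (\<lambda>y. D (p2 y))" if "decidable D" for D
    by (intro semidecidable_decidable decidable_comp[OF that] computable_intros)
qed (auto intro: semidecidable_conj semidecidable_disj)

section \<open>The systems of continuous and of computable functions on Baire space\<close>

text \<open>
  Continuous and computable realizers lead to the same argument: the reductions use computable
  realizers only, and the separations use continuity only.
\<close>

definition Kleene_system :: "((nat \<Rightarrow> nat) \<rightharpoonup> (nat \<Rightarrow> nat)) set \<Rightarrow> (nat \<Rightarrow> nat) coding_system" where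
  "Kleene_system R = K2\<lparr>realizable := R\<rparr>"

lemma K2_eq: "K2 = Kleene_system (range kapp)"
  by (simp add: Kleene_system_def K2_def)

lemma KV_eq: "KV = Kleene_system (kapp ` {p. computable p})"
  by (simp add: Kleene_system_def KV_def)

lemma Kleene_system_simps [simp]:
  "realizable (Kleene_system R) = R" "tuple (Kleene_system R) p q = join p q"
  "nat_name (Kleene_system R) n = (\<lambda>i. if i = 0 then n else 0)"
  "points (baire (Kleene_system R)) = UNIV" "names (baire (Kleene_system R)) p x \<longleftrightarrow> p = x"
  by (simp_all add: Kleene_system_def K2_def)

lemma tlc_0 [simp]: "tlc 0 = 0"
proof -
  have "0 = pr 0 0" by (simp add: prod_encode_def)
  then have "prod_decode 0 = (0, 0)" by (metis prod_encode_inverse)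
  then show ?thesis by (simp add: tlc_def)
qed

lemma funpow_tlc: "(tlc ^^ m) (list_encode ys) = list_encode (drop m ys)"
proof (induction m arbitrary: ys)
  case (Suc m)
  have "tlc (list_encode ys) = list_encode (drop 1 ys)"
    by (cases ys) (simp, simp del: list_encode.simps)
  then show ?case using Suc by (simp only: funpow_Suc_right o_apply drop_drop) simp
qed simp

text \<open>
  The associate answers as soon as the queried list is long enough.  Its first entry is the output
  position, and a list code becomes 0 precisely by removing as many entries as there are.
\<close>

lemma prefix_computable_realizable:
  assumes "prefix_computable t"
  shows "(\<lambda>c. Some (t c)) \<in> kapp ` {p. computable p}"
proof -
  obtain g a where g: "computable g"
    "\<And>x n L. (\<forall>i<a * Suc n. nthc L i = x i) \<Longrightarrow> t x n = g (pr n L)"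
    using assms unfolding prefix_computable_def by blast
  define p where "p L = (if (tlc ^^ (a * Suc (nthc L 0))) L \<noteq> 0
    then Suc (g (pr (nthc L 0) (tlc L))) else 0)" for L
  have tlc: "computable tlc" using computable_tlc[OF computable_id] .
  have p: "computable p" unfolding p_def[abs_def]
    by (intro computable_intros computable_funpow[OF tlc] computable_comp[OF g(1)])
  have query: "kquery p x n k = (if a * Suc n \<le> k then Suc (t x n) else 0)" for x n k
  proof -
    have "(tlc ^^ (a * Suc n)) (list_encode (n # map x [0..<k])) \<noteq> 0 \<longleftrightarrow> a * Suc n \<le> k"
      unfolding funpow_tlc by (metis list_encode_eq list_encode.simps(1) drop_eq_Nil length_Cons
          length_map length_upt minus_nat.diff_0 not_less_eq_eq)
    moreover have "t x n = g (pr n (list_encode (map x [0..<k])))" if "a * Suc n \<le> k"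
      using that by (intro g(2)) auto
    ultimately show ?thesis
      unfolding kquery_def p_def by (simp del: list_encode.simps mult_Suc_right)
  qed
  have least: "(LEAST k. 0 < kquery p x n k) = a * Suc n" for x n
    by (rule Least_equality) (simp_all add: query split: if_splits)
  have "kapp p x = Some (t x)" for x
  proof -
    have "\<forall>n. \<exists>k. 0 < kquery p x n k" by (auto simp: query)
    then show ?thesis unfolding kapp_def least by (simp add: query)
  qed
  then have "(\<lambda>c. Some (t c)) = kapp p" by (simp add: fun_eq_iff)
  then show ?thesis using p by simp
qed

lemma prefix_computable_id: "prefix_computable (\<lambda>x. x)"
  by (rule prefix_computableI[where a = 1 and g = "\<lambda>n L. nthc L n"]) (intro computable_intros, simp)

lemma prefix_computable_join:
  assumes "prefix_computable s" "prefix_computable t"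
  shows "prefix_computable (\<lambda>x. join (s x) (t x))"
proof -
  obtain g a where g: "computable g"
    "\<And>x n L. (\<forall>i<a * Suc n. nthc L i = x i) \<Longrightarrow> s x n = g (pr n L)"
    using assms(1) unfolding prefix_computable_def by blast
  obtain h b where h: "computable h"
    "\<And>x n L. (\<forall>i<b * Suc n. nthc L i = x i) \<Longrightarrow> t x n = h (pr n L)"
    using assms(2) unfolding prefix_computable_def by blast
  show ?thesis
  proof (rule prefix_computableI[where a = "a + b"])
    show "computable (\<lambda>y. if even (p1 y) then g (pr (p1 y div 2) (p2 y)) else h (pr (p1 y div 2) (p2 y)))"
      by (intro computable_intros computable_comp[OF g(1)] computable_comp[OF h(1)]) simp_all
    fix x n L assume L: "\<And>i. i < (a + b) * Suc n \<Longrightarrow> nthc L i = x i"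
    have "a * Suc (n div 2) \<le> (a + b) * Suc n" "b * Suc (n div 2) \<le> (a + b) * Suc n"
      by (intro mult_le_mono; simp)+
    then have "s x (n div 2) = g (pr (n div 2) L)" "t x (n div 2) = h (pr (n div 2) L)"
      using L by (intro g(2) h(2); meson order.strict_trans2)+
    then show "join (s x) (t x) n = (if even n then g (pr (n div 2) L) else h (pr (n div 2) L))"
      by (simp add: join_def)
  qed
qed

lemma join_even [simp]: "join p q (2 * i) = p i" and join_odd [simp]: "join p q (Suc (2 * i)) = q i"
  by (simp_all add: join_def)

lemma effective_Kleene_system:
  assumes "kapp ` {p. computable p} \<subseteq> R"
  shows "effective_coding (Kleene_system R) {t. prefix_computable t} (\<lambda>x i. x (2 * i)) (\<lambda>x i. x (Suc (2 * i)))"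
proof unfold_locales
  show "(\<lambda>c. Some (t c)) \<in> realizable (Kleene_system R)" if "t \<in> {t. prefix_computable t}" for t
    using that prefix_computable_realizable assms by auto
  show "(\<lambda>x i. x (2 * i)) \<in> {t. prefix_computable t}"
    by (auto intro!: prefix_computableI[where a = 2 and g = "\<lambda>n L. nthc L (2 * n)"] computable_intros)
  show "(\<lambda>x i. x (Suc (2 * i))) \<in> {t. prefix_computable t}"
    by (auto intro!: prefix_computableI[where a = 2 and g = "\<lambda>n L. nthc L (Suc (2 * n))"] computable_intros)
  show "\<exists>t\<in>{t. prefix_computable t}. \<forall>m n. t (tuple (Kleene_system R) (nat_name (Kleene_system R) m)
      (nat_name (Kleene_system R) n)) = nat_name (Kleene_system R) (f (pr m n))" if f: "computable f" for f
  proof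
    have "computable (\<lambda>y. if p1 y = 0 then f (pr (nthc (p2 y) 0) (nthc (p2 y) 1)) else 0)"
      by (intro computable_intros computable_comp[OF f])
    then show "(\<lambda>x i. if i = 0 then f (pr (x 0) (x 1)) else 0) \<in> {t. prefix_computable t}"
      by (auto intro!: prefix_computableI[where a = 2 and g = "\<lambda>n L. if n = 0 then f (pr (nthc L 0) (nthc L 1)) else 0"])
  qed (auto simp: join_def fun_eq_iff)
  show "nat_name (Kleene_system R) m = nat_name (Kleene_system R) n \<longleftrightarrow> m = n" for m n
    by (auto simp: fun_eq_iff)
  show "represented_space (baire (Kleene_system R))"
    by (simp add: represented_space_def)
qed (auto simp: prefix_computable_id prefix_computable_comp prefix_computable_join)

definition agree_below :: "nat \<Rightarrow> (nat \<Rightarrow> nat) \<Rightarrow> (nat \<Rightarrow> nat) \<Rightarrow> bool" where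
  "agree_below k p p' \<longleftrightarrow> (\<forall>i<k. p' i = p i)"

lemma agree_below_mono: "agree_below k p p' \<Longrightarrow> l \<le> k \<Longrightarrow> agree_below l p p'"
  by (simp add: agree_below_def)

text \<open>
  The value of an associate at a single output position, which may exist although the application
  is undefined as a whole.
\<close>

definition kval :: "(nat \<Rightarrow> nat) \<Rightarrow> (nat \<Rightarrow> nat) \<Rightarrow> nat \<Rightarrow> nat \<Rightarrow> bool" where
  "kval c x i v \<longleftrightarrow> (\<exists>k. kquery c x i k = Suc v \<and> (\<forall>l<k. kquery c x i l = 0))"

lemma kval_kapp:
  assumes "kapp c x = Some y" shows "kval c x i v \<longleftrightarrow> v = y i"
proof -
  define k where "k = (LEAST k. kquery c x i k > 0)"
  have ex: "\<exists>k. kquery c x i k > 0" and y: "y i = kquery c x i k - 1"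
    using assms by (auto simp: kapp_def k_def split: if_splits)
  have k: "kquery c x i k > 0" "\<And>l. l < k \<Longrightarrow> kquery c x i l = 0"
    using LeastI_ex[OF ex] not_less_Least unfolding k_def by auto
  show ?thesis
  proof
    assume "kval c x i v"
    then obtain l where l: "kquery c x i l = Suc v" "\<forall>m<l. kquery c x i m = 0" unfolding kval_def by blast
    then have "l = k" using k by (metis less_numeral_extra(3) linorder_neqE_nat nat.distinct(1))
    then show "v = y i" using l(1) y by simp
  next
    assume "v = y i"
    then show "kval c x i v" unfolding kval_def using k y by (intro exI[of _ k]) auto
  qed
qed

text \<open>
  A value rests on the finitely many entries of the argument that were queried.
\<close>

lemma kval_agree_below: "kval c x i v \<Longrightarrow> \<exists>k. \<forall>x'. agree_below k x x' \<longrightarrow> kval c x' i v"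
proof -
  assume "kval c x i v"
  then obtain k where k: "kquery c x i k = Suc v" "\<forall>l<k. kquery c x i l = 0" unfolding kval_def by blast
  have "kquery c x' i l = kquery c x i l" if "agree_below k x x'" "l \<le> k" for x' l
    using that by (auto simp: kquery_def agree_below_def intro!: arg_cong[of _ _ c] arg_cong[of _ _ list_encode])
  then have "kval c x' i v" if "agree_below k x x'" for x'
    unfolding kval_def using k that by (intro exI[of _ k]) auto
  then show ?thesis by blast
qed

text \<open>
  Application of a realizer that is defined everywhere stays within these maps, by \<open>kval_agree_below\<close>.
\<close>

definition continuous_maps :: "((nat \<Rightarrow> nat) \<Rightarrow> nat \<Rightarrow> (nat \<Rightarrow> nat) option) set" where
  "continuous_maps = {E. \<exists>e. E = (\<lambda>p n. Some (e p n)) \<and>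
     (\<forall>p n i. \<exists>k. \<forall>p'. agree_below k p p' \<longrightarrow> e p' n i = e p n i)}"

lemma continuous_mapsI:
  "(\<And>p n i. \<exists>k. \<forall>p'. agree_below k p p' \<longrightarrow> e p' n i = e p n i) \<Longrightarrow> (\<lambda>p n. Some (e p n)) \<in> continuous_maps"
  unfolding continuous_maps_def by blast

lemma continuous_mapsE:
  assumes "E \<in> continuous_maps"
  obtains e where "E = (\<lambda>p n. Some (e p n))" "\<And>p n i. \<exists>k. \<forall>p'. agree_below k p p' \<longrightarrow> e p' n i = e p n i"
    "\<And>p n m. \<exists>k. \<forall>p'. agree_below k p p' \<longrightarrow> agree_below m (e p n) (e p' n)"
proof -
  obtain e where E: "E = (\<lambda>p n. Some (e p n))"
    and e: "\<And>p n i. \<exists>k. \<forall>p'. agree_below k p p' \<longrightarrow> e p' n i = e p n i"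
    using assms unfolding continuous_maps_def by blast
  have "\<exists>k. \<forall>p'. agree_below k p p' \<longrightarrow> agree_below m (e p n) (e p' n)" for p n m
  proof (induction m)
    case (Suc m)
    obtain k where k: "\<forall>p'. agree_below k p p' \<longrightarrow> agree_below m (e p n) (e p' n)" using Suc by blast
    obtain l where l: "\<forall>p'. agree_below l p p' \<longrightarrow> e p' n m = e p n m" using e by blast
    have "agree_below (Suc m) (e p n) (e p' n)" if "agree_below (max k l) p p'" for p'
      using k[rule_format, OF agree_below_mono[OF that max.cobounded1]]
        l[rule_format, OF agree_below_mono[OF that max.cobounded2]]
      unfolding agree_below_def less_Suc_eq by auto
    then show ?case by blast
  qed (simp add: agree_below_def)
  then show thesis using that E e by blast
qed

definition open_pred :: "((nat \<Rightarrow> nat) \<Rightarrow> nat \<Rightarrow> bool) \<Rightarrow> bool" where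
  "open_pred P \<longleftrightarrow> (\<forall>p n. P p n \<longrightarrow> (\<exists>k. \<forall>p'. agree_below k p p' \<longrightarrow> P p' n))"

text \<open>
  A realizer may have several associates; where it is defined they all give the same values.
\<close>

definition kout :: "nat \<Rightarrow> ((nat \<Rightarrow> nat) \<rightharpoonup> (nat \<Rightarrow> nat)) \<Rightarrow> (nat \<Rightarrow> nat) \<Rightarrow> nat \<Rightarrow> bool" where
  "kout i r x v \<longleftrightarrow> (\<exists>c. r = kapp c \<and> kval c x i v)"

lemma kout_iff: "r \<in> range kapp \<Longrightarrow> r x = Some y \<Longrightarrow> kout i r x v \<longleftrightarrow> v = y i"
  unfolding kout_def using kval_kapp by blast

lemma open_pred_kout:
  assumes "E \<in> continuous_maps"
  shows "open_pred (\<lambda>p n. \<exists>c. E p n = Some c \<and> kout i r c (a n))"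
proof -
  obtain e where E: "E = (\<lambda>p n. Some (e p n))"
    and e: "\<And>p n m. \<exists>k. \<forall>p'. agree_below k p p' \<longrightarrow> agree_below m (e p n) (e p' n)"
    using continuous_mapsE[OF assms] by blast
  show ?thesis
    unfolding open_pred_def kout_def E
  proof (intro allI impI)
    fix p n assume "\<exists>c. Some (e p n) = Some c \<and> (\<exists>ca. r = kapp ca \<and> kval ca c i (a n))"
    then obtain c where c: "r = kapp c" "kval c (e p n) i (a n)" by blast
    obtain m where m: "\<forall>x'. agree_below m (e p n) x' \<longrightarrow> kval c x' i (a n)" using kval_agree_below[OF c(2)] by blast
    obtain k where "\<forall>p'. agree_below k p p' \<longrightarrow> agree_below m (e p n) (e p' n)" using e by blast
    then show "\<exists>k. \<forall>p'. agree_below k p p' \<longrightarrow> (\<exists>c. Some (e p' n) = Some c \<and> (\<exists>ca. r = kapp ca \<and> kval ca c i (a n)))"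
      using m c(1) by blast
  qed
qed

lemma open_pred_conj:
  assumes "open_pred P" "open_pred Q" shows "open_pred (\<lambda>p n. P p n \<and> Q p n)"
  unfolding open_pred_def
proof (intro allI impI)
  fix p n assume "P p n \<and> Q p n"
  then obtain k l where "\<forall>p'. agree_below k p p' \<longrightarrow> P p' n" "\<forall>p'. agree_below l p p' \<longrightarrow> Q p' n"
    using assms unfolding open_pred_def by blast
  then have "P p' n \<and> Q p' n" if "agree_below (max k l) p p'" for p'
    using agree_below_mono[OF that max.cobounded1] agree_below_mono[OF that max.cobounded2] by blast
  then show "\<exists>k. \<forall>p'. agree_below k p p' \<longrightarrow> P p' n \<and> Q p' n" by blast
qed

lemma continuous_maps_kapp:
  assumes "E \<in> continuous_maps" "\<And>p. kapp c p \<noteq> None"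
  shows "(\<lambda>p n. Option.bind (E p n) (kapp c)) \<in> continuous_maps"
proof -
  obtain e where E: "E = (\<lambda>p n. Some (e p n))"
    and e: "\<And>p n m. \<exists>k. \<forall>p'. agree_below k p p' \<longrightarrow> agree_below m (e p n) (e p' n)"
    using continuous_mapsE[OF assms(1)] by blast
  have value_at: "kval c x i v \<longleftrightarrow> v = the (kapp c x) i" for x i v
    by (rule kval_kapp) (use assms(2)[of x] in auto)
  have "(\<lambda>p n. Some (the (kapp c (e p n)))) \<in> continuous_maps"
  proof (rule continuous_mapsI)
    fix p n i
    obtain m where "\<forall>x'. agree_below m (e p n) x' \<longrightarrow> kval c x' i (the (kapp c (e p n)) i)"
      using kval_agree_below[of c "e p n" i "the (kapp c (e p n)) i"] value_at by auto
    then show "\<exists>k. \<forall>p'. agree_below k p p' \<longrightarrow> the (kapp c (e p' n)) i = the (kapp c (e p n)) i"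
      using e[where p = p and n = n and m = m] unfolding value_at by metis
  qed
  then show ?thesis using assms(2) by (simp add: E)
qed

lemma perturbable_Kleene_system:
  assumes "kapp ` {p. computable p} \<subseteq> R" "R \<subseteq> range kapp"
  shows "perturbable_coding (Kleene_system R) {t. prefix_computable t} (\<lambda>x i. x (2 * i)) (\<lambda>x i. x (Suc (2 * i)))
    continuous_maps open_pred (kout 0) (kout 1) (\<lambda>q i v. q i = v)"
proof -
  interpret effective_coding "Kleene_system R" "{t. prefix_computable t}" "\<lambda>x i. x (2 * i)" "\<lambda>x i. x (Suc (2 * i))"
    by (rule effective_Kleene_system[OF assms(1)])
  show ?thesis
  proof unfold_locales
    show "(\<lambda>p n. Some p) \<in> continuous_maps"
    proof (rule continuous_mapsI)
      show "\<exists>k. \<forall>p'. agree_below k p p' \<longrightarrow> p' i = p i" for p i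
        by (rule exI[of _ "Suc i"]) (simp add: agree_below_def)
    qed
    show "(\<lambda>p n. Some (nat_name (Kleene_system R) (a n))) \<in> continuous_maps" for a
      by (rule continuous_mapsI) simp
    show "(\<lambda>p n. Option.bind (E p n) (\<lambda>c. Option.bind (F p n) (\<lambda>d. Some (tuple (Kleene_system R) c d))))
        \<in> continuous_maps" if EF: "E \<in> continuous_maps" "F \<in> continuous_maps" for E F
    proof -
      obtain e where e: "E = (\<lambda>p n. Some (e p n))" "\<And>p n i. \<exists>k. \<forall>p'. agree_below k p p' \<longrightarrow> e p' n i = e p n i"
        using continuous_mapsE[OF EF(1)] by blast
      obtain f where f: "F = (\<lambda>p n. Some (f p n))" "\<And>p n i. \<exists>k. \<forall>p'. agree_below k p p' \<longrightarrow> f p' n i = f p n i"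
        using continuous_mapsE[OF EF(2)] by blast
      have "(\<lambda>p n. Some (join (e p n) (f p n))) \<in> continuous_maps"
      proof (rule continuous_mapsI)
        show "\<exists>k. \<forall>p'. agree_below k p p' \<longrightarrow> join (e p' n) (f p' n) i = join (e p n) (f p n) i" for p n i
          using e(2)[of p n "i div 2"] f(2)[of p n "i div 2"] by (simp add: join_def)
      qed
      then show ?thesis by (simp add: e(1) f(1))
    qed
    show "(\<lambda>p n. Option.bind (E p n) h) \<in> continuous_maps"
      if hyp: "E \<in> continuous_maps" "h \<in> realizable (Kleene_system R)"
        "\<And>p x. names (baire (Kleene_system R)) p x \<Longrightarrow> h p \<noteq> None" for E h
    proof -
      obtain c where "h = kapp c" using hyp(2) assms(2) by auto
      then show ?thesis using continuous_maps_kapp[OF hyp(1)] hyp(3) by simp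
    qed
    show "kout 0 r c l \<longleftrightarrow> l = k"
      if "r \<in> realizable (Kleene_system R)" "r c = Some (tuple (Kleene_system R) (nat_name (Kleene_system R) k) q)"
      for r c k q l
      using kout_iff[of r c _ 0 l] that assms(2) by (auto simp: join_def)
    show "kout 1 r c l \<longleftrightarrow> l = k"
      if "r \<in> realizable (Kleene_system R)" "r c = Some (tuple (Kleene_system R) u
        (tuple (Kleene_system R) (nat_name (Kleene_system R) k) q))"
      for r c k q u l
      using kout_iff[of r c _ 1 l] that assms(2) by (auto simp: join_def)
    show "open_pred (\<lambda>p n. \<exists>c. E p n = Some c \<and> c (a n) = b n)" if E: "E \<in> continuous_maps" for E a b
    proof -
      obtain e where "E = (\<lambda>p n. Some (e p n))" "\<And>p n i. \<exists>k. \<forall>p'. agree_below k p p' \<longrightarrow> e p' n i = e p n i"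
        using continuous_mapsE[OF E] by blast
      then show ?thesis unfolding open_pred_def by simp metis
    qed
    show "\<exists>p d s. names (baire (Kleene_system R)) p (z d s) \<and> S p d"
      if S: "open_pred S" and agree: "\<And>d s k. k < s \<Longrightarrow> z d s k = x k"
        and total: "\<And>p. names (baire (Kleene_system R)) p x \<Longrightarrow> \<exists>d. S p d" for S z x
    proof -
      obtain d where "S x d" using total by auto
      then obtain k where "\<forall>p'. agree_below k x p' \<longrightarrow> S p' d" using S unfolding open_pred_def by blast
      then have "S (z d k) d" using agree by (simp add: agree_below_def)
      then show ?thesis by auto
    qed
    show "open_pred (\<lambda>p n. P p n \<or> Q p n)" if "open_pred P" "open_pred Q" for P Q
      using that unfolding open_pred_def by metis
    show "open_pred (\<lambda>p n. D n)" for D by (simp add: open_pred_def)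
  qed (simp_all add: open_pred_kout open_pred_conj)
qed

section \<open>The strict chain of reductions\<close>

lemma (in perturbable_coding) reducibility_chain:
  "Fin C \<prec>\<^bsub>C\<^esub> BddSeq C \<and> BddSeq C \<prec>\<^bsub>C\<^esub> HalfTruth C \<and>
   HalfTruth C \<prec>\<^bsub>C\<^esub> DisConn C \<and> DisConn C \<prec>\<^bsub>C\<^esub> Truth C"
  unfolding m_less_def
  using Fin_reducible_BddSeq BddSeq_not_reducible_Fin
    BddSeq_reducible_HalfTruth HalfTruth_not_reducible_BddSeq
    HalfTruth_reducible_DisConn DisConn_not_reducible_HalfTruth
    DisConn_reducible_Truth Truth_not_reducible_DisConn
  by blast

theorem theorem5p46:
  shows "(Fin K1 \<prec>\<^bsub>K1\<^esub> BddSeq K1 \<and> BddSeq K1 \<prec>\<^bsub>K1\<^esub> HalfTruth K1 \<and>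
          HalfTruth K1 \<prec>\<^bsub>K1\<^esub> DisConn K1 \<and> DisConn K1 \<prec>\<^bsub>K1\<^esub> Truth K1) \<and>
         (Fin K2 \<prec>\<^bsub>K2\<^esub> BddSeq K2 \<and> BddSeq K2 \<prec>\<^bsub>K2\<^esub> HalfTruth K2 \<and>
          HalfTruth K2 \<prec>\<^bsub>K2\<^esub> DisConn K2 \<and> DisConn K2 \<prec>\<^bsub>K2\<^esub> Truth K2) \<and>
         (Fin KV \<prec>\<^bsub>KV\<^esub> BddSeq KV \<and> BddSeq KV \<prec>\<^bsub>KV\<^esub> HalfTruth KV \<and>
          HalfTruth KV \<prec>\<^bsub>KV\<^esub> DisConn KV \<and> DisConn KV \<prec>\<^bsub>KV\<^esub> Truth KV)"
  using K1.reducibility_chain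
    perturbable_coding.reducibility_chain[OF perturbable_Kleene_system, of "range kapp", folded K2_eq]
    perturbable_coding.reducibility_chain[OF perturbable_Kleene_system, of "kapp ` {p. computable p}", folded KV_eq]
  by auto

end
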